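(* Let $n \geq 2$ and, for $j = 1,\dots,n$, let $\Omega_j \subset \mathbb{R}^{d_j}$ with $d_j \in \mathbb{N}$ be open. Put $\Omega = \Omega_1 \times \dots \times \Omega_n \subset \mathbb{R}^d$ with $d = d_1 + \dots + d_n$. Let $\mathcal{H}_j = H^1(\Omega_j)$ for each $j$, and let $T$ be the self-adjoint operator on $L^2(\Omega)$ associated with $\mathcal{H}_1,\dots,\mathcal{H}_n$ (as defined in the context). Then $T = -\Delta_\Omega^N$, where $\Delta_\Omega^N$ is the Neumann Laplacian on $\Omega$. In particular, $H^1(\Omega) = \bigotimes_{j=1}^n H^1(\Omega_j)$.
   Context: All function spaces consist of complex-valued functions, and inner products are linear in the first argument. $H^1$ is the $L^2$-based first-order Sobolev space (functions in $L^2$ with first-order weak partial derivatives in $L^2$). For each $j$ let $\mathcal{H}_j$ be a closed subspace of $H^1(\Omega_j)$ that is dense in $L^2(\Omega_j)$. For $f_j \in \mathcal{H}_j$, the elementary tensor $\bigotimes_{j=1}^n f_j \in H^1(\Omega)$ is the function $(x_1,\dots,x_n) \mapsto \prod_{j=1}^n f_j(x_j)$, $x_j \in \Omega_j$. Let $\mathcal{K} = \operatorname{span}_{\mathbb{C}}\{ \bigotimes_{j=1}^n f_j : f_j \in \mathcal{H}_j \} \subset H^1(\Omega)$, and define $\mathcal{H} = \bigotimes_{j=1}^n \mathcal{H}_j$ to be the closure of $\mathcal{K}$ in $H^1(\Omega)$ (with respect to the $H^1(\Omega)$-norm). The form $\mathfrak{t}[f,g] = \sum_{k=1}^d \langle \partial_k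 f, \partial_k g \rangle_{L^2(\Omega)}$, $f,g \in \mathcal{H}$, is closed, nonnegative, and densely defined on $L^2(\Omega)$. $T$ denotes the unique nonnegative self-adjoint operator on $L^2(\Omega)$ with $\operatorname{Dom}(T) \subset \mathcal{H}$ and $\mathfrak{t}[f,g] = \langle Tf, g\rangle_{L^2(\Omega)}$ for all $f \in \operatorname{Dom}(T)$, $g \in \mathcal{H}$. The Neumann Laplacian $\Delta_\Omega^N$ is the Laplacian with form domain $H^1(\Omega)$, i.e. $-\Delta_\Omega^N$ is the unique nonnegative self-adjoint operator on $L^2(\Omega)$ with domain contained in $H^1(\Omega)$ and $\sum_{k=1}^d \langle \partial_k f, \partial_k g \rangle_{L^2(\Omega)} = \langle -\Delta_\Omega^N f, g\rangle_{L^2(\Omega)}$ for all $f \in \operatorname{Dom}(\Delta_\Omega^N)$, $g \in H^1(\Omega)$. Equality of unbounded operators includes equality of domains. *)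

theory Defs
  imports "HOL-Analysis.Analysis"
begin

text \<open>
  Since the dimensions \<open>d\<^sub>j\<close> vary with \<open>j\<close>, the space \<open>\<real>\<^sup>d\<close> is not a type here but the carrier
  \<open>{..<d} \<rightarrow>\<^sub>E UNIV\<close> of functions \<open>nat \<Rightarrow> real\<close>, with topology \<open>powertop_real {..<d}\<close>.
  Coordinates and factors are counted from \<open>0\<close>.
\<close>

type_synonym point = "nat \<Rightarrow> real"
type_synonym cfun = "point \<Rightarrow> complex"


section \<open>The Hilbert space \<open>L\<^sup>2(\<Omega>)\<close>\<close>

definition lebesgue_dom :: "nat \<Rightarrow> point set \<Rightarrow> point measure" where
  "lebesgue_dom d \<Omega> = restrict_space (\<Pi>\<^sub>M i\<in>{..<d}. lborel) \<Omega>"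

text \<open>
  Elements of \<open>L\<^sup>2(\<Omega>)\<close> are represented by functions rather than by classes of functions; only their
  values on \<open>\<Omega>\<close> matter, and those only up to null sets. Every Lebesgue measurable function agrees
  almost everywhere with a Borel measurable one, so no classes are lost.
\<close>

definition L2 :: "nat \<Rightarrow> point set \<Rightarrow> cfun set" where
  "L2 d \<Omega> = {f \<in> borel_measurable (lebesgue_dom d \<Omega>).
               integrable (lebesgue_dom d \<Omega>) (\<lambda>x. (cmod (f x))\<^sup>2)}"

definition l2_inner :: "nat \<Rightarrow> point set \<Rightarrow> cfun \<Rightarrow> cfun \<Rightarrow> complex" where
  "l2_inner d \<Omega> f g = (\<integral>x. f x * cnj (g x) \<partial>lebesgue_dom d \<Omega>)"

definition l2_norm :: "nat \<Rightarrow> point set \<Rightarrow> cfun \<Rightarrow> real" where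
  "l2_norm d \<Omega> f = sqrt (\<integral>x. (cmod (f x))\<^sup>2 \<partial>lebesgue_dom d \<Omega>)"

definition ae_eq :: "nat \<Rightarrow> point set \<Rightarrow> cfun \<Rightarrow> cfun \<Rightarrow> bool" where
  "ae_eq d \<Omega> f g \<longleftrightarrow> (AE x in lebesgue_dom d \<Omega>. f x = g x)"


section \<open>Weak derivatives and \<open>H\<^sup>1(\<Omega>)\<close>\<close>

definition pderiv_at :: "nat \<Rightarrow> cfun \<Rightarrow> cfun" where
  "pderiv_at k \<phi> x = vector_derivative (\<lambda>t. \<phi> (x(k := t))) (at (x k))"

fun C_k :: "nat \<Rightarrow> nat \<Rightarrow> cfun \<Rightarrow> bool" where
  "C_k d 0 \<phi> \<longleftrightarrow> continuous_map (powertop_real {..<d}) euclidean \<phi>"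
| "C_k d (Suc m) \<phi> \<longleftrightarrow>
     continuous_map (powertop_real {..<d}) euclidean \<phi> \<and>
     (\<forall>k<d. (\<forall>x\<in>{..<d} \<rightarrow>\<^sub>E UNIV. (\<lambda>t. \<phi> (x(k := t))) differentiable (at (x k))) \<and>
            C_k d m (pderiv_at k \<phi>))"

definition test_functions :: "nat \<Rightarrow> point set \<Rightarrow> cfun set" where
  "test_functions d \<Omega> = {\<phi>. (\<forall>m. C_k d m \<phi>) \<and>
     (\<exists>K. compactin (powertop_real {..<d}) K \<and> K \<subseteq> \<Omega> \<and>
          (\<forall>x\<in>({..<d} \<rightarrow>\<^sub>E UNIV) - K. \<phi> x = 0))}"

definition is_weak_pderiv :: "nat \<Rightarrow> point set \<Rightarrow> nat \<Rightarrow> cfun \<Rightarrow> cfun \<Rightarrow> bool" where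
  "is_weak_pderiv d \<Omega> k f g \<longleftrightarrow>
     (\<forall>\<phi>\<in>test_functions d \<Omega>.
        (\<integral>x. f x * pderiv_at k \<phi> x \<partial>lebesgue_dom d \<Omega>) = - (\<integral>x. g x * \<phi> x \<partial>lebesgue_dom d \<Omega>))"

definition H1 :: "nat \<Rightarrow> point set \<Rightarrow> cfun set" where
  "H1 d \<Omega> = {f \<in> L2 d \<Omega>. \<forall>k<d. \<exists>g\<in>L2 d \<Omega>. is_weak_pderiv d \<Omega> k f g}"

text \<open>The weak derivative is unique up to null sets, so the choice of representative is immaterial.\<close>

definition weak_pderiv :: "nat \<Rightarrow> point set \<Rightarrow> nat \<Rightarrow> cfun \<Rightarrow> cfun" where
  "weak_pderiv d \<Omega> k f = (SOME g. g \<in> L2 d \<Omega> \<and> is_weak_pderiv d \<Omega> k f g)"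

definition h1_norm :: "nat \<Rightarrow> point set \<Rightarrow> cfun \<Rightarrow> real" where
  "h1_norm d \<Omega> f =
     sqrt ((l2_norm d \<Omega> f)\<^sup>2 + (\<Sum>k<d. (l2_norm d \<Omega> (weak_pderiv d \<Omega> k f))\<^sup>2))"

definition h1_closure :: "nat \<Rightarrow> point set \<Rightarrow> cfun set \<Rightarrow> cfun set" where
  "h1_closure d \<Omega> K =
     {f \<in> H1 d \<Omega>. \<forall>\<epsilon>>0. \<exists>g\<in>K. h1_norm d \<Omega> (\<lambda>x. f x - g x) < \<epsilon>}"


section \<open>Product domains and tensor products\<close>

text \<open>\<open>block d j x\<close> is the component of \<open>x\<close> in \<open>\<real>\<^bsup>d j\<^esup>\<close> under \<open>\<real>\<^bsup>d 0 + \<dots> + d (n - 1)\<^esup> = \<real>\<^bsup>d 0\<^esup> \<times> \<dots> \<times> \<real>\<^bsup>d (n - 1)\<^esup>\<close>.\<close>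

definition block :: "(nat \<Rightarrow> nat) \<Rightarrow> nat \<Rightarrow> point \<Rightarrow> point" where
  "block d j x = (\<lambda>i\<in>{..<d j}. x ((\<Sum>l<j. d l) + i))"

definition total_dim :: "nat \<Rightarrow> (nat \<Rightarrow> nat) \<Rightarrow> nat" where
  "total_dim n d = (\<Sum>j<n. d j)"

definition prod_dom :: "nat \<Rightarrow> (nat \<Rightarrow> nat) \<Rightarrow> (nat \<Rightarrow> point set) \<Rightarrow> point set" where
  "prod_dom n d \<Omega> = {x \<in> {..<total_dim n d} \<rightarrow>\<^sub>E UNIV. \<forall>j<n. block d j x \<in> \<Omega> j}"

definition elem_tensor :: "nat \<Rightarrow> (nat \<Rightarrow> nat) \<Rightarrow> (nat \<Rightarrow> cfun) \<Rightarrow> cfun" where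
  "elem_tensor n d f = (\<lambda>x. \<Prod>j<n. f j (block d j x))"

definition tensor_span :: "nat \<Rightarrow> (nat \<Rightarrow> nat) \<Rightarrow> (nat \<Rightarrow> cfun set) \<Rightarrow> cfun set" where
  "tensor_span n d \<H> =
     {(\<lambda>x. \<Sum>i<m. c i * elem_tensor n d (F i) x) | (m :: nat) (c :: nat \<Rightarrow> complex) F.
        \<forall>i<m. \<forall>j<n. F i j \<in> \<H> j}"

definition tensor_space ::
    "nat \<Rightarrow> (nat \<Rightarrow> nat) \<Rightarrow> (nat \<Rightarrow> point set) \<Rightarrow> (nat \<Rightarrow> cfun set) \<Rightarrow> cfun set" where
  "tensor_space n d \<Omega> \<H> = h1_closure (total_dim n d) (prod_dom n d \<Omega>) (tensor_span n d \<H>)"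


section \<open>Unbounded operators on \<open>L\<^sup>2(\<Omega>)\<close>\<close>

text \<open>
  Operators are given by their graphs. As elements of \<open>L\<^sup>2(\<Omega>)\<close> are represented by functions, a graph
  is closed under almost everywhere equality, and it is single-valued only up to null sets. Thus
  equality of graphs is equality of the operators, including their domains.
\<close>

type_synonym operator = "(cfun \<times> cfun) set"

definition l2_operator :: "nat \<Rightarrow> point set \<Rightarrow> operator \<Rightarrow> bool" where
  "l2_operator d \<Omega> T \<longleftrightarrow>
     T \<subseteq> L2 d \<Omega> \<times> L2 d \<Omega> \<and>
     (\<lambda>x. 0, \<lambda>x. 0) \<in> T \<and>
     (\<forall>(f, h)\<in>T. \<forall>(f', h')\<in>T. (\<lambda>x. f x + f' x, \<lambda>x. h x + h' x) \<in> T) \<and>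
     (\<forall>(f, h)\<in>T. \<forall>c. (\<lambda>x. c * f x, \<lambda>x. c * h x) \<in> T) \<and>
     (\<forall>(f, h)\<in>T. \<forall>f'\<in>L2 d \<Omega>. \<forall>h'\<in>L2 d \<Omega>.
        ae_eq d \<Omega> f f' \<longrightarrow> ae_eq d \<Omega> h h' \<longrightarrow> (f', h') \<in> T) \<and>
     (\<forall>(f, h)\<in>T. \<forall>(f', h')\<in>T. ae_eq d \<Omega> f f' \<longrightarrow> ae_eq d \<Omega> h h')"

definition densely_defined :: "nat \<Rightarrow> point set \<Rightarrow> operator \<Rightarrow> bool" where
  "densely_defined d \<Omega> T \<longleftrightarrow>
     (\<forall>f\<in>L2 d \<Omega>. \<forall>\<epsilon>>0. \<exists>g\<in>Domain T. l2_norm d \<Omega> (\<lambda>x. f x - g x) < \<epsilon>)"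

definition adjoint_op :: "nat \<Rightarrow> point set \<Rightarrow> operator \<Rightarrow> operator" where
  "adjoint_op d \<Omega> T =
     {(g, k) \<in> L2 d \<Omega> \<times> L2 d \<Omega>. \<forall>(f, h)\<in>T. l2_inner d \<Omega> h g = l2_inner d \<Omega> f k}"

definition self_adjoint :: "nat \<Rightarrow> point set \<Rightarrow> operator \<Rightarrow> bool" where
  "self_adjoint d \<Omega> T \<longleftrightarrow>
     l2_operator d \<Omega> T \<and> densely_defined d \<Omega> T \<and> adjoint_op d \<Omega> T = T"

definition nonneg_op :: "nat \<Rightarrow> point set \<Rightarrow> operator \<Rightarrow> bool" where
  "nonneg_op d \<Omega> T \<longleftrightarrow>
     (\<forall>(f, h)\<in>T. Im (l2_inner d \<Omega> h f) = 0 \<and> 0 \<le> Re (l2_inner d \<Omega> h f))"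

definition neg_op :: "operator \<Rightarrow> operator" where
  "neg_op T = {(f, \<lambda>x. - h x) | f h. (f, h) \<in> T}"

definition dirichlet_form :: "nat \<Rightarrow> point set \<Rightarrow> cfun \<Rightarrow> cfun \<Rightarrow> complex" where
  "dirichlet_form d \<Omega> f g = (\<Sum>k<d. l2_inner d \<Omega> (weak_pderiv d \<Omega> k f) (weak_pderiv d \<Omega> k g))"

text \<open>
  \<open>form_operator d \<Omega> H T\<close>: \<open>T\<close> is the nonnegative self-adjoint operator of the Dirichlet form with
  form domain \<open>H\<close>.
\<close>

definition form_operator :: "nat \<Rightarrow> point set \<Rightarrow> cfun set \<Rightarrow> operator \<Rightarrow> bool" where
  "form_operator d \<Omega> H T \<longleftrightarrow>
     self_adjoint d \<Omega> T \<and> nonneg_op d \<Omega> T \<and> Domain T \<subseteq> H \<and>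
     (\<forall>(f, h)\<in>T. \<forall>g\<in>H. dirichlet_form d \<Omega> f g = l2_inner d \<Omega> h g)"

definition neumann_laplacian :: "nat \<Rightarrow> point set \<Rightarrow> operator \<Rightarrow> bool" where
  "neumann_laplacian d \<Omega> L \<longleftrightarrow> form_operator d \<Omega> (H1 d \<Omega>) (neg_op L)"

end

theory Submission
  imports Defs "HOL-Computational_Algebra.Polynomial"
begin

text \<open>
  Two nonnegative self-adjoint operators with the same form and the same form domain are restrictions
  of each other's adjoints, hence equal. So everything rests on the density of the span of elementary
  tensors in \<open>H\<^sup>1\<close>, and by induction on the number of factors on the case \<open>\<Omega> = \<Omega>\<^sub>1 \<times> \<Omega>\<^sub>2\<close>.

  Let \<open>w \<in> H\<^sup>1(\<Omega>)\<close> be orthogonal to all tensors and let \<open>R\<close> be the Riesz map with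
  \<open>\<langle>R f, g\<rangle> = \<langle>f, g\<rangle>\<close>, where the inner product on the left is that of \<open>H\<^sup>1(\<Omega>\<^sub>2)\<close> and the one on the
  right that of \<open>L\<^sup>2(\<Omega>\<^sub>2)\<close>. If \<open>e\<^sub>l\<close> is an orthonormal basis of \<open>H\<^sup>1(\<Omega>\<^sub>2)\<close>, then
  \<open>(1 \<otimes> R) w = \<Sum>\<^sub>l w\<^sub>l \<otimes> e\<^sub>l\<close> with \<open>w\<^sub>l(x) = \<langle>w(x, \<cdot>), e\<^sub>l\<rangle> \<in> H\<^sup>1(\<Omega>\<^sub>1)\<close>, a limit of tensors. Pairing it with \<open>w\<close>
  in \<open>H\<^sup>1(\<Omega>)\<close> gives \<open>0 = \<parallel>w\<parallel>\<^sup>2 + \<Sum>\<^sub>l \<parallel>\<nabla> w\<^sub>l\<parallel>\<^sup>2\<close>, with the norms of \<open>L\<^sup>2\<close>, and so \<open>w = 0\<close>.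

  To avoid completeness and infinite bases, \<open>w\<close> is only almost orthogonal to the tensors, and the \<open>e\<^sub>l\<close> span
  a finite-dimensional subspace of \<open>H\<^sup>1(\<Omega>\<^sub>2)\<close> through which \<open>w\<close> is approximated in \<open>L\<^sup>2(\<Omega>\<^sub>1; H\<^sup>1(\<Omega>\<^sub>2))\<close>.
\<close>

section \<open>Tuples of square-integrable functions\<close>

text \<open>The domains are arbitrary open sets, so functions in \<open>H^1\<close> need be neither
  extendable to the whole space nor limits of functions that are smooth up to the boundary.
  Smoothing them locally does not bring them near tensors, and this is why the argument is
  variational. Two features of R carry it. As 1 \<otimes> R acts on the second variable only, it
  commutes with derivatives in the first one, and being nonnegative on \<open>L^2\<close> it gives
  their part of the pairing a favourable sign. In the remaining part, the defining property of R
  trades the \<open>H^1\<close> inner product in the second variable for that of \<open>L^2\<close>,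
  and what is left is the norm of w itself. This controls w only in \<open>L^2\<close>, not its
  derivatives. The step to the \<open>H^1\<close> norm uses that the gradient is closable, that is,
  integration by parts against test functions that are dense in \<open>L^2\<close>; these are built
  from exp (- 1 / s).\<close>

definition sqi :: "'a measure \<Rightarrow> ('a \<Rightarrow> complex) \<Rightarrow> bool" where
  "sqi M f \<longleftrightarrow> f \<in> borel_measurable M \<and> integrable M (\<lambda>x. (cmod (f x))\<^sup>2)"

definition ip :: "'a measure \<Rightarrow> ('a \<Rightarrow> complex) \<Rightarrow> ('a \<Rightarrow> complex) \<Rightarrow> complex" where
  "ip M f g = (LINT x|M. f x * cnj (g x))"

definition tsp :: "'a measure \<Rightarrow> nat \<Rightarrow> (nat \<Rightarrow> 'a \<Rightarrow> complex) set" where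
  "tsp M N = {u. \<forall>k<N. sqi M (u k)}"

definition tip :: "'a measure \<Rightarrow> nat \<Rightarrow> (nat \<Rightarrow> 'a \<Rightarrow> complex) \<Rightarrow> (nat \<Rightarrow> 'a \<Rightarrow> complex) \<Rightarrow> complex" where
  "tip M N u v = (\<Sum>k<N. ip M (u k) (v k))"

definition tnorm :: "'a measure \<Rightarrow> nat \<Rightarrow> (nat \<Rightarrow> 'a \<Rightarrow> complex) \<Rightarrow> real" where
  "tnorm M N u = sqrt (Re (tip M N u u))"

definition nrm :: "'a measure \<Rightarrow> ('a \<Rightarrow> complex) \<Rightarrow> real" where
  "nrm M f = sqrt (Re (ip M f f))"

lemma borel_measurable_cnj [measurable (raw)]:
  "f \<in> borel_measurable M \<Longrightarrow> (\<lambda>x. cnj (f x)) \<in> borel_measurable M"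
  by (rule measurable_compose[OF _ borel_measurable_continuous_onI]) (auto intro: continuous_intros)

lemma sqi_integrable_mult_cnj:
  assumes "sqi M f" "sqi M g"
  shows "integrable M (\<lambda>x. f x * cnj (g x))"
proof (rule Bochner_Integration.integrable_bound)
  show "integrable M (\<lambda>x. (cmod (f x))\<^sup>2 + (cmod (g x))\<^sup>2)"
    using assms by (auto simp: sqi_def)
  have "cmod (f x) * cmod (g x) \<le> (cmod (f x))\<^sup>2 + (cmod (g x))\<^sup>2" for x
  proof -
    have "2 * (cmod (f x) * cmod (g x)) \<le> (cmod (f x))\<^sup>2 + (cmod (g x))\<^sup>2"
      using sum_squares_bound[of "cmod (f x)" "cmod (g x)"] by (simp add: mult.assoc)
    then show ?thesis
      by (smt (verit) mult_nonneg_nonneg norm_ge_zero)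
  qed
  then show "AE x in M. norm (f x * cnj (g x)) \<le> norm ((cmod (f x))\<^sup>2 + (cmod (g x))\<^sup>2)"
    by (auto simp: norm_mult)
qed (use assms in \<open>auto simp: sqi_def\<close>)

lemma sqi_zero [simp]: "sqi M (\<lambda>x. 0)"
  by (simp add: sqi_def)

lemma sqi_scale: "sqi M f \<Longrightarrow> sqi M (\<lambda>x. c * f x)"
  by (auto simp: sqi_def norm_mult power_mult_distrib)

lemma sqi_cnj: "sqi M f \<Longrightarrow> sqi M (\<lambda>x. cnj (f x))"
  by (auto simp: sqi_def)

lemma sqi_integrable_mult: "sqi M f \<Longrightarrow> sqi M g \<Longrightarrow> integrable M (\<lambda>x. f x * g x)"
  using sqi_integrable_mult_cnj[of M f "\<lambda>x. cnj (g x)"] sqi_cnj[of M g] by simp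

lemma sqi_add:
  assumes "sqi M f" "sqi M g"
  shows "sqi M (\<lambda>x. f x + g x)"
  unfolding sqi_def
proof
  have [measurable]: "f \<in> borel_measurable M" "g \<in> borel_measurable M"
    using assms by (auto simp: sqi_def)
  show "(\<lambda>x. f x + g x) \<in> borel_measurable M" by simp
  show "integrable M (\<lambda>x. (cmod (f x + g x))\<^sup>2)"
  proof (rule Bochner_Integration.integrable_bound)
    show "integrable M (\<lambda>x. 2 * (cmod (f x))\<^sup>2 + 2 * (cmod (g x))\<^sup>2)"
      using assms by (auto simp: sqi_def)
    have "(cmod (f x + g x))\<^sup>2 \<le> 2 * (cmod (f x))\<^sup>2 + 2 * (cmod (g x))\<^sup>2" for x
    proof -
      have "(cmod (f x + g x))\<^sup>2 \<le> (cmod (f x) + cmod (g x))\<^sup>2"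
        by (simp add: norm_triangle_ineq power_mono)
      also have "\<dots> \<le> 2 * (cmod (f x))\<^sup>2 + 2 * (cmod (g x))\<^sup>2"
        using sum_squares_bound[of "cmod (f x)" "cmod (g x)"] by (simp add: power2_sum)
      finally show ?thesis .
    qed
    then show "AE x in M. norm ((cmod (f x + g x))\<^sup>2)
        \<le> norm (2 * (cmod (f x))\<^sup>2 + 2 * (cmod (g x))\<^sup>2)"
      by auto
  qed simp
qed

lemma sqi_diff: "sqi M f \<Longrightarrow> sqi M g \<Longrightarrow> sqi M (\<lambda>x. f x - g x)"
  using sqi_add[of M f "\<lambda>x. - 1 * g x"] sqi_scale[of M g "-1"] by simp

lemma sqi_sum: "(\<And>i. i \<in> I \<Longrightarrow> sqi M (f i)) \<Longrightarrow> sqi M (\<lambda>x. \<Sum>i\<in>I. f i x)"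
  by (induction I rule: infinite_finite_induct) (auto intro!: sqi_add)

lemma ip_swap: "ip M g f = cnj (ip M f g)"
  unfolding ip_def by (subst Bochner_Integration.integral_cnj[symmetric]) (simp add: mult.commute del: Bochner_Integration.integral_cnj)

lemma ip_add_left: "sqi M f \<Longrightarrow> sqi M g \<Longrightarrow> sqi M h \<Longrightarrow>
    ip M (\<lambda>x. f x + g x) h = ip M f h + ip M g h"
  by (simp add: ip_def distrib_right sqi_integrable_mult_cnj)

lemma ip_scale_left: "ip M (\<lambda>x. c * f x) g = c * ip M f g"
  by (simp add: ip_def mult.assoc)

lemma tsp_zero: "(\<lambda>k x. 0) \<in> tsp M N"
  by (simp add: tsp_def)

lemma tsp_add: "u \<in> tsp M N \<Longrightarrow> v \<in> tsp M N \<Longrightarrow> (\<lambda>k x. u k x + v k x) \<in> tsp M N"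
  by (auto simp: tsp_def intro: sqi_add)

lemma tsp_diff: "u \<in> tsp M N \<Longrightarrow> v \<in> tsp M N \<Longrightarrow> (\<lambda>k x. u k x - v k x) \<in> tsp M N"
  by (auto simp: tsp_def intro: sqi_diff)

lemma tsp_scale: "u \<in> tsp M N \<Longrightarrow> (\<lambda>k x. c * u k x) \<in> tsp M N"
  by (auto simp: tsp_def intro: sqi_scale)

lemma tsp_sum: "(\<And>i. i \<in> I \<Longrightarrow> u i \<in> tsp M N) \<Longrightarrow> (\<lambda>k x. \<Sum>i\<in>I. u i k x) \<in> tsp M N"
  by (auto simp: tsp_def intro!: sqi_sum)

lemma tip_swap: "tip M N v u = cnj (tip M N u v)"
  unfolding tip_def by (simp add: ip_swap[of M "v _" "u _"])

lemma tip_add_left: "u \<in> tsp M N \<Longrightarrow> v \<in> tsp M N \<Longrightarrow> w \<in> tsp M N \<Longrightarrow>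
    tip M N (\<lambda>k x. u k x + v k x) w = tip M N u w + tip M N v w"
  by (auto simp: tip_def tsp_def ip_add_left sum.distrib[symmetric])

lemma tip_scale_left: "tip M N (\<lambda>k x. c * u k x) v = c * tip M N u v"
  by (simp add: tip_def ip_scale_left sum_distrib_left)

lemma tip_diff_left: "u \<in> tsp M N \<Longrightarrow> v \<in> tsp M N \<Longrightarrow> w \<in> tsp M N \<Longrightarrow>
    tip M N (\<lambda>k x. u k x - v k x) w = tip M N u w - tip M N v w"
  using tip_add_left[of u M N "\<lambda>k x. - 1 * v k x" w] tsp_scale[of v M N "-1"]
    tip_scale_left[of M N "-1" v w] by simp

lemma tip_zero_left [simp]: "tip M N (\<lambda>k x. 0) v = 0"
  by (simp add: tip_def ip_def)

lemma tip_sum_left: "(\<And>i. i \<in> I \<Longrightarrow> u i \<in> tsp M N) \<Longrightarrow> w \<in> tsp M N \<Longrightarrow>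
    tip M N (\<lambda>k x. \<Sum>i\<in>I. u i k x) w = (\<Sum>i\<in>I. tip M N (u i) w)"
proof (induction I rule: infinite_finite_induct)
  case (insert i I)
  then show ?case
    using tip_add_left[of "u i" M N "\<lambda>k x. \<Sum>i\<in>I. u i k x" w] tsp_sum[of I u M N] by simp
qed auto

lemma tip_diff_right: "u \<in> tsp M N \<Longrightarrow> v \<in> tsp M N \<Longrightarrow> w \<in> tsp M N \<Longrightarrow>
    tip M N w (\<lambda>k x. u k x - v k x) = tip M N w u - tip M N w v"
  by (subst (1 2 3) tip_swap) (simp add: tip_diff_left)

lemma tip_scale_right: "tip M N v (\<lambda>k x. c * u k x) = cnj c * tip M N v u"
  by (subst (1 2) tip_swap) (simp add: tip_scale_left)

lemma tip_sum_right: "(\<And>i. i \<in> I \<Longrightarrow> u i \<in> tsp M N) \<Longrightarrow> w \<in> tsp M N \<Longrightarrow>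
    tip M N w (\<lambda>k x. \<Sum>i\<in>I. u i k x) = (\<Sum>i\<in>I. tip M N w (u i))"
  by (subst (1 2) tip_swap) (simp add: tip_sum_left)

lemma ip_self: "ip M f f = of_real (LINT x|M. (cmod (f x))\<^sup>2)"
  by (simp add: ip_def complex_norm_square[symmetric] flip: of_real_power)

lemma nrm_power2: "(nrm M f)\<^sup>2 = (LINT x|M. (cmod (f x))\<^sup>2)"
  by (simp add: nrm_def ip_self)

lemma nrm_nonneg [simp]: "0 \<le> nrm M f"
  by (simp add: nrm_def ip_self)

lemma tip_self: "tip M N u u = of_real ((tnorm M N u)\<^sup>2)"
  by (simp add: tnorm_def tip_def ip_self sum_nonneg)

lemma tnorm_power2: "(tnorm M N u)\<^sup>2 = (\<Sum>k<N. (nrm M (u k))\<^sup>2)"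
  unfolding nrm_power2 by (simp add: tnorm_def tip_def ip_self sum_nonneg)

lemma tnorm_nonneg [simp]: "0 \<le> tnorm M N u"
  by (simp add: tnorm_def tip_def ip_self sum_nonneg)

lemma nrm_le_tnorm: "k < N \<Longrightarrow> nrm M (u k) \<le> tnorm M N u"
  by (rule power2_le_imp_le) (auto simp: tnorm_power2 intro!: member_le_sum[of k])

lemma tnorm_scale: "tnorm M N (\<lambda>k x. c * u k x) = cmod c * tnorm M N u"
proof -
  have "tip M N (\<lambda>k x. c * u k x) (\<lambda>k x. c * u k x) = of_real ((cmod c * tnorm M N u)\<^sup>2)"
    by (simp add: tip_scale_left tip_scale_right tip_self power_mult_distrib
        complex_norm_square[unfolded of_real_power] mult.assoc[symmetric])
  then show ?thesis
    by (simp add: tnorm_def[of M N "\<lambda>k x. c * u k x"])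
qed

lemma tnorm_diff_power2:
  assumes "u \<in> tsp M N" "v \<in> tsp M N"
  shows "(tnorm M N (\<lambda>k x. u k x - v k x))\<^sup>2 =
    (tnorm M N u)\<^sup>2 - 2 * Re (tip M N u v) + (tnorm M N v)\<^sup>2"
proof -
  have "tip M N (\<lambda>k x. u k x - v k x) (\<lambda>k x. u k x - v k x) =
     tip M N u u - (tip M N u v + cnj (tip M N u v)) + tip M N v v"
    using assms by (simp add: tip_diff_left tip_diff_right tsp_diff tip_swap[of M N v u])
  then have "Re (tip M N (\<lambda>k x. u k x - v k x) (\<lambda>k x. u k x - v k x)) =
     Re (tip M N u u) - 2 * Re (tip M N u v) + Re (tip M N v v)"
    by simp
  then show ?thesis unfolding tip_self by (simp del: of_real_power)
qed

lemma tip_Cauchy_Schwarz: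
  assumes u: "u \<in> tsp M N" and v: "v \<in> tsp M N"
  shows "cmod (tip M N u v) \<le> tnorm M N u * tnorm M N v"
proof -
  define A where "A = (tnorm M N u)\<^sup>2"
  define B where "B = (cmod (tip M N u v))\<^sup>2"
  define C where "C = (tnorm M N v)\<^sup>2"
  \<comment> \<open>The squared norm of u - c v for c = t <u, v>; putting <u, v> into the
    coefficient makes the whole expression a real quadratic in t.\<close>
  have key: "0 \<le> A - 2 * t * B + t\<^sup>2 * B * C" for t :: real
  proof -
    define c where "c = of_real t * tip M N u v"
    have "0 \<le> (tnorm M N (\<lambda>k x. u k x - c * v k x))\<^sup>2" by simp
    also have "\<dots> = A - 2 * Re (cnj c * tip M N u v) + (cmod c)\<^sup>2 * C"
      using tnorm_diff_power2[OF u tsp_scale[OF v, of c]]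
      by (simp add: A_def C_def tip_scale_right tnorm_scale power_mult_distrib)
    also have "cnj c * tip M N u v = of_real (t * B)"
      unfolding c_def B_def by (simp add: complex_norm_square[unfolded of_real_power] mult.commute mult.left_commute)
    also have "(cmod c)\<^sup>2 = t\<^sup>2 * B"
      by (simp add: c_def B_def norm_mult power_mult_distrib)
    finally show ?thesis by simp
  qed
  have "B \<le> A * C"
  proof (cases "C = 0")
    case True
    \<comment> \<open>Tuples are not identified up to null sets, so norm 0 does not mean v = 0. With
      C = 0 the quadratic degenerates to A - 2 t B, and the t chosen here would give it the value
      -1.\<close>
    have "B = 0"
    proof (rule ccontr)
      assume "B \<noteq> 0"
      then have "B > 0" by (simp add: B_def)
      then show False
        using key[of "(A + 1) / (2 * B)"] True by (simp add: field_simps)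
    qed
    then show ?thesis using True by simp
  next
    case False
    then have "C > 0" by (simp add: C_def)
    then show ?thesis
      using key[of "1 / C"] by (simp add: field_simps power2_eq_square)
  qed
  then show ?thesis
    unfolding A_def B_def C_def
    by (metis mult_nonneg_nonneg power2_le_imp_le power_mult_distrib tnorm_nonneg)
qed

lemma tnorm_diff_le:
  assumes "u \<in> tsp M N" "v \<in> tsp M N"
  shows "tnorm M N (\<lambda>k x. u k x - v k x) \<le> tnorm M N u + tnorm M N v"
proof (rule power2_le_imp_le)
  show "(tnorm M N (\<lambda>k x. u k x - v k x))\<^sup>2 \<le> (tnorm M N u + tnorm M N v)\<^sup>2"
    unfolding tnorm_diff_power2[OF assms] power2_sum
    using tip_Cauchy_Schwarz[OF assms] abs_Re_le_cmod[of "tip M N u v"] by linarith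
qed simp

lemma tnorm_add_le:
  assumes "u \<in> tsp M N" "v \<in> tsp M N"
  shows "tnorm M N (\<lambda>k x. u k x + v k x) \<le> tnorm M N u + tnorm M N v"
  using tnorm_diff_le[OF assms(1) tsp_scale[OF assms(2), of "-1"]] tnorm_scale[of M N "-1" v]
  by simp

lemma tnorm_sum_le:
  "(\<And>i. i \<in> I \<Longrightarrow> u i \<in> tsp M N) \<Longrightarrow>
    tnorm M N (\<lambda>k x. \<Sum>i\<in>I. u i k x) \<le> (\<Sum>i\<in>I. tnorm M N (u i))"
proof (induction I rule: infinite_finite_induct)
  case (insert i I)
  then show ?case
    using tnorm_add_le[of "u i" M N "\<lambda>k x. \<Sum>i\<in>I. u i k x"] tsp_sum[of I u M N] by fastforce
qed (auto simp: tnorm_def)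

text \<open>A single function is a tuple of length one, so what holds for \<open>tip\<close> and
  \<open>tnorm\<close> specializes to \<open>ip\<close> and \<open>nrm\<close>.\<close>

lemma tsp_1: "sqi M f \<Longrightarrow> (\<lambda>_. f) \<in> tsp M (Suc 0)"
  by (simp add: tsp_def)

lemma tip_1: "tip M (Suc 0) (\<lambda>_. f) (\<lambda>_. g) = ip M f g"
  by (simp add: tip_def)

lemma tnorm_1: "tnorm M (Suc 0) (\<lambda>_. f) = nrm M f"
  by (simp add: tnorm_def nrm_def tip_def)

lemma ip_Cauchy_Schwarz: "sqi M f \<Longrightarrow> sqi M g \<Longrightarrow> cmod (ip M f g) \<le> nrm M f * nrm M g"
  using tip_Cauchy_Schwarz[OF tsp_1 tsp_1, of M f g] by (simp add: tip_1 tnorm_1)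

lemma nrm_add_le: "sqi M f \<Longrightarrow> sqi M g \<Longrightarrow> nrm M (\<lambda>x. f x + g x) \<le> nrm M f + nrm M g"
  using tnorm_add_le[OF tsp_1 tsp_1, of M f g] by (simp add: tnorm_1)

lemma nrm_diff_le: "sqi M f \<Longrightarrow> sqi M g \<Longrightarrow> nrm M (\<lambda>x. f x - g x) \<le> nrm M f + nrm M g"
  using tnorm_diff_le[OF tsp_1 tsp_1, of M f g] by (simp add: tnorm_1)

lemma nrm_scale: "nrm M (\<lambda>x. c * f x) = cmod c * nrm M f"
  using tnorm_scale[of M "Suc 0" c "\<lambda>_. f"] by (simp add: tnorm_1)

lemma ip_diff_left: "sqi M f \<Longrightarrow> sqi M g \<Longrightarrow> sqi M h \<Longrightarrow>
    ip M (\<lambda>x. f x - g x) h = ip M f h - ip M g h"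
  using tip_diff_left[OF tsp_1 tsp_1 tsp_1, of M f g h] by (simp add: tip_1)

lemma ip_diff_right: "sqi M f \<Longrightarrow> sqi M g \<Longrightarrow> sqi M h \<Longrightarrow>
    ip M h (\<lambda>x. f x - g x) = ip M h f - ip M h g"
  using tip_diff_right[OF tsp_1 tsp_1 tsp_1, of M f g h] by (simp add: tip_1)

lemma ip_sum_left: "(\<And>i. i \<in> I \<Longrightarrow> sqi M (f i)) \<Longrightarrow> sqi M h \<Longrightarrow>
    ip M (\<lambda>x. \<Sum>i\<in>I. f i x) h = (\<Sum>i\<in>I. ip M (f i) h)"
  using tip_sum_left[of I "\<lambda>i _. f i" M "Suc 0" "\<lambda>_. h"] by (simp add: tip_1 tsp_1)

lemma ip_sum_right: "(\<And>i. i \<in> I \<Longrightarrow> sqi M (f i)) \<Longrightarrow> sqi M h \<Longrightarrow>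
    ip M h (\<lambda>x. \<Sum>i\<in>I. f i x) = (\<Sum>i\<in>I. ip M h (f i))"
  by (subst (1 2) ip_swap) (simp add: ip_sum_left)

section \<open>Subspaces of tuples: orthonormalization and a density criterion\<close>

locale tsubspace =
  fixes M :: "'a measure" and N :: nat and V :: "(nat \<Rightarrow> 'a \<Rightarrow> complex) set"
  assumes sub: "V \<subseteq> tsp M N"
    and zero: "(\<lambda>k x. 0) \<in> V"
    and add: "u \<in> V \<Longrightarrow> v \<in> V \<Longrightarrow> (\<lambda>k x. u k x + v k x) \<in> V"
    and scale: "u \<in> V \<Longrightarrow> (\<lambda>k x. c * u k x) \<in> V"
begin

lemma tsp: "u \<in> V \<Longrightarrow> u \<in> tsp M N"
  using sub by auto

lemma diff: "u \<in> V \<Longrightarrow> v \<in> V \<Longrightarrow> (\<lambda>k x. u k x - v k x) \<in> V"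
  using add[of u "\<lambda>k x. - 1 * v k x"] scale[of v "-1"] by simp

lemma sum: "(\<And>i. i \<in> I \<Longrightarrow> u i \<in> V) \<Longrightarrow> (\<lambda>k x. \<Sum>i\<in>I. u i k x) \<in> V"
  by (induction I rule: infinite_finite_induct) (auto simp: zero intro!: add)

lemma tip_lincomb_left:
  assumes "\<And>i. i \<in> I \<Longrightarrow> e i \<in> V" "w \<in> V"
  shows "tip M N (\<lambda>k x. \<Sum>i\<in>I. c i * e i k x) w = (\<Sum>i\<in>I. c i * tip M N (e i) w)"
  using assms tip_sum_left[of I "\<lambda>i k x. c i * e i k x" M N w]
  by (simp add: tip_scale_left tsp scale)

text \<open>Residuals need not vanish: a tuple of norm \<open>0\<close> is only almost everywhere \<open>0\<close>.\<close>

lemma Gram_Schmidt: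
  assumes "set gs \<subseteq> V"
  shows "\<exists>(m::nat) e. (\<forall>l<m. e l \<in> V) \<and> (\<forall>l<m. \<forall>l'<m. tip M N (e l) (e l') = (if l = l' then 1 else 0)) \<and>
    (\<forall>g\<in>set gs. tnorm M N (\<lambda>k x. g k x - (\<Sum>l<m. tip M N g (e l) * e l k x)) = 0)"
  using assms
proof (induction gs)
  case Nil
  show ?case by (rule exI[of _ 0]) simp
next
  case (Cons g gs)
  obtain m :: nat and e where e: "\<forall>l<m. e l \<in> V"
    and on: "\<forall>l<m. \<forall>l'<m. tip M N (e l) (e l') = (if l = l' then 1 else 0)"
    and res: "\<forall>g\<in>set gs. tnorm M N (\<lambda>k x. g k x - (\<Sum>l<m. tip M N g (e l) * e l k x)) = 0"
    using Cons by auto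
  have gV: "g \<in> V" using Cons by auto
  define R where "R g = (\<lambda>k x. g k x - (\<Sum>l<m. tip M N g (e l) * e l k x))" for g
  have RV: "R g \<in> V" if "g \<in> V" for g
    unfolding R_def using e by (intro diff that sum scale) auto
  have Re: "tip M N (R g) (e l) = 0" if "g \<in> V" "l < m" for g l
  proof -
    have "tip M N (R g) (e l) = tip M N g (e l) - (\<Sum>l'<m. tip M N g (e l') * tip M N (e l') (e l))"
      unfolding R_def using e that
      by (subst tip_diff_left) (auto intro!: tsp sum scale tip_lincomb_left)
    also have "(\<Sum>l'<m. tip M N g (e l') * tip M N (e l') (e l)) = (\<Sum>l'<m. if l' = l then tip M N g (e l') else 0)"
      using on that by (intro sum.cong) auto
    also have "\<dots> = tip M N g (e l)" using that by simp
    finally show ?thesis by simp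
  qed
  show ?case
  proof (cases "tnorm M N (R g) = 0")
    case True
    then show ?thesis
      using e on res by (intro exI[of _ m] exI[of _ e]) (auto simp: R_def)
  next
    case False
    define r where "r = tnorm M N (R g)"
    have r: "r \<noteq> 0" using False by (simp add: r_def)
    define h where "h = (\<lambda>k x. complex_of_real (inverse r) * R g k x)"
    define e' where "e' = e(m := h)"
    have hV: "h \<in> V" unfolding h_def by (intro scale RV gV)
    have hh: "tip M N h h = 1"
      unfolding tip_self h_def tnorm_scale using r by (simp add: r_def norm_inverse power2_eq_square)
    have he: "tip M N h (e l) = 0" if "l < m" for l
      unfolding h_def by (simp add: tip_scale_left Re gV that)
    have eh: "tip M N (e l) h = 0" if "l < m" for l
      using he[OF that] by (subst tip_swap) simp
    \<comment> \<open>As h is orthogonal to the old \<open>e l\<close>, only the residual of g'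
      contributes. For g' treated earlier that residual has norm 0, so its new coefficient vanishes
      and its expansion stays as it was.\<close>
    have gh: "tip M N g' h = tip M N (R g') h" if "g' \<in> V" for g'
    proof -
      have "tip M N (R g') h = tip M N g' h - (\<Sum>l<m. tip M N g' (e l) * tip M N (e l) h)"
        unfolding R_def using e that hV
        by (subst tip_diff_left) (auto intro!: tsp sum scale tip_lincomb_left)
      then show ?thesis using eh by simp
    qed
    have e'V: "\<forall>l<Suc m. e' l \<in> V"
      using e hV by (auto simp: e'_def)
    have on': "\<forall>l<Suc m. \<forall>l'<Suc m. tip M N (e' l) (e' l') = (if l = l' then 1 else 0)"
      using on hh he eh by (auto simp: e'_def less_Suc_eq)
    have split: "(\<lambda>k x. g' k x - (\<Sum>l<Suc m. tip M N g' (e' l) * e' l k x)) =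
        (\<lambda>k x. R g' k x - tip M N g' h * h k x)" for g'
      by (auto simp: e'_def R_def fun_eq_iff)
    have "tip M N g h = of_real r"
      using gh[OF gV] r
      unfolding h_def tip_scale_right by (simp add: tip_self r_def[symmetric] power2_eq_square)
    then have 1: "tnorm M N (\<lambda>k x. R g k x - tip M N g h * h k x) = 0"
      using r tnorm_scale[of M N 0 "\<lambda>_ _. 0"] by (simp add: h_def mult.assoc[symmetric] flip: of_real_mult)
    have 2: "tnorm M N (\<lambda>k x. R g' k x - tip M N g' h * h k x) = 0" if "g' \<in> set gs" for g'
    proof -
      have g'V: "g' \<in> V" using that Cons by auto
      have "tnorm M N (R g') = 0" using res that by (simp add: R_def)
      then have "tip M N g' h = 0"
        using gh[OF g'V] tip_Cauchy_Schwarz[OF tsp[OF RV[OF g'V]] tsp[OF hV]] by simp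
      then show ?thesis using res that by (simp add: R_def)
    qed
    show ?thesis
      using e'V on' 1 2 unfolding split[symmetric]
      by (intro exI[of _ "Suc m"] exI[of _ e']) auto
  qed
qed

text \<open>
  This replaces orthogonal projection, and so avoids completeness: a minimizing sequence for the
  distance of \<open>u\<close> from \<open>K\<close> has residuals that are almost orthogonal to \<open>K\<close>, hence small in the
  component \<open>0\<close>, hence weakly small.
\<close>

lemma dense_if_almost_orthogonal_small:
  assumes K: "tsubspace M N K" "K \<subseteq> V"
    and small: "\<And>w \<delta>. w \<in> V \<Longrightarrow> 0 \<le> \<delta> \<Longrightarrow> (\<And>k. k \<in> K \<Longrightarrow> Re (tip M N w k) \<le> \<delta> * tnorm M N k) \<Longrightarrow>
        (nrm M (w 0))\<^sup>2 \<le> \<delta> * tnorm M N w"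
    and weak: "\<And>w \<epsilon>. w \<in> V \<Longrightarrow> 0 < \<epsilon> \<Longrightarrow>
        \<exists>A\<ge>0. \<forall>v\<in>V. cmod (tip M N w v) \<le> \<epsilon> * tnorm M N v + A * nrm M (v 0)"
    and u: "u \<in> V" and \<epsilon>: "0 < \<epsilon>"
  shows "\<exists>k\<in>K. tnorm M N (\<lambda>i x. u i x - k i x) < \<epsilon>"
proof -
  interpret K: tsubspace M N K by (rule K)
  define D where "D k = (tnorm M N (\<lambda>i x. u i x - k i x))\<^sup>2" for k
  define I where "I = Inf (D ` K)"
  have bdd: "bdd_below (D ` K)" by (auto simp: D_def intro!: bdd_belowI[of _ 0])
  have ne: "D ` K \<noteq> {}" using K.zero by auto
  have Ile: "I \<le> D k" if "k \<in> K" for k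
    unfolding I_def by (rule cInf_lower) (use that bdd in auto)
  \<comment> \<open>\<open>D\<close> is a squared distance, so the minimizing sequence is chosen
    within the square of \<eta>; the defect of orthogonality is then \<eta> itself.\<close>
  define \<eta> :: "nat \<Rightarrow> real" where "\<eta> l = inverse (real (Suc l))" for l
  have \<eta>: "\<eta> l > 0" "\<eta> l \<le> 1" for l by (auto simp: \<eta>_def field_simps)
  have "\<exists>k\<in>K. D k < I + (\<eta> l)\<^sup>2" for l
  proof -
    have "Inf (D ` K) < I + (\<eta> l)\<^sup>2" using \<eta>[of l] by (simp add: I_def)
    then show ?thesis using cInf_less_iff[OF ne bdd] by auto
  qed
  then obtain k where kK: "\<And>l. k l \<in> K" and kD: "\<And>l. D (k l) < I + (\<eta> l)\<^sup>2" by metis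
  define w where "w l = (\<lambda>i x. u i x - k l i x)" for l
  have wV: "w l \<in> V" for l unfolding w_def by (intro diff u) (use kK K in auto)
  note wT = tsp[OF wV]
  have orth: "Re (tip M N (w l) h) \<le> \<eta> l * tnorm M N h" if h: "h \<in> K" for l h
  proof (cases "tnorm M N h = 0")
    case True
    then show ?thesis
      using tip_Cauchy_Schwarz[OF wT K.tsp[OF h], of l] by simp
  next
    case False
    \<comment> \<open>A step t h away from \<open>k l\<close> cannot bring D below its infimum,
      hence lowers it by less than the square of \<eta>. This t makes the quadratic term, the square
      of t times the norm of h, equal to that tolerance.\<close>
    define t where "t = \<eta> l / tnorm M N h"
    have nh: "tnorm M N h > 0" using False tnorm_nonneg[of M N h] by linarith
    have t: "t > 0" using nh \<eta> by (simp add: t_def)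
    have "I \<le> D (\<lambda>i x. k l i x + of_real t * h i x)"
      by (intro Ile K.add K.scale kK h)
    also have "\<dots> = (tnorm M N (\<lambda>i x. w l i x - of_real t * h i x))\<^sup>2"
      by (simp add: D_def w_def algebra_simps)
    also have "\<dots> = D (k l) - 2 * t * Re (tip M N (w l) h) + t\<^sup>2 * (tnorm M N h)\<^sup>2"
      using tnorm_diff_power2[OF wT K.tsp[OF K.scale[OF h]], of l "of_real t"]
      by (simp add: D_def w_def tip_scale_right tnorm_scale power_mult_distrib)
    also have "\<dots> \<le> I + (\<eta> l)\<^sup>2 - 2 * t * Re (tip M N (w l) h) + t\<^sup>2 * (tnorm M N h)\<^sup>2"
      using kD[of l] by simp
    also have "t\<^sup>2 * (tnorm M N h)\<^sup>2 = (\<eta> l)\<^sup>2"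
      using nh by (simp add: t_def power_divide)
    finally have "t * Re (tip M N (w l) h) \<le> (\<eta> l)\<^sup>2" by simp
    also have "\<dots> = t * (\<eta> l * tnorm M N h)"
      using nh by (simp add: t_def power2_eq_square)
    finally show ?thesis using t by simp
  qed
  define C where "C = sqrt (I + 1)"
  have wC: "tnorm M N (w l) \<le> C" for l
  proof -
    have "(tnorm M N (w l))\<^sup>2 \<le> I + (\<eta> l)\<^sup>2" using kD[of l] by (simp add: D_def w_def)
    also have "\<dots> \<le> I + 1" using \<eta>[of l] by (simp add: power_le_one)
    finally show ?thesis unfolding C_def by (rule real_le_rsqrt)
  qed
  have C0: "C \<ge> 0" using wC[of 0] tnorm_nonneg[of M N "w 0"] by linarith
  have w0: "(nrm M (w l 0))\<^sup>2 \<le> \<eta> l * C" for l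
  proof -
    have "(nrm M (w l 0))\<^sup>2 \<le> \<eta> l * tnorm M N (w l)"
      using \<eta>[of l] by (intro small wV orth) auto
    also have "\<dots> \<le> \<eta> l * C" using wC \<eta>[of l] by (intro mult_left_mono) auto
    finally show ?thesis .
  qed
  have \<eta>0: "\<eta> \<longlonglongrightarrow> 0" unfolding \<eta>_def using LIMSEQ_inverse_real_of_nat by simp
  have "(\<lambda>l. sqrt (\<eta> l * C)) \<longlonglongrightarrow> sqrt (0 * C)"
    by (intro tendsto_intros \<eta>0)
  then have s0: "(\<lambda>l. sqrt (\<eta> l * C)) \<longlonglongrightarrow> 0" by simp
  \<comment> \<open>The difference of \<open>w m\<close> and \<open>w l\<close> lies in K, so almost
    orthogonality bounds <w m, w m> - <w m, w l>. For fixed m the product <w m, w l> is small for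
    large l: by \<open>weak\<close>, up to e it depends only on component 0 of \<open>w l\<close>,
    which tends to 0.\<close>
  have main: "(tnorm M N (w m))\<^sup>2 \<le> 2 * C * \<eta> m" for m
  proof (rule field_le_epsilon)
    fix e :: real assume e: "e > 0"
    define e1 where "e1 = e / (2 * (C + 1))"
    have e1: "e1 > 0" using e C0 by (simp add: e1_def)
    obtain A where A: "A \<ge> 0" "\<And>v. v \<in> V \<Longrightarrow> cmod (tip M N (w m) v) \<le> e1 * tnorm M N v + A * nrm M (v 0)"
      using weak[OF wV e1, of m] by blast
    have "(\<lambda>l. A * sqrt (\<eta> l * C)) \<longlonglongrightarrow> A * 0" by (intro tendsto_intros s0)
    then have "eventually (\<lambda>l. A * sqrt (\<eta> l * C) < e / 2) sequentially"
      using e by (intro order_tendstoD) auto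
    then obtain l where l: "A * sqrt (\<eta> l * C) < e / 2"
      by (auto simp: eventually_sequentially)
    have "cmod (tip M N (w m) (w l)) \<le> e1 * tnorm M N (w l) + A * nrm M (w l 0)"
      by (rule A(2)[OF wV])
    also have "\<dots> \<le> e1 * C + A * sqrt (\<eta> l * C)"
      using wC[of l] e1 A w0[of l] by (intro add_mono mult_left_mono) (auto intro: real_le_rsqrt)
    also have "e1 * C \<le> e / 2"
      unfolding e1_def using e C0 by (simp add: field_simps)
    finally have 1: "cmod (tip M N (w m) (w l)) \<le> e" using l by simp
    have "(\<lambda>i x. w m i x - w l i x) = (\<lambda>i x. k l i x - k m i x)"
      by (simp add: w_def)
    then have "Re (tip M N (w m) (\<lambda>i x. w m i x - w l i x)) \<le> \<eta> m * tnorm M N (\<lambda>i x. w m i x - w l i x)"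
      using orth[OF K.diff[OF kK kK], of m l m] by simp
    also have "\<dots> \<le> \<eta> m * (C + C)"
      using \<eta>[of m] tnorm_diff_le[OF wT wT, of m l] wC[of m] wC[of l] by (intro mult_left_mono) auto
    finally have 2: "Re (tip M N (w m) (w m)) - Re (tip M N (w m) (w l)) \<le> 2 * C * \<eta> m"
      by (simp add: tip_diff_right wT algebra_simps)
    show "(tnorm M N (w m))\<^sup>2 \<le> 2 * C * \<eta> m + e"
      using 1 2 abs_Re_le_cmod[of "tip M N (w m) (w l)"] unfolding tip_self by simp
  qed
  have "(\<lambda>m. 2 * C * \<eta> m) \<longlonglongrightarrow> 2 * C * 0" by (intro tendsto_intros \<eta>0)
  then have "eventually (\<lambda>m. 2 * C * \<eta> m < \<epsilon>\<^sup>2) sequentially"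
    using \<epsilon> by (intro order_tendstoD) auto
  then obtain m where "2 * C * \<eta> m < \<epsilon>\<^sup>2" by (auto simp: eventually_sequentially)
  then have "(tnorm M N (w m))\<^sup>2 < \<epsilon>\<^sup>2" using main[of m] by simp
  then have "tnorm M N (w m) < \<epsilon>" using \<epsilon> by (simp add: power2_less_imp_less)
  then show ?thesis using kK[of m] unfolding w_def by blast
qed

end

section \<open>Square-integrable functions on a product\<close>

text \<open>Partial inner products, the index telling which variable is integrated out: f \<mapsto>
  \<open>slice1 M f a\<close> is the adjoint of b \<mapsto> a \<otimes> b, and likewise for
  \<open>slice2\<close>.\<close>

definition slice1 :: "'a measure \<Rightarrow> ('a \<times> 'b \<Rightarrow> complex) \<Rightarrow> ('a \<Rightarrow> complex) \<Rightarrow> 'b \<Rightarrow> complex" where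
  "slice1 M f a y = (LINT x|M. f (x, y) * cnj (a x))"

definition slice2 :: "'b measure \<Rightarrow> ('a \<times> 'b \<Rightarrow> complex) \<Rightarrow> ('b \<Rightarrow> complex) \<Rightarrow> 'a \<Rightarrow> complex" where
  "slice2 M f b x = (LINT y|M. f (x, y) * cnj (b y))"

context pair_sigma_finite
begin

lemma integrable_tensor:
  fixes f :: "'a \<Rightarrow> 'c::{banach, second_countable_topology, real_normed_field}"
  assumes f: "integrable M1 f" and g: "integrable M2 g"
  shows "integrable (M1 \<Otimes>\<^sub>M M2) (\<lambda>z. f (fst z) * g (snd z))"
proof (rule Fubini_integrable)
  have [measurable]: "f \<in> borel_measurable M1" "g \<in> borel_measurable M2"
    using assms by auto
  show "(\<lambda>z. f (fst z) * g (snd z)) \<in> borel_measurable (M1 \<Otimes>\<^sub>M M2)" by measurable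
  show "integrable M1 (\<lambda>x. LINT y|M2. norm (f (fst (x, y)) * g (snd (x, y))))"
    using f by (simp add: norm_mult)
  show "AE x in M1. integrable M2 (\<lambda>y. f (fst (x, y)) * g (snd (x, y)))"
    using g by simp
qed

lemma integral_tensor:
  fixes f :: "'a \<Rightarrow> 'c::{banach, second_countable_topology, real_normed_field}"
  assumes f: "integrable M1 f" and g: "integrable M2 g"
  shows "(LINT z|(M1 \<Otimes>\<^sub>M M2). f (fst z) * g (snd z)) = (LINT x|M1. f x) * (LINT y|M2. g y)"
  using integral_fst'[OF integrable_tensor[OF assms]] by simp

lemma sqi_tensor:
  assumes "sqi M1 a" "sqi M2 b"
  shows "sqi (M1 \<Otimes>\<^sub>M M2) (\<lambda>z. a (fst z) * b (snd z))"
proof -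
  have [measurable]: "a \<in> borel_measurable M1" "b \<in> borel_measurable M2"
    using assms by (auto simp: sqi_def)
  show ?thesis
    unfolding sqi_def norm_mult power_mult_distrib
    by (intro conjI integrable_tensor) (use assms in \<open>auto simp: sqi_def\<close>)
qed

lemma ip_tensor:
  assumes "sqi M1 a" "sqi M2 b" "sqi M1 a'" "sqi M2 b'"
  shows "ip (M1 \<Otimes>\<^sub>M M2) (\<lambda>z. a (fst z) * b (snd z)) (\<lambda>z. a' (fst z) * b' (snd z)) =
    ip M1 a a' * ip M2 b b'"
  unfolding ip_def
  using integral_tensor[OF sqi_integrable_mult_cnj[OF assms(1,3)] sqi_integrable_mult_cnj[OF assms(2,4)]]
  by (simp add: ac_simps)

lemma nrm_tensor:
  assumes "sqi M1 a" "sqi M2 b"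
  shows "nrm (M1 \<Otimes>\<^sub>M M2) (\<lambda>z. a (fst z) * b (snd z)) = nrm M1 a * nrm M2 b"
  unfolding nrm_def ip_tensor[OF assms assms] by (simp add: ip_self real_sqrt_mult)

text \<open>For almost every x the function f(x, \<cdot>) is square-integrable, and Cauchy-Schwarz
  in y bounds the slice by its norm times that of b; Fubini makes this bound square-integrable in
  x.\<close>

lemma sqi_slice2:
  assumes f: "sqi (M1 \<Otimes>\<^sub>M M2) f" and b: "sqi M2 b"
  shows "sqi M1 (slice2 M2 f b)"
proof -
  have [measurable]: "f \<in> borel_measurable (M1 \<Otimes>\<^sub>M M2)" "b \<in> borel_measurable M2"
    using assms by (auto simp: sqi_def)
  have int: "integrable (M1 \<Otimes>\<^sub>M M2) (\<lambda>z. (cmod (f z))\<^sup>2)" using f by (simp add: sqi_def)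
  have meas: "slice2 M2 f b \<in> borel_measurable M1"
    unfolding slice2_def by measurable
  show ?thesis
    unfolding sqi_def
  proof (rule conjI[OF meas], rule Bochner_Integration.integrable_bound)
    show "integrable M1 (\<lambda>x. (LINT y|M2. (cmod (f (x, y)))\<^sup>2) * (nrm M2 b)\<^sup>2)"
      using integrable_fst'[OF int] by simp
    show "(\<lambda>x. (cmod (slice2 M2 f b x))\<^sup>2) \<in> borel_measurable M1"
      using meas by measurable
    show "AE x in M1. norm ((cmod (slice2 M2 f b x))\<^sup>2)
        \<le> norm ((LINT y|M2. (cmod (f (x, y)))\<^sup>2) * (nrm M2 b)\<^sup>2)"
      using AE_integrable_fst'[OF int] AE_space
    proof eventually_elim
      case (elim x)
      then have "sqi M2 (\<lambda>y. f (x, y))" by (auto simp: sqi_def)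
      from ip_Cauchy_Schwarz[OF this b]
      have "cmod (slice2 M2 f b x) \<le> nrm M2 (\<lambda>y. f (x, y)) * nrm M2 b"
        by (simp add: slice2_def ip_def)
      then have "(cmod (slice2 M2 f b x))\<^sup>2 \<le> (nrm M2 (\<lambda>y. f (x, y)) * nrm M2 b)\<^sup>2"
        by (simp add: power_mono)
      also have "\<dots> = (LINT y|M2. (cmod (f (x, y)))\<^sup>2) * (nrm M2 b)\<^sup>2"
        by (simp add: power_mult_distrib nrm_power2)
      finally show ?case by simp
    qed
  qed
qed

lemma ip_slice2:
  assumes f: "sqi (M1 \<Otimes>\<^sub>M M2) f" and a: "sqi M1 a" and b: "sqi M2 b"
  shows "ip (M1 \<Otimes>\<^sub>M M2) f (\<lambda>z. a (fst z) * b (snd z)) = ip M1 (slice2 M2 f b) a"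
proof -
  have "ip (M1 \<Otimes>\<^sub>M M2) f (\<lambda>z. a (fst z) * b (snd z)) =
      (LINT x|M1. LINT y|M2. f (x, y) * cnj (a x * b y))"
    unfolding ip_def
    using integral_fst'[OF sqi_integrable_mult_cnj[OF f sqi_tensor[OF a b]]] by simp
  also have "\<dots> = (LINT x|M1. LINT y|M2. (f (x, y) * cnj (b y)) * cnj (a x))"
    by (simp add: ac_simps)
  finally show ?thesis by (simp add: ip_def slice2_def)
qed

lemma sqi_swap:
  assumes f: "sqi (M1 \<Otimes>\<^sub>M M2) f"
  shows "sqi (M2 \<Otimes>\<^sub>M M1) (\<lambda>z. f (snd z, fst z))"
proof -
  have [measurable]: "f \<in> borel_measurable (M1 \<Otimes>\<^sub>M M2)" using f by (simp add: sqi_def)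
  show ?thesis
    using f integrable_product_swap[of "\<lambda>z. (cmod (f z))\<^sup>2"] by (simp add: sqi_def case_prod_beta')
qed

lemma slice1_swap: "slice1 M1 f a = slice2 M1 (\<lambda>z. f (snd z, fst z)) a"
  by (simp add: slice1_def slice2_def fun_eq_iff)

lemma sqi_slice1:
  assumes f: "sqi (M1 \<Otimes>\<^sub>M M2) f" and a: "sqi M1 a"
  shows "sqi M2 (slice1 M1 f a)"
proof -
  interpret Q: pair_sigma_finite M2 M1 ..
  show ?thesis unfolding slice1_swap by (rule Q.sqi_slice2[OF sqi_swap[OF f] a])
qed

lemma ip_slice1:
  assumes f: "sqi (M1 \<Otimes>\<^sub>M M2) f" and a: "sqi M1 a" and b: "sqi M2 b"
  shows "ip (M1 \<Otimes>\<^sub>M M2) f (\<lambda>z. a (fst z) * b (snd z)) = ip M2 (slice1 M1 f a) b"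
proof -
  interpret Q: pair_sigma_finite M2 M1 ..
  have [measurable]: "f \<in> borel_measurable (M1 \<Otimes>\<^sub>M M2)" "a \<in> borel_measurable M1" "b \<in> borel_measurable M2"
    using assms by (simp_all add: sqi_def)
  have "ip (M1 \<Otimes>\<^sub>M M2) f (\<lambda>z. a (fst z) * b (snd z)) =
     ip (M2 \<Otimes>\<^sub>M M1) (\<lambda>z. f (snd z, fst z)) (\<lambda>z. b (fst z) * a (snd z))"
    unfolding ip_def
    by (subst integral_product_swap[symmetric]) (auto simp: case_prod_beta' ac_simps)
  also have "\<dots> = ip M2 (slice1 M1 f a) b"
    unfolding slice1_swap by (rule Q.ip_slice2[OF sqi_swap[OF f] b a])
  finally show ?thesis .
qed

text \<open>The sum with slices is the orthogonal projection of f onto span a \<otimes>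
  \<open>L^2\<close>, which contains the competing sum up to null functions. The gain is that
  arbitrary second factors b are replaced by slices of f, and slices inherit weak derivatives from
  f.\<close>

lemma nrm_diff_Fourier_sum_le:
  fixes n m :: nat
  assumes f: "sqi (M1 \<Otimes>\<^sub>M M2) f"
    and a: "\<And>j. j < n \<Longrightarrow> sqi M1 (a j)"
    and on: "\<And>i j. i < n \<Longrightarrow> j < n \<Longrightarrow> ip M1 (a i) (a j) = (if i = j then 1 else 0)"
    and a': "\<And>l. l < m \<Longrightarrow> sqi M1 (a' l)" and b: "\<And>l. l < m \<Longrightarrow> sqi M2 (b l)"
    and res: "\<And>l. l < m \<Longrightarrow> nrm M1 (\<lambda>x. a' l x - (\<Sum>j<n. ip M1 (a' l) (a j) * a j x)) = 0"
  shows "nrm (M1 \<Otimes>\<^sub>M M2) (\<lambda>z. f z - (\<Sum>j<n. a j (fst z) * slice1 M1 f (a j) (snd z)))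
    \<le> nrm (M1 \<Otimes>\<^sub>M M2) (\<lambda>z. f z - (\<Sum>l<m. a' l (fst z) * b l (snd z)))"
proof -
  let ?P = "M1 \<Otimes>\<^sub>M M2"
  define s where "s j = slice1 M1 f (a j)" for j
  have s: "sqi M2 (s j)" if "j < n" for j
    unfolding s_def by (rule sqi_slice1[OF f a[OF that]])
  define r where "r = (\<lambda>z. f z - (\<Sum>j<n. a j (fst z) * s j (snd z)))"
  define h where "h = (\<lambda>z. f z - (\<Sum>l<m. a' l (fst z) * b l (snd z)))"
  have at: "sqi ?P (\<lambda>z. a j (fst z) * g (snd z))" if "j < n" "sqi M2 g" for j g
    using that by (intro sqi_tensor a)
  have a't: "sqi ?P (\<lambda>z. a' l (fst z) * b l (snd z))" if "l < m" for l
    using that by (intro sqi_tensor a' b)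
  have r: "sqi ?P r" unfolding r_def by (intro sqi_diff[OF f] sqi_sum at s) auto
  have h: "sqi ?P h" unfolding h_def by (intro sqi_diff[OF f] sqi_sum a't) auto
  have orth: "ip ?P r (\<lambda>z. a j (fst z) * g (snd z)) = 0" if j: "j < n" and g: "sqi M2 g" for j g
  proof -
    have "ip ?P r (\<lambda>z. a j (fst z) * g (snd z)) =
        ip ?P f (\<lambda>z. a j (fst z) * g (snd z)) -
        (\<Sum>i<n. ip ?P (\<lambda>z. a i (fst z) * s i (snd z)) (\<lambda>z. a j (fst z) * g (snd z)))"
      unfolding r_def using j g f
      by (subst ip_diff_left) (auto intro!: sqi_sum ip_sum_left simp: at s)
    also have "(\<Sum>i<n. ip ?P (\<lambda>z. a i (fst z) * s i (snd z)) (\<lambda>z. a j (fst z) * g (snd z))) =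
        (\<Sum>i<n. if i = j then ip M2 (s i) g else 0)"
      using j g by (intro sum.cong) (auto simp: ip_tensor a s on)
    also have "\<dots> = ip M2 (s j) g" using j by simp
    also have "ip ?P f (\<lambda>z. a j (fst z) * g (snd z)) = ip M2 (s j) g"
      unfolding s_def by (rule ip_slice1[OF f a[OF j] g])
    finally show ?thesis by simp
  qed
  have orth': "ip ?P r (\<lambda>z. a' l (fst z) * b l (snd z)) = 0" if l: "l < m" for l
  proof -
    define c where "c j = ip M1 (a' l) (a j)" for j
    \<comment> \<open>Each \<open>a' l\<close> is a combination of the \<open>a j\<close> up to z0,
      which has norm 0 but need not vanish.\<close>
    define z0 where "z0 = (\<lambda>x. a' l x - (\<Sum>j<n. c j * a j x))"
    have z0: "sqi M1 z0" "nrm M1 z0 = 0"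
      unfolding z0_def using l res by (auto intro!: sqi_diff sqi_sum sqi_scale a a' simp: c_def)
    have "(\<lambda>z. a' l (fst z) * b l (snd z)) =
        (\<lambda>z. z0 (fst z) * b l (snd z) + (\<Sum>j<n. c j * (a j (fst z) * b l (snd z))))"
      by (simp add: z0_def algebra_simps sum_distrib_left)
    then have "ip ?P r (\<lambda>z. a' l (fst z) * b l (snd z)) = cnj (ip ?P (\<lambda>z. z0 (fst z) * b l (snd z)) r
        + ip ?P (\<lambda>z. \<Sum>j<n. c j * (a j (fst z) * b l (snd z))) r)"
      using sqi_tensor[OF z0(1) b[OF l]] l r
      by (subst ip_swap, simp only:, subst ip_add_left)
        (auto intro!: sqi_sum sqi_scale[where f = "\<lambda>z. a _ (fst z) * b l (snd z)"] simp: at b)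
    also have "ip ?P (\<lambda>z. z0 (fst z) * b l (snd z)) r = 0"
      using ip_Cauchy_Schwarz[OF sqi_tensor[OF z0(1) b[OF l]] r]
      by (simp add: nrm_tensor z0 b l)
    also have "ip ?P (\<lambda>z. \<Sum>j<n. c j * (a j (fst z) * b l (snd z))) r =
        (\<Sum>j<n. c j * ip ?P (\<lambda>z. a j (fst z) * b l (snd z)) r)"
      using l r by (subst ip_sum_left)
        (auto intro!: sqi_scale[where f = "\<lambda>z. a _ (fst z) * b l (snd z)"] simp: ip_scale_left at b)
    also have "\<dots> = 0"
      using l by (intro sum.neutral ballI, subst ip_swap) (simp add: orth b)
    finally show ?thesis by simp
  qed
  \<comment> \<open>The remainder r is orthogonal to both sums, so in the second argument r may be
    exchanged for f, and f for h.\<close>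
  have "ip ?P r r = ip ?P r f - (\<Sum>j<n. ip ?P r (\<lambda>z. a j (fst z) * s j (snd z)))"
    using r f by (subst (2) r_def, subst ip_diff_right) (auto intro!: sqi_sum ip_sum_right simp: at s)
  also have "\<dots> = ip ?P r f - (\<Sum>l<m. ip ?P r (\<lambda>z. a' l (fst z) * b l (snd z)))"
    by (simp add: orth orth' s)
  also have "\<dots> = ip ?P r h"
    using r f unfolding h_def
    by (subst ip_diff_right) (auto intro!: sqi_sum ip_sum_right[symmetric] simp: a't)
  finally have "ip ?P r r = ip ?P r h" .
  then have "(nrm ?P r)\<^sup>2 = cmod (ip ?P r h)"
    by (metis ip_self nrm_power2 abs_of_nonneg norm_of_real zero_le_power2)
  also have "\<dots> \<le> nrm ?P r * nrm ?P h" by (rule ip_Cauchy_Schwarz[OF r h])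
  finally have "nrm ?P r * nrm ?P r \<le> nrm ?P r * nrm ?P h" by (simp add: power2_eq_square)
  then have "nrm ?P r \<le> nrm ?P h"
    using nrm_nonneg[of ?P r] nrm_nonneg[of ?P h]
    by (cases "nrm ?P r = 0") (auto simp: mult_le_cancel_left)
  then show ?thesis by (simp add: r_def h_def s_def)
qed

end

section \<open>Tensor products of tuples and the abstract density theorem for two factors\<close>

text \<open>
  Component \<open>0\<close> is the tensor product itself, the components \<open>1, \<dots>, p\<close> are its derivatives in the
  first factor and \<open>p + 1, \<dots>, p + q\<close> those in the second; \<open>drop_first p\<close> keeps component \<open>0\<close> and the latter.
\<close>

definition tens :: "nat \<Rightarrow> (nat \<Rightarrow> 'a \<Rightarrow> complex) \<Rightarrow> (nat \<Rightarrow> 'b \<Rightarrow> complex) \<Rightarrow> nat \<Rightarrow> 'a \<times> 'b \<Rightarrow> complex" where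
  "tens p a b k z = (if k \<le> p then a k (fst z) * b 0 (snd z) else a 0 (fst z) * b (k - p) (snd z))"

definition tens_span ::
  "nat \<Rightarrow> (nat \<Rightarrow> 'a \<Rightarrow> complex) set \<Rightarrow> (nat \<Rightarrow> 'b \<Rightarrow> complex) set \<Rightarrow> (nat \<Rightarrow> 'a \<times> 'b \<Rightarrow> complex) set" where
  "tens_span p V1 V2 = {(\<lambda>k z. \<Sum>l<m. tens p (a l) (b l) k z) | (m :: nat) a b.
     \<forall>l<m. a l \<in> V1 \<and> b l \<in> V2}"

definition drop_first :: "nat \<Rightarrow> (nat \<Rightarrow> 'c) \<Rightarrow> nat \<Rightarrow> 'c" where
  "drop_first p w k = w (if k = 0 then 0 else p + k)"

text \<open>The part kept by \<open>drop_first p\<close> is the inner product of \<open>L^2\<close>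
  functions on the first factor with values in \<open>H^1\<close> of the second; the other sum holds
  the derivatives in the first factor.\<close>

lemma tip_split:
  "tip M (Suc (p + q)) u v =
    tip M (Suc q) (drop_first p u) (drop_first p v) + (\<Sum>i<p. ip M (u (Suc i)) (v (Suc i)))"
proof (induction q)
  case 0
  show ?case
    by (simp add: tip_def drop_first_def sum.lessThan_Suc_shift del: sum.lessThan_Suc)
next
  case (Suc q)
  have "tip M (Suc (p + Suc q)) u v = tip M (Suc (p + q)) u v + ip M (u (p + Suc q)) (v (p + Suc q))"
    by (simp add: tip_def)
  moreover have "tip M (Suc (Suc q)) (drop_first p u) (drop_first p v) =
     tip M (Suc q) (drop_first p u) (drop_first p v) + ip M (u (p + Suc q)) (v (p + Suc q))"
    by (simp add: tip_def drop_first_def)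
  ultimately show ?case using Suc by simp
qed

lemma tnorm_split:
  "(tnorm M (Suc (p + q)) u)\<^sup>2 = (tnorm M (Suc q) (drop_first p u))\<^sup>2 + (\<Sum>i<p. (nrm M (u (Suc i)))\<^sup>2)"
proof -
  have "complex_of_real ((tnorm M (Suc (p + q)) u)\<^sup>2) =
     of_real ((tnorm M (Suc q) (drop_first p u))\<^sup>2 + (\<Sum>i<p. (nrm M (u (Suc i)))\<^sup>2))"
    unfolding tip_self[symmetric] tip_split of_real_add of_real_sum ip_self nrm_power2 ..
  then show ?thesis using of_real_eq_iff by blast
qed

lemma drop_first_tsp: "w \<in> tsp M (Suc (p + q)) \<Longrightarrow> drop_first p w \<in> tsp M (Suc q)"
  by (auto simp: tsp_def drop_first_def)

text \<open>All that the density argument needs to know about Sobolev spaces. The slices are taken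
  against merely square-integrable functions, since pairing in one variable commutes with
  derivatives in the other. \<open>weakly_closed\<close> says that a functional <w, \<cdot>> is, up
  to \<epsilon>, continuous in component 0 alone.\<close>

locale tensor_setting = pair_sigma_finite M1 M2 + W1: tsubspace M1 "Suc p" V1 +
  W2: tsubspace M2 "Suc q" V2 + W: tsubspace "M1 \<Otimes>\<^sub>M M2" "Suc (p + q)" V
  for M1 :: "'a measure" and M2 :: "'b measure" and p q V1 V2 V +
  assumes tens_in: "a \<in> V1 \<Longrightarrow> b \<in> V2 \<Longrightarrow> tens p a b \<in> V"
    and slice1_in: "w \<in> V \<Longrightarrow> sqi M1 f \<Longrightarrow> (\<lambda>k. slice1 M1 (drop_first p w k) f) \<in> V2"
    and slice2_in: "w \<in> V \<Longrightarrow> sqi M2 g \<Longrightarrow> (\<lambda>k. slice2 M2 (w k) g) \<in> V1"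
    and sqi_dense: "sqi (M1 \<Otimes>\<^sub>M M2) h \<Longrightarrow> 0 < \<epsilon> \<Longrightarrow>
      \<exists>(m::nat) f g. (\<forall>l<m. sqi M1 (f l) \<and> sqi M2 (g l)) \<and>
        nrm (M1 \<Otimes>\<^sub>M M2) (\<lambda>z. h z - (\<Sum>l<m. f l (fst z) * g l (snd z))) < \<epsilon>"
    and weakly_closed: "w \<in> V \<Longrightarrow> 0 < \<epsilon> \<Longrightarrow>
        \<exists>A\<ge>0. \<forall>v\<in>V. cmod (tip (M1 \<Otimes>\<^sub>M M2) (Suc (p + q)) w v)
          \<le> \<epsilon> * tnorm (M1 \<Otimes>\<^sub>M M2) (Suc (p + q)) v + A * nrm (M1 \<Otimes>\<^sub>M M2) (v 0)"
begin

abbreviation P :: "('a \<times> 'b) measure" where "P \<equiv> M1 \<Otimes>\<^sub>M M2"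

lemma V1_sqi: "a \<in> V1 \<Longrightarrow> k \<le> p \<Longrightarrow> sqi M1 (a k)"
  using W1.tsp by (auto simp: tsp_def)

lemma V2_sqi: "b \<in> V2 \<Longrightarrow> k \<le> q \<Longrightarrow> sqi M2 (b k)"
  using W2.tsp by (auto simp: tsp_def)

lemma V_sqi: "w \<in> V \<Longrightarrow> k \<le> p + q \<Longrightarrow> sqi P (w k)"
  using W.tsp by (auto simp: tsp_def)

lemma tens_span_subset: "tens_span p V1 V2 \<subseteq> V"
proof
  fix u assume "u \<in> tens_span p V1 V2"
  then obtain m :: nat and a b where u: "u = (\<lambda>k z. \<Sum>l<m. tens p (a l) (b l) k z)"
    and ab: "\<And>l. l < m \<Longrightarrow> a l \<in> V1 \<and> b l \<in> V2"
    by (auto simp: tens_span_def)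
  show "u \<in> V" unfolding u by (rule W.sum) (simp add: ab tens_in)
qed

lemma tens_span_tsubspace: "tsubspace P (Suc (p + q)) (tens_span p V1 V2)"
proof
  show "tens_span p V1 V2 \<subseteq> tsp P (Suc (p + q))"
    using tens_span_subset W.sub by blast
  show "(\<lambda>k x. 0) \<in> tens_span p V1 V2"
    unfolding tens_span_def by (intro CollectI exI[of _ 0]) simp
  show "(\<lambda>k x. c * u k x) \<in> tens_span p V1 V2" if uK: "u \<in> tens_span p V1 V2" for u c
  proof -
    obtain m :: nat and a b where u: "u = (\<lambda>k z. \<Sum>l<m. tens p (a l) (b l) k z)"
      and ab: "\<forall>l<m. a l \<in> V1 \<and> b l \<in> V2"
      using uK by (auto simp: tens_span_def)
    have "(\<lambda>k x. c * u k x) = (\<lambda>k z. \<Sum>l<m. tens p (\<lambda>k x. c * a l k x) (b l) k z)"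
      by (auto simp: u sum_distrib_left tens_def fun_eq_iff intro!: sum.cong)
    then show ?thesis
      unfolding tens_span_def using ab W1.scale
      by (intro CollectI exI[of _ m] exI[of _ "\<lambda>l k x. c * a l k x"] exI[of _ b]) simp
  qed
  show "(\<lambda>k x. u k x + v k x) \<in> tens_span p V1 V2"
    if uK: "u \<in> tens_span p V1 V2" and vK: "v \<in> tens_span p V1 V2" for u v
  proof -
    obtain m :: nat and a b where u: "u = (\<lambda>k z. \<Sum>l<m. tens p (a l) (b l) k z)"
      and ab: "\<forall>l<m. a l \<in> V1 \<and> b l \<in> V2"
      using uK by (auto simp: tens_span_def)
    obtain n :: nat and a' b' where v: "v = (\<lambda>k z. \<Sum>l<n. tens p (a' l) (b' l) k z)"
      and ab': "\<forall>l<n. a' l \<in> V1 \<and> b' l \<in> V2"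
      using vK by (auto simp: tens_span_def)
    define A where "A l = (if l < m then a l else a' (l - m))" for l
    define B where "B l = (if l < m then b l else b' (l - m))" for l
    have "(\<Sum>l<m + n. tens p (A l) (B l) k z) = u k z + v k z" for k z
    proof -
      have "(\<Sum>l<m + n. tens p (A l) (B l) k z) = (\<Sum>l<m. tens p (A l) (B l) k z)
         + (\<Sum>l=m..<m + n. tens p (A l) (B l) k z)"
        by (simp add: lessThan_atLeast0 sum.atLeastLessThan_concat)
      also have "(\<Sum>l=m..<m + n. tens p (A l) (B l) k z) = (\<Sum>l<n. tens p (A (l + m)) (B (l + m)) k z)"
        using sum.shift_bounds_nat_ivl[of "\<lambda>l. tens p (A l) (B l) k z" 0 m n]
        by (simp add: lessThan_atLeast0 add.commute)
      finally show ?thesis by (simp add: A_def B_def u v)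
    qed
    then show ?thesis
      unfolding tens_span_def using ab ab'
      by (intro CollectI exI[of _ "m + n"] exI[of _ A] exI[of _ B]) (auto simp: A_def B_def)
  qed
qed

text \<open>\<open>sqi_dense\<close> treats each component of w separately, with unrelated tensors.
  Orthonormalizing all their first factors at once gives one family a that serves every component,
  and the second factors of the Fourier sums are then the components of a single tuple in
  \<open>V2\<close>, by \<open>slice1_in\<close>.\<close>

lemma Fourier_approx:
  assumes w: "w \<in> V" and \<epsilon>: "0 < \<epsilon>"
  obtains n :: nat and a where "\<And>j. j < n \<Longrightarrow> sqi M1 (a j)"
    "tnorm P (Suc q) (\<lambda>k z. drop_first p w k z -
      (\<Sum>j<n. a j (fst z) * slice1 M1 (drop_first p w k) (a j) (snd z))) \<le> \<epsilon>"
proof -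
  define \<eta> where "\<eta> = \<epsilon> / Suc q"
  have \<eta>: "\<eta> > 0" using \<epsilon> by (simp add: \<eta>_def)
  have S: "sqi P (drop_first p w k)" if "k \<le> q" for k
    using that V_sqi[OF w] by (auto simp: drop_first_def)
  \<comment> \<open>The triple packs the number of terms and both families of factors, so that a
    single choice over k provides all three.\<close>
  define Q where "Q k t \<longleftrightarrow> (\<forall>l<fst t. sqi M1 (fst (snd t) l) \<and> sqi M2 (snd (snd t) l)) \<and>
        nrm P (\<lambda>z. drop_first p w k z - (\<Sum>l<fst t. fst (snd t) l (fst z) * snd (snd t) l (snd z))) < \<eta>"
    for k and t :: "nat \<times> (nat \<Rightarrow> 'a \<Rightarrow> complex) \<times> (nat \<Rightarrow> 'b \<Rightarrow> complex)"
  have "\<exists>t. Q k t" if k: "k \<le> q" for k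
  proof -
    obtain m :: nat and f g where "(\<forall>l<m. sqi M1 (f l) \<and> sqi M2 (g l)) \<and>
        nrm P (\<lambda>z. drop_first p w k z - (\<Sum>l<m. f l (fst z) * g l (snd z))) < \<eta>"
      using sqi_dense[OF S[OF k] \<eta>] by (elim exE)
    then have "Q k (m, f, g)" by (simp add: Q_def)
    then show ?thesis ..
  qed
  then obtain t where t: "\<And>k. k \<le> q \<Longrightarrow> Q k (t k)" by metis
  define m where "m k = fst (t k)" for k
  define f where "f k = fst (snd (t k))" for k
  define g where "g k = snd (snd (t k))" for k
  have fg: "sqi M1 (f k l) \<and> sqi M2 (g k l)" if "k \<le> q" "l < m k" for k l
    using t[OF that(1)] that(2) by (simp add: Q_def f_def g_def m_def)
  have close: "nrm P (\<lambda>z. drop_first p w k z - (\<Sum>l<m k. f k l (fst z) * g k l (snd z))) < \<eta>"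
    if "k \<le> q" for k
    using t[OF that] by (simp add: Q_def f_def g_def m_def)
  have full: "tsubspace M1 (Suc 0) (tsp M1 (Suc 0))"
    by standard (auto intro: tsp_zero tsp_add tsp_scale)
  \<comment> \<open>The first factors from all components together, each turned into a tuple of
    length one so that \<open>Gram_Schmidt\<close> applies.\<close>
  define F where "F = (\<Union>k\<in>{..q}. \<Union>l\<in>{..<m k}. {(\<lambda>_::nat. f k l)})"
  have "finite F" by (simp add: F_def)
  then obtain gs where gs: "set gs = F" using finite_list by auto
  have "set gs \<subseteq> tsp M1 (Suc 0)" using fg by (auto simp: gs F_def intro: tsp_1)
  from tsubspace.Gram_Schmidt[OF full this, unfolded gs] obtain n :: nat and e where
    e: "\<forall>l<n. e l \<in> tsp M1 (Suc 0)"
    and on: "\<forall>l<n. \<forall>l'<n. tip M1 (Suc 0) (e l) (e l') = (if l = l' then 1 else 0)"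
    and res: "\<forall>g\<in>F. tnorm M1 (Suc 0) (\<lambda>k x. g k x - (\<Sum>l<n. tip M1 (Suc 0) g (e l) * e l k x)) = 0"
    by blast
  define a where "a l = e l 0" for l
  have a: "sqi M1 (a j)" if "j < n" for j
    using e that by (auto simp: a_def tsp_def)
  have best: "nrm P (\<lambda>z. drop_first p w k z - (\<Sum>j<n. a j (fst z) * slice1 M1 (drop_first p w k) (a j) (snd z)))
      \<le> nrm P (\<lambda>z. drop_first p w k z - (\<Sum>l<m k. f k l (fst z) * g k l (snd z)))" if k: "k \<le> q" for k
  proof (rule nrm_diff_Fourier_sum_le[OF S[OF k] a])
    show "ip M1 (a i) (a j) = (if i = j then 1 else 0)" if "i < n" "j < n" for i j
      using on that by (auto simp: a_def tip_def)
    show "nrm M1 (\<lambda>x. f k l x - (\<Sum>j<n. ip M1 (f k l) (a j) * a j x)) = 0" if "l < m k" for l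
    proof -
      have "(\<lambda>_. f k l) \<in> F" using k that by (auto simp: F_def)
      then have "tnorm M1 (Suc 0) (\<lambda>k' x. f k l x - (\<Sum>j<n. tip M1 (Suc 0) (\<lambda>_. f k l) (e j) * e j k' x)) = 0"
        by (rule res[rule_format])
      then show ?thesis by (simp add: tnorm_def nrm_def tip_def a_def)
    qed
  qed (use fg[OF k] in auto)
  have "(tnorm P (Suc q) (\<lambda>k z. drop_first p w k z -
      (\<Sum>j<n. a j (fst z) * slice1 M1 (drop_first p w k) (a j) (snd z))))\<^sup>2 \<le> (\<Sum>k<Suc q. \<eta>\<^sup>2)"
    unfolding tnorm_power2
  proof (rule sum_mono)
    fix k assume "k \<in> {..<Suc q}"
    then have k: "k \<le> q" by simp
    show "(nrm P (\<lambda>z. drop_first p w k z -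
      (\<Sum>j<n. a j (fst z) * slice1 M1 (drop_first p w k) (a j) (snd z))))\<^sup>2 \<le> \<eta>\<^sup>2"
      using best[OF k] close[OF k] by (intro power_mono) auto
  qed
  also have "\<dots> = Suc q * \<eta>\<^sup>2" by simp
  also have "\<dots> \<le> (Suc q)\<^sup>2 * \<eta>\<^sup>2" by (intro mult_right_mono) (auto simp: power2_eq_square)
  also have "\<dots> = \<epsilon>\<^sup>2" by (simp add: \<eta>_def power_divide)
  finally have "tnorm P (Suc q) (\<lambda>k z. drop_first p w k z -
      (\<Sum>j<n. a j (fst z) * slice1 M1 (drop_first p w k) (a j) (snd z))) \<le> \<epsilon>"
    using \<epsilon> by (auto intro: power2_le_imp_le)
  with a show ?thesis by (rule that)
qed

lemma tip_column:
  assumes "sqi M1 f" "sqi M1 f'" "b \<in> V2" "b' \<in> V2"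
  shows "tip P (Suc q) (\<lambda>k z. f (fst z) * b k (snd z)) (\<lambda>k z. f' (fst z) * b' k (snd z)) =
    ip M1 f f' * tip M2 (Suc q) b b'"
  unfolding tip_def sum_distrib_left using assms V2_sqi by (intro sum.cong ip_tensor) auto

lemma column_tsp: "sqi M1 f \<Longrightarrow> b \<in> V2 \<Longrightarrow> (\<lambda>k z. f (fst z) * b k (snd z)) \<in> tsp P (Suc q)"
  using V2_sqi by (auto simp: tsp_def intro!: sqi_tensor)

text \<open>
  The sum is \<open>1 \<otimes> R\<close> applied to \<open>f\<close>, where \<open>R\<close> is the Riesz map \<open>L\<^sup>2 \<rightarrow> span e\<close> of the
  \<open>H\<^sup>1\<close>-inner product on the second factor; \<open>R\<close> is nonnegative and maps \<open>L\<^sup>2\<close> contractively to \<open>H\<^sup>1\<close>.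
\<close>

lemma
  fixes n :: nat
  assumes f: "sqi P f" and e: "\<And>l. l < n \<Longrightarrow> e l \<in> V2"
    and on: "\<And>l l'. l < n \<Longrightarrow> l' < n \<Longrightarrow> tip M2 (Suc q) (e l) (e l') = (if l = l' then 1 else 0)"
  defines "r \<equiv> (\<lambda>k z. \<Sum>l<n. slice2 M2 f (e l 0) (fst z) * e l k (snd z))"
  shows Riesz_sum_tsp: "r \<in> tsp P (Suc q)"
    and Riesz_sum_contractive: "tnorm P (Suc q) r \<le> nrm P f"
    and Riesz_sum_nonneg: "0 \<le> Re (ip P f (r 0))"
proof -
  define U where "U l = slice2 M2 f (e l 0)" for l
  have U: "sqi M1 (U l)" if "l < n" for l
    unfolding U_def using f e that V2_sqi by (intro sqi_slice2) auto
  have col: "(\<lambda>k z. U l (fst z) * e l k (snd z)) \<in> tsp P (Suc q)" if "l < n" for l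
    using U e that by (intro column_tsp) auto
  have r: "r = (\<lambda>k z. \<Sum>l<n. U l (fst z) * e l k (snd z))" by (simp add: r_def U_def)
  show rT: "r \<in> tsp P (Suc q)" unfolding r by (intro tsp_sum col) auto
  have "tip P (Suc q) r r = (\<Sum>l<n. \<Sum>l'<n. tip P (Suc q) (\<lambda>k z. U l (fst z) * e l k (snd z))
      (\<lambda>k z. U l' (fst z) * e l' k (snd z)))"
    using rT col by (subst (1) r, subst tip_sum_left, simp_all)
      (intro sum.cong refl, subst (1) r, subst tip_sum_right, simp_all)
  also have "\<dots> = (\<Sum>l<n. \<Sum>l'<n. if l' = l then ip M1 (U l) (U l') else 0)"
    using U e on by (intro sum.cong refl) (auto simp: tip_column)
  also have "\<dots> = (\<Sum>l<n. ip M1 (U l) (U l))" by simp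
  finally have rr: "tip P (Suc q) r r = (\<Sum>l<n. ip M1 (U l) (U l))" .
  have "ip P f (r 0) = (\<Sum>l<n. ip P f (\<lambda>z. U l (fst z) * e l 0 (snd z)))"
    unfolding r using f col by (intro ip_sum_right) (auto simp: tsp_def)
  also have "\<dots> = (\<Sum>l<n. ip M1 (U l) (U l))"
    using f U e V2_sqi by (intro sum.cong refl) (auto simp: ip_slice2 U_def)
  finally have fr: "ip P f (r 0) = tip P (Suc q) r r" using rr by simp
  show "0 \<le> Re (ip P f (r 0))" unfolding fr tip_self by simp
  have r0: "sqi P (r 0)" using rT by (auto simp: tsp_def)
  have "(tnorm P (Suc q) r)\<^sup>2 = cmod (ip P f (r 0))"
    unfolding fr tip_self norm_of_real by simp
  also have "\<dots> \<le> nrm P f * nrm P (r 0)" by (rule ip_Cauchy_Schwarz[OF f r0])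
  also have "\<dots> \<le> nrm P f * tnorm P (Suc q) r"
    by (intro mult_left_mono nrm_le_tnorm) auto
  finally have "tnorm P (Suc q) r * tnorm P (Suc q) r \<le> nrm P f * tnorm P (Suc q) r"
    by (simp add: power2_eq_square)
  then show "tnorm P (Suc q) r \<le> nrm P f"
    using tnorm_nonneg[of P "Suc q" r]
    by (cases "tnorm P (Suc q) r = 0") (auto simp: mult_le_cancel_right)
qed

text \<open>Tests w against its Riesz sum v. The derivatives in the first factor contribute a
  nonnegative amount to <w, v>, so the kept part is at most \<delta> times the norm of v, and v is
  no larger than w by contractivity. The kept part is nearly the squared norm of \<open>w 0\<close>;
  the defect comes from replacing w by a finite sum w' of tensors and vanishes with
  \<epsilon>.\<close>

lemma almost_orthogonal_small:
  assumes w: "w \<in> V" and \<delta>: "0 \<le> \<delta>"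
    and orth: "\<And>k. k \<in> tens_span p V1 V2 \<Longrightarrow>
      Re (tip P (Suc (p + q)) w k) \<le> \<delta> * tnorm P (Suc (p + q)) k"
  shows "(nrm P (w 0))\<^sup>2 \<le> \<delta> * tnorm P (Suc (p + q)) w"
proof -
  let ?S = "drop_first p"
  have main: "(nrm P (w 0))\<^sup>2 \<le> \<delta> * tnorm P (Suc (p + q)) w + 2 * \<epsilon> * nrm P (w 0)" if \<epsilon>: "0 < \<epsilon>" for \<epsilon>
  proof -
    obtain n :: nat and a where a: "\<And>j. j < n \<Longrightarrow> sqi M1 (a j)" and
      close: "tnorm P (Suc q) (\<lambda>k z. ?S w k z - (\<Sum>j<n. a j (fst z) * slice1 M1 (?S w k) (a j) (snd z))) \<le> \<epsilon>"
      by (rule Fourier_approx[OF w \<epsilon>]) (rule that)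
    define g where "g j = (\<lambda>k. slice1 M1 (?S w k) (a j))" for j
    have g: "g j \<in> V2" if "j < n" for j
      unfolding g_def using w a that by (intro slice1_in) auto
    define w' where "w' = (\<lambda>k z. \<Sum>j<n. a j (fst z) * g j k (snd z))"
    have w': "w' \<in> tsp P (Suc q)"
      unfolding w'_def by (intro tsp_sum column_tsp a g) auto
    have Sw: "?S w \<in> tsp P (Suc q)" by (intro drop_first_tsp W.tsp w)
    have close': "tnorm P (Suc q) (\<lambda>k z. ?S w k z - w' k z) \<le> \<epsilon>"
      using close by (simp add: w'_def g_def)
    \<comment> \<open>The family e spans the second factors of w' up to norm 0, so the finite Riesz
      sum is exact in pairings with w', though not with w.\<close>
    have "set (map g [0..<n]) \<subseteq> V2" using g by auto
    from W2.Gram_Schmidt[OF this] obtain m :: nat and e where "\<forall>l<m. e l \<in> V2"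
      and "\<forall>l<m. \<forall>l'<m. tip M2 (Suc q) (e l) (e l') = (if l = l' then 1 else 0)"
      and "\<forall>g\<in>set (map g [0..<n]).
        tnorm M2 (Suc q) (\<lambda>k x. g k x - (\<Sum>l<m. tip M2 (Suc q) g (e l) * e l k x)) = 0"
      by blast
    then have e: "\<And>l. l < m \<Longrightarrow> e l \<in> V2"
      and on: "\<And>l l'. l < m \<Longrightarrow> l' < m \<Longrightarrow> tip M2 (Suc q) (e l) (e l') = (if l = l' then 1 else 0)"
      and res: "\<And>j. j < n \<Longrightarrow>
        tnorm M2 (Suc q) (\<lambda>k x. g j k x - (\<Sum>l<m. tip M2 (Suc q) (g j) (e l) * e l k x)) = 0"
      by simp_all
    define U where "U l = (\<lambda>k. slice2 M2 (w k) (e l 0))" for l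
    have U: "U l \<in> V1" if "l < m" for l
      unfolding U_def using w e that V2_sqi by (intro slice2_in) auto
    define v where "v = (\<lambda>k z. \<Sum>l<m. tens p (U l) (e l) k z)"
    have vK: "v \<in> tens_span p V1 V2"
      unfolding v_def tens_span_def using U e by blast
    define R where "R f = (\<lambda>k z. \<Sum>l<m. slice2 M2 f (e l 0) (fst z) * e l k (snd z))" for f :: "'a \<times> 'b \<Rightarrow> complex"
    note Riesz = Riesz_sum_tsp[of _ m e, OF _ e on, folded R_def]
      Riesz_sum_contractive[of _ m e, OF _ e on, folded R_def]
    have wk: "sqi P (w k)" if "k \<le> p + q" for k using V_sqi[OF w that] .
    \<comment> \<open>In the kept components v is R of \<open>w 0\<close>. In the others it is
      component 0 of R applied to the first-factor derivatives of w, which is the sense in which R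
      commutes with them. Contractivity of R in both places will bound v by w.\<close>
    have Sv: "?S v k = R (w 0) k" for k
      by (auto simp: drop_first_def v_def tens_def R_def U_def fun_eq_iff)
    have vi: "v (Suc i) = R (w (Suc i)) 0" if "i < p" for i
      using that by (auto simp: v_def tens_def R_def U_def fun_eq_iff)
    have Sv': "?S v = R (w 0)" using Sv by auto
    have Svle: "tnorm P (Suc q) (?S v) \<le> nrm P (w 0)"
      unfolding Sv' using wk by (intro Riesz) auto
    have vle: "tnorm P (Suc (p + q)) v \<le> tnorm P (Suc (p + q)) w"
    proof (rule power2_le_imp_le)
      have "(nrm P (v (Suc i)))\<^sup>2 \<le> (nrm P (w (Suc i)))\<^sup>2" if "i < p" for i
      proof (rule power_mono)
        have "nrm P (v (Suc i)) \<le> tnorm P (Suc q) (R (w (Suc i)))"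
          unfolding vi[OF that] by (rule nrm_le_tnorm) simp
        also have "\<dots> \<le> nrm P (w (Suc i))" using wk that by (intro Riesz) auto
        finally show "nrm P (v (Suc i)) \<le> nrm P (w (Suc i))" .
      qed simp
      moreover have "(tnorm P (Suc q) (?S v))\<^sup>2 \<le> (tnorm P (Suc q) (?S w))\<^sup>2"
        using Svle nrm_le_tnorm[of 0 "Suc q" P "?S w"]
        by (intro power_mono) (auto simp: drop_first_def)
      ultimately show "(tnorm P (Suc (p + q)) v)\<^sup>2 \<le> (tnorm P (Suc (p + q)) w)\<^sup>2"
        unfolding tnorm_split by (intro add_mono sum_mono) auto
    qed simp
    have SvT: "?S v \<in> tsp P (Suc q)" unfolding Sv' using wk by (intro Riesz) auto
    have "Re (tip P (Suc q) (?S w) (?S v)) \<le> Re (tip P (Suc (p + q)) w v)"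
    proof -
      have "0 \<le> (\<Sum>i<p. Re (ip P (w (Suc i)) (v (Suc i))))"
      proof (rule sum_nonneg)
        fix i assume "i \<in> {..<p}"
        then have i: "i < p" by simp
        show "0 \<le> Re (ip P (w (Suc i)) (v (Suc i)))"
          using Riesz_sum_nonneg[of "w (Suc i)" m e, OF wk e on] i by (simp add: vi R_def)
      qed
      then show ?thesis by (simp add: tip_split)
    qed
    also have "\<dots> \<le> \<delta> * tnorm P (Suc (p + q)) v" by (rule orth[OF vK])
    also have "\<dots> \<le> \<delta> * tnorm P (Suc (p + q)) w" using vle \<delta> by (rule mult_left_mono)
    finally have 1: "Re (tip P (Suc q) (?S w) (?S v)) \<le> \<delta> * tnorm P (Suc (p + q)) w" .
    \<comment> \<open>T is computed in two ways, as the pairing of w' with v in the kept components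
      and as the \<open>L^2\<close> product of \<open>w' 0\<close> and \<open>w 0\<close>. Their
      equality is the defining property of the Riesz map on the span of e.\<close>
    define T where "T = (\<Sum>j<n. \<Sum>l<m. tip M2 (Suc q) (g j) (e l) * ip M1 (a j) (U l 0))"
    have e0: "sqi M2 (e l 0)" if "l < m" for l using e V2_sqi that by auto
    have U0: "sqi M1 (U l 0)" if "l < m" for l using U V1_sqi that by auto
    have Svsum: "?S v = (\<lambda>k z. \<Sum>l<m. U l 0 (fst z) * e l k (snd z))"
      unfolding Sv' by (simp add: R_def U_def)
    have "tip P (Suc q) w' (?S v) = (\<Sum>j<n. \<Sum>l<m. tip P (Suc q) (\<lambda>k z. a j (fst z) * g j k (snd z))
      (\<lambda>k z. U l 0 (fst z) * e l k (snd z)))"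
      unfolding w'_def using SvT a g U0 e
      by (subst tip_sum_left, simp_all add: column_tsp)
        (intro sum.cong refl, subst Svsum, subst tip_sum_right, simp_all add: column_tsp)
    also have "\<dots> = T"
      unfolding T_def using a g U0 e by (intro sum.cong refl) (auto simp: tip_column)
    finally have tipT: "tip P (Suc q) w' (?S v) = T" .
    have "ip P (w' 0) (w 0) = (\<Sum>j<n. ip P (\<lambda>z. a j (fst z) * g j 0 (snd z)) (w 0))"
      unfolding w'_def using a g V2_sqi wk by (intro ip_sum_left) (auto intro!: sqi_tensor)
    also have "\<dots> = T"
      unfolding T_def
    proof (intro sum.cong refl)
      fix j assume "j \<in> {..<n}"
      then have j: "j < n" by simp
      define c where "c l = tip M2 (Suc q) (g j) (e l)" for l
      define z0 where "z0 = (\<lambda>x. g j 0 x - (\<Sum>l<m. c l * e l 0 x))"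
      have g0: "sqi M2 (g j 0)" using g j V2_sqi by auto
      have z0: "sqi M2 z0" unfolding z0_def by (intro sqi_diff sqi_sum sqi_scale g0 e0) auto
      have "nrm M2 z0 \<le> 0"
        using nrm_le_tnorm[of 0 "Suc q" M2 "\<lambda>k x. g j k x - (\<Sum>l<m. tip M2 (Suc q) (g j) (e l) * e l k x)"]
          res[OF j] by (simp add: z0_def c_def)
      then have z0': "nrm M2 z0 = 0" using nrm_nonneg[of M2 z0] by linarith
      have ae: "sqi P (\<lambda>z. a j (fst z) * e l 0 (snd z))" if "l < m" for l
        using a j e0 that by (intro sqi_tensor) auto
      have "(\<lambda>z. a j (fst z) * g j 0 (snd z)) =
          (\<lambda>z. a j (fst z) * z0 (snd z) + (\<Sum>l<m. c l * (a j (fst z) * e l 0 (snd z))))"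
        by (simp add: z0_def algebra_simps sum_distrib_left)
      then have "ip P (\<lambda>z. a j (fst z) * g j 0 (snd z)) (w 0) = ip P (\<lambda>z. a j (fst z) * z0 (snd z)) (w 0) +
          ip P (\<lambda>z. \<Sum>l<m. c l * (a j (fst z) * e l 0 (snd z))) (w 0)"
        using sqi_tensor[OF a[OF j] z0] wk ae
        by (simp only:, subst ip_add_left)
          (auto intro!: sqi_sum sqi_scale[where f = "\<lambda>z. a j (fst z) * e _ 0 (snd z)"])
      also have "ip P (\<lambda>z. a j (fst z) * z0 (snd z)) (w 0) = 0"
        using ip_Cauchy_Schwarz[OF sqi_tensor[OF a[OF j] z0] wk[of 0]]
        by (simp add: nrm_tensor a j z0 z0')
      also have "ip P (\<lambda>z. \<Sum>l<m. c l * (a j (fst z) * e l 0 (snd z))) (w 0) =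
          (\<Sum>l<m. c l * ip P (\<lambda>z. a j (fst z) * e l 0 (snd z)) (w 0))"
        using ae wk by (subst ip_sum_left)
          (auto intro!: sqi_scale[where f = "\<lambda>z. a j (fst z) * e _ 0 (snd z)"] simp: ip_scale_left)
      also have "\<dots> = (\<Sum>l<m. c l * ip M1 (a j) (U l 0))"
        using a j e0 wk
        by (intro sum.cong refl, subst ip_swap) (simp add: ip_slice2 U_def ip_swap[of M1 "a j"])
      finally show "ip P (\<lambda>z. a j (fst z) * g j 0 (snd z)) (w 0) =
          (\<Sum>l<m. tip M2 (Suc q) (g j) (e l) * ip M1 (a j) (U l 0))"
        by (simp add: c_def)
    qed
    finally have ipT: "ip P (w' 0) (w 0) = T" .
    have d: "(\<lambda>k z. ?S w k z - w' k z) \<in> tsp P (Suc q)" by (rule tsp_diff[OF Sw w'])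
    have w'0: "sqi P (w' 0)" using w' by (auto simp: tsp_def)
    \<comment> \<open>Passing from w to w' costs \<epsilon> times the norm of \<open>w 0\<close>
      twice: here in the \<open>L^2\<close> product, and below in the pairing with v, whose norm is
      at most that of \<open>w 0\<close>.\<close>
    have "(nrm P (w 0))\<^sup>2 = Re (ip P (w 0) (w 0))" by (simp add: ip_self nrm_power2)
    also have "\<dots> = Re T + Re (ip P (\<lambda>z. w 0 z - w' 0 z) (w 0))"
      using wk w'0 by (simp add: ip_diff_left ipT)
    also have "Re (ip P (\<lambda>z. w 0 z - w' 0 z) (w 0)) \<le> nrm P (\<lambda>z. w 0 z - w' 0 z) * nrm P (w 0)"
      using ip_Cauchy_Schwarz[OF sqi_diff[OF wk w'0] wk[of 0], of 0]
        complex_Re_le_cmod[of "ip P (\<lambda>z. w 0 z - w' 0 z) (w 0)"] by linarith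
    also have "\<dots> \<le> \<epsilon> * nrm P (w 0)"
      using nrm_le_tnorm[of 0 "Suc q" P "\<lambda>k z. ?S w k z - w' k z"] close'
      by (intro mult_right_mono) (auto simp: drop_first_def)
    finally have 2: "(nrm P (w 0))\<^sup>2 \<le> Re T + \<epsilon> * nrm P (w 0)" by simp
    have "Re T = Re (tip P (Suc q) (?S w) (?S v)) - Re (tip P (Suc q) (\<lambda>k z. ?S w k z - w' k z) (?S v))"
      using Sw w' SvT by (simp add: tip_diff_left tipT)
    also have "\<dots> \<le> Re (tip P (Suc q) (?S w) (?S v)) +
        tnorm P (Suc q) (\<lambda>k z. ?S w k z - w' k z) * tnorm P (Suc q) (?S v)"
      using tip_Cauchy_Schwarz[OF d SvT]
        abs_Re_le_cmod[of "tip P (Suc q) (\<lambda>k z. ?S w k z - w' k z) (?S v)"] by linarith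
    also have "\<dots> \<le> Re (tip P (Suc q) (?S w) (?S v)) + \<epsilon> * nrm P (w 0)"
      using close' Svle \<epsilon> by (intro add_left_mono mult_mono) auto
    finally have "Re T \<le> Re (tip P (Suc q) (?S w) (?S v)) + \<epsilon> * nrm P (w 0)" .
    then show ?thesis using 1 2 by simp
  qed
  show ?thesis
  proof (rule field_le_epsilon)
    fix e :: real assume e: "0 < e"
    define N where "N = nrm P (w 0) + 1"
    define \<epsilon> where "\<epsilon> = e / (2 * N)"
    have N: "N > 0" "nrm P (w 0) \<le> N" by (auto simp: N_def add_nonneg_pos)
    have "\<epsilon> > 0" using e N by (simp add: \<epsilon>_def)
    moreover have "2 * \<epsilon> * nrm P (w 0) \<le> 2 * \<epsilon> * N"
      using N \<open>\<epsilon> > 0\<close> by (intro mult_left_mono) auto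
    moreover have "2 * \<epsilon> * N = e" using N by (simp add: \<epsilon>_def)
    ultimately show "(nrm P (w 0))\<^sup>2 \<le> \<delta> * tnorm P (Suc (p + q)) w + e"
      using main[of \<epsilon>] by linarith
  qed
qed

theorem tens_span_dense:
  assumes "u \<in> V" "0 < \<epsilon>"
  shows "\<exists>k\<in>tens_span p V1 V2. tnorm P (Suc (p + q)) (\<lambda>i z. u i z - k i z) < \<epsilon>"
  by (rule W.dense_if_almost_orthogonal_small[OF tens_span_tsubspace tens_span_subset
      almost_orthogonal_small weakly_closed assms])

end

section \<open>Bump functions\<close>

abbreviation ext :: "nat \<Rightarrow> point set" where "ext d \<equiv> {..<d} \<rightarrow>\<^sub>E UNIV"

text \<open>A family closed under differentiation, so that a single derivative formula yields
  smoothness, also at the critical point 0.\<close>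

definition flat :: "real poly \<Rightarrow> real \<Rightarrow> real" where
  "flat p s = (if 0 < s then poly p (1 / s) * exp (- (1 / s)) else 0)"

lemma poly_exp_decay: "((\<lambda>x::real. poly p x * exp (- x)) \<longlongrightarrow> 0) at_top"
proof -
  have "((\<lambda>x::real. \<Sum>i\<le>degree p. coeff p i * (x ^ i / exp x)) \<longlongrightarrow> (\<Sum>i\<le>degree p. coeff p i * 0)) at_top"
    by (intro tendsto_intros tendsto_power_div_exp_0)
  moreover have "(\<Sum>i\<le>degree p. coeff p i * (x ^ i / exp x)) = poly p x * exp (- x)" for x :: real
    by (simp add: poly_altdef sum_distrib_right exp_minus divide_inverse mult.assoc)
  ultimately show ?thesis by simp
qed

text \<open>In terms of X = 1 / s, differentiation turns p into (p - p') X^2, and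
  \<open>[:0, 0, 1:]\<close> is X^2. At 0 the difference quotient from the right is X p(X) exp (-
  X), which decays as X grows; from the left it is 0.\<close>

lemma flat_has_derivative:
  "(flat p has_real_derivative flat ((p - pderiv p) * [:0, 0, 1:]) s) (at s)"
proof -
  consider "0 < s" | "s < 0" | "s = 0" by linarith
  then show ?thesis
  proof cases
    case 1
    have "((\<lambda>s. poly p (1 / s) * exp (- (1 / s))) has_real_derivative
        flat ((p - pderiv p) * [:0, 0, 1:]) s) (at s)"
      using 1
      by (auto intro!: derivative_eq_intros DERIV_chain'[OF _ poly_DERIV] simp: flat_def divide_simps power2_eq_square)
        (simp add: algebra_simps)?
    then show ?thesis
    proof (rule has_field_derivative_transform_within_open[where S = "{0<..}"])
      show "poly p (1 / s) * exp (- (1 / s)) = flat p s" if "s \<in> {0<..}" for s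
        using that by (simp add: flat_def)
    qed (use 1 in auto)
  next
    case 2
    have "((\<lambda>_. 0) has_real_derivative flat ((p - pderiv p) * [:0, 0, 1:]) s) (at s)"
      using 2 by (simp add: flat_def)
    then show ?thesis
      by (rule has_field_derivative_transform_within_open[where S = "{..<0}"]) (use 2 in \<open>auto simp: flat_def\<close>)
  next
    case 3
    have "((\<lambda>h. flat p h / h) \<longlongrightarrow> 0) (at_right 0)"
    proof -
      have "((\<lambda>h. poly (p * [:0, 1:]) (inverse h) * exp (- inverse h)) \<longlongrightarrow> 0) (at_right (0::real))"
        by (rule filterlim_compose[OF poly_exp_decay filterlim_inverse_at_top_right])
      then show ?thesis
        by (rule Lim_transform_eventually)
          (auto simp: flat_def eventually_at_right_field divide_simps intro!: exI[of _ 1])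
    qed
    moreover have "((\<lambda>h. flat p h / h) \<longlongrightarrow> 0) (at_left 0)"
      by (rule Lim_transform_eventually[OF tendsto_const])
        (auto simp: flat_def eventually_at_left_field intro!: exI[of _ "-1"])
    ultimately have "((\<lambda>h. flat p h / h) \<longlongrightarrow> 0) (at 0)"
      by (simp add: filterlim_split_at)
    then show ?thesis
      using 3 by (simp add: DERIV_def flat_def)
  qed
qed

text \<open>The affine substitution places the flat end at either side of an interval, a negative
  \<alpha> giving the right one. The factor \<alpha> from the chain rule is absorbed by the
  polynomial, so this family too is closed under differentiation.\<close>

definition shift_flat :: "real \<Rightarrow> real \<Rightarrow> real poly \<Rightarrow> real \<Rightarrow> real" where
  "shift_flat \<alpha> \<beta> p t = flat p (\<alpha> * t + \<beta>)"

lemma shift_flat_has_derivative: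
  "(shift_flat \<alpha> \<beta> p has_real_derivative shift_flat \<alpha> \<beta> (smult \<alpha> ((p - pderiv p) * [:0, 0, 1:])) t) (at t)"
proof -
  have "((\<lambda>t. flat p (\<alpha> * t + \<beta>)) has_real_derivative
      flat ((p - pderiv p) * [:0, 0, 1:]) (\<alpha> * t + \<beta>) * \<alpha>) (at t)"
    by (rule DERIV_chain2[OF flat_has_derivative]) (auto intro!: derivative_eq_intros)
  moreover have "flat q u * \<alpha> = flat (smult \<alpha> q) u" for q u
    by (simp add: flat_def)
  ultimately show ?thesis unfolding shift_flat_def[abs_def] by (simp only:)
qed

section \<open>Calculus of \<open>C_k\<close> functions and of changes of coordinates\<close>

lemma ext_upd: "x \<in> ext d \<Longrightarrow> k < d \<Longrightarrow> x(k := t) \<in> ext d"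
  by (auto simp: PiE_iff extensional_def)

lemma pderiv_at_cong:
  assumes "\<And>x. x \<in> ext d \<Longrightarrow> f x = g x" "x \<in> ext d" "k < d"
  shows "pderiv_at k f x = pderiv_at k g x"
  using assms ext_upd[of x d k] by (simp add: pderiv_at_def)

text \<open>Updating a coordinate below d does not leave the carrier \<open>ext d\<close>, so
  derivatives never see the values outside it.\<close>

lemma C_k_cong:
  "(\<And>x. x \<in> ext d \<Longrightarrow> f x = g x) \<Longrightarrow> C_k d m f \<Longrightarrow> C_k d m g"
proof (induction m arbitrary: f g)
  case 0
  then show ?case using continuous_map_eq[of "powertop_real {..<d}" euclidean f g] by simp
next
  case (Suc m)
  have cont: "continuous_map (powertop_real {..<d}) euclidean g"
    using Suc.prems continuous_map_eq[of "powertop_real {..<d}" euclidean f g] by simp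
  have "(\<lambda>t. f (x(k := t))) = (\<lambda>t. g (x(k := t)))" if "x \<in> ext d" "k < d" for x k
    using Suc.prems(1) ext_upd[OF that] by auto
  moreover have "C_k d m (pderiv_at k g)" if "k < d" for k
    using Suc.IH[of "pderiv_at k f" "pderiv_at k g"] pderiv_at_cong[of d f g, OF Suc.prems(1)] Suc.prems(2) that
    by auto
  ultimately show ?case using cont Suc.prems(2) by simp
qed

lemma C_k_Suc_imp: "C_k d (Suc m) f \<Longrightarrow> C_k d m f"
  by (induction m arbitrary: f) auto

lemma C_k_const: "C_k d m (\<lambda>x. c)"
proof (induction m arbitrary: c)
  case (Suc m)
  have "pderiv_at k (\<lambda>x. c) = (\<lambda>x. 0)" for k by (simp add: pderiv_at_def fun_eq_iff)
  then show ?case using Suc by simp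
qed simp

lemma pderiv_at_vector_derivative:
  "(\<lambda>t. f (x(k := t))) differentiable (at (x k)) \<Longrightarrow>
    ((\<lambda>t. f (x(k := t))) has_vector_derivative pderiv_at k f x) (at (x k))"
  unfolding pderiv_at_def by (simp add: vector_derivative_works)

text \<open>Lets the derivatives be supplied by any formulas that are right on the carrier, where
  \<open>pderiv_at\<close> may differ from them elsewhere.\<close>

lemma C_k_SucI:
  assumes "continuous_map (powertop_real {..<d}) euclidean f"
    and "\<And>k x. k < d \<Longrightarrow> x \<in> ext d \<Longrightarrow> ((\<lambda>t. f (x(k := t))) has_vector_derivative f' k x) (at (x k))"
    and "\<And>k. k < d \<Longrightarrow> C_k d m (f' k)"
  shows "C_k d (Suc m) f"
proof -
  have "C_k d m (pderiv_at k f)" if "k < d" for k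
    by (rule C_k_cong[OF _ assms(3)[OF that]])
      (simp add: pderiv_at_def vector_derivative_at[OF assms(2)[OF that]])
  then show ?thesis
    using assms(1,2) by (auto simp: differentiable_def has_vector_derivative_def)
qed

lemma C_k_continuous: "C_k d m f \<Longrightarrow> continuous_map (powertop_real {..<d}) euclidean f"
  by (cases m) auto

lemma C_k_has_derivative:
  "C_k d (Suc m) f \<Longrightarrow> k < d \<Longrightarrow> x \<in> ext d \<Longrightarrow>
    ((\<lambda>t. f (x(k := t))) has_vector_derivative pderiv_at k f x) (at (x k))"
  by (intro pderiv_at_vector_derivative) auto

lemma C_k_add: "C_k d m f \<Longrightarrow> C_k d m g \<Longrightarrow> C_k d m (\<lambda>x. f x + g x)"
proof (induction m arbitrary: f g)
  case 0
  then show ?case by (auto intro: continuous_map_add)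
next
  case (Suc m)
  show ?case
  proof (rule C_k_SucI)
    show "continuous_map (powertop_real {..<d}) euclidean (\<lambda>x. f x + g x)"
      using Suc.prems by (auto intro: continuous_map_add)
    show "((\<lambda>t. f (x(k := t)) + g (x(k := t))) has_vector_derivative pderiv_at k f x + pderiv_at k g x) (at (x k))"
      if "k < d" "x \<in> ext d" for k x
      by (intro has_vector_derivative_add C_k_has_derivative[OF Suc.prems(1)]
          C_k_has_derivative[OF Suc.prems(2)] that)
    show "C_k d m (\<lambda>x. pderiv_at k f x + pderiv_at k g x)" if "k < d" for k
      using Suc.prems that by (intro Suc.IH) auto
  qed
qed

lemma continuous_map_mult_complex:
  fixes f g :: "'a \<Rightarrow> complex"
  assumes "continuous_map X euclidean f" "continuous_map X euclidean g"
  shows "continuous_map X euclidean (\<lambda>x. f x * g x)"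
proof -
  have "continuous_map X euclidean ((\<lambda>z. fst z * snd z) \<circ> (\<lambda>x. (f x, g x)))"
  proof (rule continuous_map_compose)
    show "continuous_map X (euclidean :: (complex \<times> complex) topology) (\<lambda>x. (f x, g x))"
      using assms by (simp flip: prod_topology_euclidean add: continuous_map_pairedI)
    show "continuous_map euclidean euclidean (\<lambda>z::complex \<times> complex. fst z * snd z)"
      by (simp add: continuous_on_mult continuous_on_fst continuous_on_snd)
  qed
  then show ?thesis by (simp add: o_def)
qed

lemma C_k_mult: "C_k d m f \<Longrightarrow> C_k d m g \<Longrightarrow> C_k d m (\<lambda>x. f x * g x)"
proof (induction m arbitrary: f g)
  case 0
  then show ?case by (auto intro: continuous_map_mult_complex)
next
  case (Suc m)
  show ?case
  proof (rule C_k_SucI)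
    show "continuous_map (powertop_real {..<d}) euclidean (\<lambda>x. f x * g x)"
      using Suc.prems by (auto intro: continuous_map_mult_complex)
    show "((\<lambda>t. f (x(k := t)) * g (x(k := t))) has_vector_derivative
        f x * pderiv_at k g x + pderiv_at k f x * g x) (at (x k))"
      if "k < d" "x \<in> ext d" for k x
      using has_vector_derivative_mult[OF C_k_has_derivative[OF Suc.prems(1) that]
          C_k_has_derivative[OF Suc.prems(2) that]] unfolding fun_upd_triv .
    show "C_k d m (\<lambda>x. f x * pderiv_at k g x + pderiv_at k f x * g x)" if "k < d" for k
      using Suc.prems that C_k_Suc_imp[of d m]
      by (intro C_k_add Suc.IH) (auto simp del: C_k.simps simp: C_k.simps(2)[of d m])
  qed
qed

lemma C_k_prod: "(\<And>i. i \<in> I \<Longrightarrow> C_k d m (f i)) \<Longrightarrow> C_k d m (\<lambda>x. \<Prod>i\<in>I. f i x)"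
  by (induction I rule: infinite_finite_induct) (auto simp: C_k_const intro!: C_k_mult)

text \<open>Maps that copy coordinates or insert constants: input coordinate k feeds output
  coordinate j alone if \<sigma> k is \<open>Some j\<close>, and nothing if it is
  \<open>None\<close>. This covers projections to a factor and the embeddings with one variable
  fixed, and the chain rule has at most one term.\<close>

definition coord_map :: "nat \<Rightarrow> nat \<Rightarrow> (nat \<Rightarrow> nat option) \<Rightarrow> (point \<Rightarrow> point) \<Rightarrow> bool" where
  "coord_map p d \<sigma> h \<longleftrightarrow> continuous_map (powertop_real {..<p}) (powertop_real {..<d}) h \<and>
     (\<forall>k<p. \<forall>x\<in>ext p. case \<sigma> k of None \<Rightarrow> (\<forall>t. h (x(k := t)) = h x)
        | Some j \<Rightarrow> j < d \<and> h x j = x k \<and> (\<forall>t. h (x(k := t)) = (h x)(j := t)))"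

lemma coord_map_ext: "coord_map p d \<sigma> h \<Longrightarrow> x \<in> ext p \<Longrightarrow> h x \<in> ext d"
  unfolding coord_map_def continuous_map_def by auto

lemma pderiv_at_coord_map:
  assumes "coord_map p d \<sigma> h" "k < p" "x \<in> ext p"
  shows "pderiv_at k (\<lambda>x. f (h x)) x = (case \<sigma> k of None \<Rightarrow> 0 | Some j \<Rightarrow> pderiv_at j f (h x))"
  using assms by (force simp: coord_map_def pderiv_at_def split: option.splits)

lemma C_k_coord_map:
  assumes h: "coord_map p d \<sigma> h"
  shows "C_k d m f \<Longrightarrow> C_k p m (\<lambda>x. f (h x))"
proof (induction m arbitrary: f)
  case 0
  then show ?case
    using h continuous_map_compose[of "powertop_real {..<p}" "powertop_real {..<d}" h euclidean f]
    by (simp add: coord_map_def o_def)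
next
  case (Suc m)
  show ?case
  proof (rule C_k_SucI)
    show "continuous_map (powertop_real {..<p}) euclidean (\<lambda>x. f (h x))"
      using h Suc.prems continuous_map_compose[of "powertop_real {..<p}" "powertop_real {..<d}" h euclidean f]
      by (simp add: coord_map_def o_def)
    show "((\<lambda>t. f (h (x(k := t)))) has_vector_derivative
        (case \<sigma> k of None \<Rightarrow> 0 | Some j \<Rightarrow> pderiv_at j f (h x))) (at (x k))"
      if k: "k < p" and x: "x \<in> ext p" for k x
    proof (cases "\<sigma> k")
      case None
      then have "h (x(k := t)) = h x" for t
        using h k x unfolding coord_map_def by (auto split: option.splits)
      then show ?thesis using None by simp
    next
      case (Some j)
      then have j: "j < d" "h x j = x k" "\<And>t. h (x(k := t)) = (h x)(j := t)"
        using h k x unfolding coord_map_def by (auto split: option.splits)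
      show ?thesis
        using C_k_has_derivative[OF Suc.prems j(1) coord_map_ext[OF h x]]
        unfolding Some option.case j(2,3) .
    qed
    show "C_k p m (\<lambda>x. case \<sigma> k of None \<Rightarrow> 0 | Some j \<Rightarrow> pderiv_at j f (h x))" if k: "k < p" for k
    proof (cases "\<sigma> k")
      case None
      then show ?thesis by (simp add: C_k_const)
    next
      case (Some j)
      \<comment> \<open>Some point of the carrier is needed as a witness, because
        \<open>coord_map\<close> asserts j < d only under the quantifier over points.\<close>
      have "(\<lambda>i\<in>{..<p}. 0) \<in> ext p" by simp
      then have "j < d" using h k Some unfolding coord_map_def by (fastforce split: option.splits)
      then show ?thesis using Suc Some by simp
    qed
  qed
qed

lemma continuous_map_coordinate:
  assumes "k < d"
  shows "continuous_map (powertop_real {..<d}) euclidean (\<lambda>x. complex_of_real (shift_flat \<alpha> \<beta> p (x k)))"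
proof -
  have "continuous_on UNIV (\<lambda>t. complex_of_real (shift_flat \<alpha> \<beta> p t))"
    by (intro continuous_on_of_real DERIV_continuous_on[OF DERIV_subset[OF shift_flat_has_derivative]]) auto
  then have 1: "continuous_map euclidean euclidean (\<lambda>t. complex_of_real (shift_flat \<alpha> \<beta> p t))" by simp
  have 2: "continuous_map (powertop_real {..<d}) euclideanreal (\<lambda>x. x k)"
    using assms by (intro continuous_map_product_projection) auto
  show ?thesis using continuous_map_compose[OF 2 1] by (simp add: o_def)
qed

lemma C_k_coordinate:
  "k < d \<Longrightarrow> C_k d m (\<lambda>x. complex_of_real (shift_flat \<alpha> \<beta> p (x k)))"
proof (induction m arbitrary: p)
  case 0
  then show ?case by (simp add: continuous_map_coordinate)
next
  case (Suc m)
  show ?case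
  proof (rule C_k_SucI[OF continuous_map_coordinate[OF Suc.prems]])
    show "((\<lambda>t. complex_of_real (shift_flat \<alpha> \<beta> p ((x(j := t)) k))) has_vector_derivative
      (if j = k then complex_of_real (shift_flat \<alpha> \<beta> (smult \<alpha> ((p - pderiv p) * [:0, 0, 1:])) (x k)) else 0)) (at (x j))"
      if "j < d" "x \<in> ext d" for j x
    proof (cases "j = k")
      case True
      have "((\<lambda>t. complex_of_real (shift_flat \<alpha> \<beta> p t)) has_vector_derivative
          complex_of_real (shift_flat \<alpha> \<beta> (smult \<alpha> ((p - pderiv p) * [:0, 0, 1:])) (x k))) (at (x k))"
        by (intro has_vector_derivative_of_real shift_flat_has_derivative)
      then show ?thesis using True by (simp only: fun_upd_same simp_thms if_True)
    qed simp
    show "C_k d m (\<lambda>x. if j = k then complex_of_real (shift_flat \<alpha> \<beta> (smult \<alpha> ((p - pderiv p) * [:0, 0, 1:])) (x k)) else 0)"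
      for j
      using Suc by (cases "j = k") (simp_all add: C_k_const del: mult_pCons_right)
  qed
qed

section \<open>Boxes and the density of bump functions\<close>

abbreviation leb :: "nat \<Rightarrow> point measure" where "leb d \<equiv> \<Pi>\<^sub>M i\<in>{..<d}. lborel"

definition obox :: "nat \<Rightarrow> point \<Rightarrow> point \<Rightarrow> point set" where
  "obox d l h = (\<Pi>\<^sub>E i\<in>{..<d}. {l i<..<h i})"

definition cbx :: "nat \<Rightarrow> point \<Rightarrow> point \<Rightarrow> point set" where
  "cbx d l h = (\<Pi>\<^sub>E i\<in>{..<d}. {l i..h i})"

interpretation lborels: product_sigma_finite "\<lambda>_::nat. lborel :: real measure" ..

lemma space_leb: "space (leb d) = ext d"
  by (simp add: space_PiM)

lemma obox_sets [measurable]: "obox d l h \<in> sets (leb d)"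
  unfolding obox_def by (intro sets_PiM_I_finite) auto

lemma emeasure_obox_finite: "emeasure (leb d) (obox d l h) < \<infinity>"
proof -
  have "emeasure (leb d) (obox d l h) = (\<Prod>i<d. emeasure lborel {l i<..<h i})"
    unfolding obox_def by (rule lborels.emeasure_PiM) auto
  also have "\<dots> < \<infinity>"
  proof -
    have "emeasure lborel {l i<..<h i} < \<infinity>" for i
      by (cases "l i \<le> h i") auto
    then show ?thesis by (simp add: ennreal_prod_eq_top less_top[symmetric])
  qed
  finally show ?thesis .
qed

text \<open>Rational corners leave only countably many boxes, and having the closed box inside
  \<Omega> will give compact support to the bump on the open one.\<close>

lemma box_between:
  assumes op: "openin (powertop_real {..<d}) \<Omega>" and x: "x \<in> \<Omega>"
  shows "\<exists>l\<in>{..<d} \<rightarrow>\<^sub>E \<rat>. \<exists>h\<in>{..<d} \<rightarrow>\<^sub>E \<rat>. x \<in> obox d l h \<and> cbx d l h \<subseteq> \<Omega>"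
proof -
  obtain U where U: "\<And>i. i < d \<Longrightarrow> open (U i)" "x \<in> Pi\<^sub>E {..<d} U" "Pi\<^sub>E {..<d} U \<subseteq> \<Omega>"
    using op[unfolded openin_product_topology_alt, rule_format, OF x] by auto
  have "\<exists>a\<in>\<rat>. \<exists>b\<in>\<rat>. a < x i \<and> x i < b \<and> {a..b} \<subseteq> U i" if i: "i < d" for i
  proof -
    have "x i \<in> U i" using U(2) i by auto
    then obtain e where e: "e > 0" "cball (x i) e \<subseteq> U i"
      using U(1)[OF i] open_contains_cball by blast
    obtain a where a: "a \<in> \<rat>" "x i - e < a" "a < x i" using Rats_dense_in_real[of "x i - e" "x i"] e by auto
    obtain b where b: "b \<in> \<rat>" "x i < b" "b < x i + e" using Rats_dense_in_real[of "x i" "x i + e"] e by auto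
    have "{a..b} \<subseteq> cball (x i) e" using a b by (auto simp: dist_real_def)
    then show ?thesis using a b e by blast
  qed
  then obtain a b where ab: "\<And>i. i < d \<Longrightarrow> a i \<in> \<rat> \<and> b i \<in> \<rat> \<and> a i < x i \<and> x i < b i \<and> {a i..b i} \<subseteq> U i"
    by metis
  show ?thesis
  proof (rule bexI[of _ "restrict a {..<d}"], rule bexI[of _ "restrict b {..<d}"], rule conjI)
    show "restrict a {..<d} \<in> {..<d} \<rightarrow>\<^sub>E \<rat>" "restrict b {..<d} \<in> {..<d} \<rightarrow>\<^sub>E \<rat>"
      using ab by (simp_all add: restrict_PiE_iff)
    show "x \<in> obox d (restrict a {..<d}) (restrict b {..<d})"
      unfolding obox_def PiE_iff
    proof (intro conjI ballI)
      show "x i \<in> {restrict a {..<d} i<..<restrict b {..<d} i}" if "i \<in> {..<d}" for i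
        using ab[of i] that by simp
      show "x \<in> extensional {..<d}" using U(2) by (simp add: PiE_iff)
    qed
    show "cbx d (restrict a {..<d}) (restrict b {..<d}) \<subseteq> \<Omega>"
    proof
      fix y assume y: "y \<in> cbx d (restrict a {..<d}) (restrict b {..<d})"
      have "y i \<in> U i" if "i < d" for i
      proof -
        have "y i \<in> {restrict a {..<d} i..restrict b {..<d} i}"
          using PiE_mem[OF y[unfolded cbx_def], of i] that by simp
        then have "y i \<in> {a i..b i}" using that by simp
        then show ?thesis using ab[OF that] by blast
      qed
      moreover have "y \<in> extensional {..<d}" using y unfolding cbx_def by (simp only: PiE_iff)
      ultimately have "y \<in> Pi\<^sub>E {..<d} U" by (simp add: PiE_iff)
      then show "y \<in> \<Omega>" using U(3) by blast
    qed
  qed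
qed

lemma open_eq_Union_boxes:
  assumes op: "openin (powertop_real {..<d}) \<Omega>"
  obtains Q :: "nat \<Rightarrow> point set" where "\<Omega> = (\<Union>i. Q i)"
    "\<And>i. Q i = {} \<or> (\<exists>l h. Q i = obox d l h \<and> cbx d l h \<subseteq> \<Omega>)"
proof -
  define R where "R = {..<d} \<rightarrow>\<^sub>E (\<rat> :: real set)"
  define B where "B = {lh \<in> R \<times> R. cbx d (fst lh) (snd lh) \<subseteq> \<Omega>}"
  \<comment> \<open>The empty set is inserted so that the family is nonempty and can be enumerated
    even if \<Omega> is empty.\<close>
  define \<Q> where "\<Q> = insert {} ((\<lambda>lh. obox d (fst lh) (snd lh)) ` B)"
  have "countable R" unfolding R_def by (intro countable_PiE) (simp_all add: countable_rat)
  then have "countable (R \<times> R)" by simp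
  then have "countable B" unfolding B_def by (rule countable_Collect)
  then have "countable \<Q>" by (simp add: \<Q>_def)
  then have range: "range (from_nat_into \<Q>) = \<Q>"
    by (intro range_from_nat_into) (simp_all add: \<Q>_def)
  have sub: "obox d l h \<subseteq> cbx d l h" for l h
    unfolding obox_def cbx_def by (rule PiE_mono) auto
  have \<Q>: "A = {} \<or> (\<exists>l h. A = obox d l h \<and> cbx d l h \<subseteq> \<Omega>)" if "A \<in> \<Q>" for A
    using that unfolding \<Q>_def B_def by blast
  have "\<Omega> = \<Union>\<Q>"
  proof (rule set_eqI, rule iffI)
    fix x assume "x \<in> \<Omega>"
    from box_between[OF op this] obtain l h where lh: "l \<in> R" "h \<in> R" "cbx d l h \<subseteq> \<Omega>" "x \<in> obox d l h"
      unfolding R_def by blast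
    have "(l, h) \<in> B" using lh by (simp add: B_def)
    then have "obox d l h \<in> \<Q>" unfolding \<Q>_def by (intro insertI2 image_eqI[of _ _ "(l, h)"]) simp_all
    then show "x \<in> \<Union>\<Q>" using lh(4) by (rule UnionI)
  next
    fix x assume "x \<in> \<Union>\<Q>"
    then obtain A where A: "A \<in> \<Q>" "x \<in> A" by (rule UnionE)
    from \<Q>[OF A(1)] show "x \<in> \<Omega>"
    proof
      assume "\<exists>l h. A = obox d l h \<and> cbx d l h \<subseteq> \<Omega>"
      then show ?thesis using sub A(2) by blast
    qed (use A(2) in simp)
  qed
  then have "\<Omega> = (\<Union>i. from_nat_into \<Q> i)" by (simp only: range)
  moreover have "from_nat_into \<Q> i = {} \<or> (\<exists>l h. from_nat_into \<Q> i = obox d l h \<and> cbx d l h \<subseteq> \<Omega>)" for i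
    using range by (intro \<Q>) blast
  ultimately show ?thesis by (rule that)
qed

text \<open>The product sigma-algebra is generated by rectangles, not by open sets; it contains the
  latter because countably many boxes exhaust them.\<close>

lemma open_sets:
  assumes "openin (powertop_real {..<d}) \<Omega>"
  shows "\<Omega> \<in> sets (leb d)"
proof -
  obtain Q :: "nat \<Rightarrow> point set" where Q: "\<Omega> = (\<Union>i. Q i)"
    "\<And>i. Q i = {} \<or> (\<exists>l h. Q i = obox d l h \<and> cbx d l h \<subseteq> \<Omega>)"
    by (rule open_eq_Union_boxes[OF assms]) (rule that)
  have "Q i \<in> sets (leb d)" for i using Q(2)[of i] by auto
  then show ?thesis unfolding Q(1) by auto
qed

lemma continuous_map_measurable:
  assumes "continuous_map (powertop_real {..<d}) euclidean (f :: point \<Rightarrow> complex)"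
  shows "f \<in> borel_measurable (leb d)"
proof (rule borel_measurableI)
  fix S :: "complex set" assume "open S"
  then have "openin (powertop_real {..<d}) {x \<in> topspace (powertop_real {..<d}). f x \<in> S}"
    using assms by (intro openin_continuous_map_preimage) auto
  then have "{x \<in> ext d. f x \<in> S} \<in> sets (leb d)" by (intro open_sets) simp
  also have "{x \<in> ext d. f x \<in> S} = f -` S \<inter> space (leb d)" by (auto simp: space_PiM)
  finally show "f -` S \<inter> space (leb d) \<in> sets (leb d)" .
qed

text \<open>Boxes form a generator that is stable under intersection, as induction over disjoint
  unions and complements requires.\<close>

lemma sets_leb_sigma: "sets (leb d) = sigma_sets (ext d) {obox d l h | l h. True}"
proof -
  let ?N = "sigma (ext d) {obox d l h | l h. True}"
  have sub: "{obox d l h | l h. True} \<subseteq> Pow (ext d)" by (auto simp: obox_def PiE_iff)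
  have spN: "space ?N = ext d" using sub by (rule space_measure_of)
  have setsN: "sets ?N = sigma_sets (ext d) {obox d l h | l h. True}" using sub by (rule sets_measure_of)
  have "sets (leb d) \<subseteq> sets ?N"
  proof (rule sets_PiM_in_sets)
    show "space ?N = (\<Pi>\<^sub>E i\<in>{..<d}. space lborel)" using spN by simp
    fix i :: nat and A :: "real set" assume i: "i \<in> {..<d}" and A: "A \<in> sets lborel"
    have "(\<lambda>x. x i) \<in> borel_measurable ?N"
      unfolding borel_measurable_iff_greater spN
    proof
      fix a
      \<comment> \<open>The half-space is exhausted by boxes that grow in all other directions; a k
        above the sum of all absolute values bounds every coordinate of x at once.\<close>
      have "{x \<in> ext d. a < x i} = (\<Union>k::nat. obox d (\<lambda>j. if j = i then a else - real k) (\<lambda>j. real k))"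
      proof (intro set_eqI iffI)
        fix x assume x: "x \<in> {x \<in> ext d. a < x i}"
        obtain k :: nat where k: "(\<Sum>j<d. \<bar>x j\<bar>) < real k" using reals_Archimedean2 by blast
        have "\<bar>x j\<bar> < real k" if "j < d" for j
          using member_le_sum[of j "{..<d}" "\<lambda>j. \<bar>x j\<bar>"] that k by auto
        then have "- real k < x j \<and> x j < real k" if "j < d" for j
          using that by (auto simp: abs_less_iff minus_less_iff)
        then have "x \<in> obox d (\<lambda>j. if j = i then a else - real k) (\<lambda>j. real k)"
          using x by (auto simp: obox_def PiE_iff)
        then show "x \<in> (\<Union>k::nat. obox d (\<lambda>j. if j = i then a else - real k) (\<lambda>j. real k))" by blast
      next
        fix x assume "x \<in> (\<Union>k::nat. obox d (\<lambda>j. if j = i then a else - real k) (\<lambda>j. real k))"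
        then show "x \<in> {x \<in> ext d. a < x i}"
          using i by (auto simp: obox_def PiE_iff dest!: bspec[of _ _ i])
      qed
      also have "\<dots> \<in> sets ?N" unfolding setsN by (intro sigma_sets.Union sigma_sets.Basic) auto
      finally show "{x \<in> ext d. a < x i} \<in> sets ?N" .
    qed
    from measurable_sets[OF this, of A] A show "{x \<in> space ?N. x i \<in> A} \<in> sets ?N"
      by (simp add: vimage_def Int_def conj_commute)
  qed
  moreover have "sigma_sets (ext d) {obox d l h | l h. True} \<subseteq> sets (leb d)"
    using sets.sigma_sets_subset[of "{obox d l h | l h. True}" "leb d"] obox_sets
    unfolding space_leb by blast
  ultimately show ?thesis using setsN by auto
qed

text \<open>
  The profile \<open>exp (- 1 / (m s))\<close> is smooth and increases to \<open>1\<close>, so that no mollification is needed to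
  approximate the indicator function of an open box by test functions.
\<close>

definition bump :: "nat \<Rightarrow> nat \<Rightarrow> point \<Rightarrow> point \<Rightarrow> cfun" where
  "bump d m l h x = (\<Prod>i<d. complex_of_real (shift_flat (real (Suc m)) (- (real (Suc m) * l i)) 1 (x i)) *
     complex_of_real (shift_flat (- real (Suc m)) (real (Suc m) * h i) 1 (x i)))"

lemma shift_flat_eq:
  assumes "0 < c"
  shows "shift_flat c (- (c * a)) 1 t = (if a < t then exp (- (1 / (c * (t - a)))) else 0)"
    "shift_flat (- c) (c * b) 1 t = (if t < b then exp (- (1 / (c * (b - t)))) else 0)"
  using assms by (simp_all add: shift_flat_def flat_def algebra_simps)

lemma bump_outside: "x \<in> ext d \<Longrightarrow> x \<notin> obox d l h \<Longrightarrow> bump d m l h x = 0"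
  unfolding bump_def shift_flat_eq[OF of_nat_0_less_iff[THEN iffD2, OF zero_less_Suc]]
  by (auto simp: obox_def PiE_iff)

lemma norm_bump_le: "cmod (bump d m l h x) \<le> 1"
  unfolding bump_def shift_flat_eq[OF of_nat_0_less_iff[THEN iffD2, OF zero_less_Suc]]
    prod_norm[symmetric]
  by (intro prod_le_1) (auto simp: norm_mult intro!: mult_le_one)

lemma bump_tendsto: "x \<in> obox d l h \<Longrightarrow> (\<lambda>m. bump d m l h x) \<longlonglongrightarrow> 1"
proof -
  assume x: "x \<in> obox d l h"
  have lim: "(\<lambda>m. complex_of_real (exp (- (1 / (real (Suc m) * c))))) \<longlonglongrightarrow> 1" for c
  proof -
    have "(\<lambda>m. inverse (real (Suc m)) * inverse c) \<longlonglongrightarrow> 0 * inverse c"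
      by (intro tendsto_intros LIMSEQ_inverse_real_of_nat)
    then have "(\<lambda>m. complex_of_real (exp (- (inverse (real (Suc m)) * inverse c)))) \<longlonglongrightarrow> of_real (exp (- 0))"
      by (intro tendsto_intros) auto
    then show ?thesis by (simp add: divide_inverse)
  qed
  have "(\<lambda>m. bump d m l h x) \<longlonglongrightarrow> (\<Prod>i<d. 1 * 1)"
    unfolding bump_def shift_flat_eq[OF of_nat_0_less_iff[THEN iffD2, OF zero_less_Suc]]
    using x by (intro tendsto_prod tendsto_mult) (auto simp: obox_def PiE_iff simp del: of_nat_Suc intro: lim)
  then show ?thesis by simp
qed

lemma C_k_bump: "C_k d k (bump d m l h)"
  unfolding bump_def[abs_def] by (intro C_k_prod C_k_mult C_k_coordinate) auto

lemma bump_test_function: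
  assumes "cbx d l h \<subseteq> \<Omega>"
  shows "bump d m l h \<in> test_functions d \<Omega>"
proof -
  have "compactin (powertop_real {..<d}) (cbx d l h)"
    unfolding cbx_def compactin_PiE by auto
  moreover have "bump d m l h x = 0" if "x \<in> ext d - cbx d l h" for x
    using that by (intro bump_outside) (force simp: obox_def cbx_def PiE_iff)+
  ultimately show ?thesis
    using assms C_k_bump by (auto simp: test_functions_def)
qed

text \<open>The linear span, built by adding one bump at a time so that rule induction replaces
  finite sums over boxes and exponents.\<close>

inductive_set bump_span :: "nat \<Rightarrow> point set \<Rightarrow> cfun set" for d \<Omega> where
  zero: "(\<lambda>x. 0) \<in> bump_span d \<Omega>"
| step: "f \<in> bump_span d \<Omega> \<Longrightarrow> cbx d l h \<subseteq> \<Omega> \<Longrightarrow> (\<lambda>x. f x + c * bump d m l h x) \<in> bump_span d \<Omega>"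

lemma bump_span_add: "g \<in> bump_span d \<Omega> \<Longrightarrow> f \<in> bump_span d \<Omega> \<Longrightarrow> (\<lambda>x. f x + g x) \<in> bump_span d \<Omega>"
proof (induction rule: bump_span.induct)
  case (step g l h c m)
  then show ?case using bump_span.step[of "\<lambda>x. f x + g x" d \<Omega> l h c m] by (simp add: add.assoc)
qed simp

lemma bump_span_scale: "f \<in> bump_span d \<Omega> \<Longrightarrow> (\<lambda>x. a * f x) \<in> bump_span d \<Omega>"
proof (induction rule: bump_span.induct)
  case zero
  then show ?case by (simp add: bump_span.zero)
next
  case (step g l h c m)
  then show ?case
    using bump_span.step[of "\<lambda>x. a * g x" d \<Omega> l h "a * c" m] by (simp add: algebra_simps)
qed

lemma bump_in_span: "cbx d l h \<subseteq> \<Omega> \<Longrightarrow> bump d m l h \<in> bump_span d \<Omega>"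
  using bump_span.step[OF bump_span.zero, of d l h \<Omega> 1 m] by simp

section \<open>Closures in \<open>L^2\<close>\<close>

definition l2_closure :: "'a measure \<Rightarrow> ('a \<Rightarrow> complex) set \<Rightarrow> ('a \<Rightarrow> complex) set" where
  "l2_closure M S = {f. sqi M f \<and> (\<forall>\<epsilon>>0. \<exists>g\<in>S. sqi M g \<and> nrm M (\<lambda>x. f x - g x) < \<epsilon>)}"

lemma l2_closure_add:
  assumes S: "\<And>f g. f \<in> S \<Longrightarrow> g \<in> S \<Longrightarrow> (\<lambda>x. f x + g x) \<in> S"
    and f: "f \<in> l2_closure M S" and g: "g \<in> l2_closure M S"
  shows "(\<lambda>x. f x + g x) \<in> l2_closure M S"
  unfolding l2_closure_def
proof (intro CollectI conjI allI impI)
  show "sqi M (\<lambda>x. f x + g x)" using f g by (auto simp: l2_closure_def intro: sqi_add)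
  fix \<epsilon> :: real assume "0 < \<epsilon>"
  then have e: "0 < \<epsilon> / 2" by simp
  obtain f' where f': "f' \<in> S" "sqi M f'" "nrm M (\<lambda>x. f x - f' x) < \<epsilon> / 2"
    using f e unfolding l2_closure_def by blast
  obtain g' where g': "g' \<in> S" "sqi M g'" "nrm M (\<lambda>x. g x - g' x) < \<epsilon> / 2"
    using g e unfolding l2_closure_def by blast
  have "nrm M (\<lambda>x. (f x - f' x) + (g x - g' x)) \<le> nrm M (\<lambda>x. f x - f' x) + nrm M (\<lambda>x. g x - g' x)"
    using f g f' g' by (intro nrm_add_le sqi_diff) (auto simp: l2_closure_def)
  then have "nrm M (\<lambda>x. (f x + g x) - (f' x + g' x)) < \<epsilon>"
    using f' g' by (simp add: algebra_simps)
  then show "\<exists>h\<in>S. sqi M h \<and> nrm M (\<lambda>x. f x + g x - h x) < \<epsilon>"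
    using S[OF f'(1) g'(1)] sqi_add[OF f'(2) g'(2)] by blast
qed

lemma l2_closure_scale:
  assumes S: "\<And>f. f \<in> S \<Longrightarrow> (\<lambda>x. c * f x) \<in> S" and f: "f \<in> l2_closure M S"
  shows "(\<lambda>x. c * f x) \<in> l2_closure M S"
  unfolding l2_closure_def
proof (intro CollectI conjI allI impI)
  show "sqi M (\<lambda>x. c * f x)" using f by (auto simp: l2_closure_def intro: sqi_scale)
  fix \<epsilon> :: real assume \<epsilon>: "0 < \<epsilon>"
  then have e: "0 < \<epsilon> / (cmod c + 1)" by (intro divide_pos_pos) (auto simp: add_nonneg_pos)
  obtain f' where f': "f' \<in> S" "sqi M f'" "nrm M (\<lambda>x. f x - f' x) < \<epsilon> / (cmod c + 1)"
    using f e unfolding l2_closure_def by blast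
  have "nrm M (\<lambda>x. c * f x - c * f' x) = cmod c * nrm M (\<lambda>x. f x - f' x)"
    using nrm_scale[of M c "\<lambda>x. f x - f' x"] by (simp add: algebra_simps)
  also have "\<dots> \<le> (cmod c + 1) * nrm M (\<lambda>x. f x - f' x)" by (intro mult_right_mono) auto
  also have "\<dots> < \<epsilon>" using f'(3) norm_ge_zero[of c] by (simp add: field_simps add_nonneg_pos)
  finally show "\<exists>h\<in>S. sqi M h \<and> nrm M (\<lambda>x. c * f x - h x) < \<epsilon>"
    using S[OF f'(1)] sqi_scale[OF f'(2)] by blast
qed

lemma l2_closure_closed:
  assumes f: "sqi M f" and close: "\<And>\<epsilon>. 0 < \<epsilon> \<Longrightarrow> \<exists>g\<in>l2_closure M S. nrm M (\<lambda>x. f x - g x) < \<epsilon>"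
  shows "f \<in> l2_closure M S"
  unfolding l2_closure_def
proof (intro CollectI conjI allI impI f)
  fix \<epsilon> :: real assume "0 < \<epsilon>"
  then have e: "0 < \<epsilon> / 2" by simp
  obtain g where g: "g \<in> l2_closure M S" "nrm M (\<lambda>x. f x - g x) < \<epsilon> / 2" using close[OF e] by blast
  obtain k where k: "k \<in> S" "sqi M k" "nrm M (\<lambda>x. g x - k x) < \<epsilon> / 2"
    using g e unfolding l2_closure_def by blast
  have "nrm M (\<lambda>x. (f x - g x) + (g x - k x)) \<le> nrm M (\<lambda>x. f x - g x) + nrm M (\<lambda>x. g x - k x)"
    using f g k by (intro nrm_add_le sqi_diff) (auto simp: l2_closure_def)
  then have "nrm M (\<lambda>x. f x - k x) < \<epsilon>" using g k by simp
  then show "\<exists>h\<in>S. sqi M h \<and> nrm M (\<lambda>x. f x - h x) < \<epsilon>" using k by blast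
qed

text \<open>The single limit argument behind all the approximations below: bumps to boxes, boxes to
  measurable sets, simple functions to arbitrary ones. The majorant for dominated convergence is the
  square of 2 F, as both f and \<open>s n\<close> are bounded by F.\<close>

lemma l2_closure_dominated:
  assumes F: "integrable M (\<lambda>x. (F x)\<^sup>2)" and f: "f \<in> borel_measurable M"
    and s: "\<And>n. s n \<in> l2_closure M S"
    and lim: "\<And>x. x \<in> space M \<Longrightarrow> (\<lambda>n. s n x) \<longlonglongrightarrow> f x"
    and bound: "\<And>n x. x \<in> space M \<Longrightarrow> cmod (s n x) \<le> F x"
  shows "f \<in> l2_closure M S"
proof -
  have s': "sqi M (s n)" for n using s by (auto simp: l2_closure_def)
  have [measurable]: "f \<in> borel_measurable M" "\<And>n. s n \<in> borel_measurable M"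
    using f s' by (auto simp: sqi_def)
  have bf: "cmod (f x) \<le> F x" if "x \<in> space M" for x
    using tendsto_norm[OF lim[OF that]] bound[OF that] by (intro LIMSEQ_le_const2) auto
  have f': "sqi M f"
    unfolding sqi_def
  proof (intro conjI f)
    show "integrable M (\<lambda>x. (cmod (f x))\<^sup>2)"
      by (rule Bochner_Integration.integrable_bound[OF F]) (auto intro!: AE_I2 power_mono bf)
  qed
  have "(\<lambda>n. LINT x|M. (cmod (f x - s n x))\<^sup>2) \<longlonglongrightarrow> (LINT x|M. 0)"
  proof (rule integral_dominated_convergence[where w = "\<lambda>x. 4 * (F x)\<^sup>2"])
    show "AE x in M. (\<lambda>n. (cmod (f x - s n x))\<^sup>2) \<longlonglongrightarrow> 0"
    proof (rule AE_I2)
      fix x assume "x \<in> space M"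
      then have "(\<lambda>n. (cmod (f x - s n x))\<^sup>2) \<longlonglongrightarrow> (cmod (f x - f x))\<^sup>2"
        by (intro tendsto_intros lim)
      then show "(\<lambda>n. (cmod (f x - s n x))\<^sup>2) \<longlonglongrightarrow> 0" by simp
    qed
    show "AE x in M. norm ((cmod (f x - s n x))\<^sup>2) \<le> 4 * (F x)\<^sup>2" for n
    proof (rule AE_I2)
      fix x assume x: "x \<in> space M"
      have "cmod (f x - s n x) \<le> 2 * F x"
        using norm_triangle_ineq4[of "f x" "s n x"] bf[OF x] bound[OF x, of n] by simp
      then have "(cmod (f x - s n x))\<^sup>2 \<le> (2 * F x)\<^sup>2" by (rule power_mono) simp
      then show "norm ((cmod (f x - s n x))\<^sup>2) \<le> 4 * (F x)\<^sup>2" by (simp add: power_mult_distrib)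
    qed
  qed (use F in auto)
  then have lim0: "(\<lambda>n. (nrm M (\<lambda>x. f x - s n x))\<^sup>2) \<longlonglongrightarrow> 0" by (simp add: nrm_power2)
  show ?thesis
  proof (rule l2_closure_closed[OF f'])
    fix \<epsilon> :: real assume \<epsilon>: "0 < \<epsilon>"
    then have "eventually (\<lambda>n. (nrm M (\<lambda>x. f x - s n x))\<^sup>2 < \<epsilon>\<^sup>2) sequentially"
      by (intro order_tendstoD(2)[OF lim0]) simp
    then obtain n where "(nrm M (\<lambda>x. f x - s n x))\<^sup>2 < \<epsilon>\<^sup>2" by (auto simp: eventually_sequentially)
    then have "nrm M (\<lambda>x. f x - s n x) < \<epsilon>" using \<epsilon> by (simp add: power2_less_imp_less)
    then show "\<exists>g\<in>l2_closure M S. nrm M (\<lambda>x. f x - g x) < \<epsilon>" using s by blast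
  qed
qed

lemma l2_closure_incl:
  assumes "f \<in> S" "sqi M f"
  shows "f \<in> l2_closure M S"
proof -
  have "nrm M (\<lambda>x. f x - f x) = 0" by (simp add: nrm_def ip_def)
  then show ?thesis using assms unfolding l2_closure_def by fastforce
qed

lemma continuous_lebesgue_dom_measurable:
  "continuous_map (powertop_real {..<d}) euclidean (f :: point \<Rightarrow> complex) \<Longrightarrow>
    f \<in> borel_measurable (lebesgue_dom d \<Omega>)"
  unfolding lebesgue_dom_def by (intro measurable_restrict_space1 continuous_map_measurable)

lemma obox_subset_cbx: "obox d l h \<subseteq> cbx d l h"
  unfolding obox_def cbx_def by (rule PiE_mono) auto

section \<open>Density of bump functions on an open domain\<close>

locale open_domain =
  fixes d :: nat and \<Omega> :: "point set"
  assumes op: "openin (powertop_real {..<d}) \<Omega>"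
begin

abbreviation M :: "point measure" where "M \<equiv> lebesgue_dom d \<Omega>"

lemma \<Omega>_sets: "\<Omega> \<in> sets (leb d)"
  by (rule open_sets[OF op])

lemma \<Omega>_ext: "\<Omega> \<subseteq> ext d"
  using openin_subset[OF op] by simp

lemma space_M: "space M = \<Omega>"
  using \<Omega>_ext by (auto simp: lebesgue_dom_def space_restrict_space space_leb)

lemma sets_M: "A \<in> sets M \<longleftrightarrow> A \<subseteq> \<Omega> \<and> A \<in> sets (leb d)"
  unfolding lebesgue_dom_def using \<Omega>_sets \<Omega>_ext
  by (subst sets_restrict_space_iff) (auto simp: space_leb Int_absorb2)

lemma emeasure_M: "A \<subseteq> \<Omega> \<Longrightarrow> emeasure M A = emeasure (leb d) A"
  unfolding lebesgue_dom_def using \<Omega>_sets \<Omega>_ext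
  by (subst emeasure_restrict_space) (auto simp: space_leb Int_absorb2)

lemma integrable_indicator_obox: "integrable M (\<lambda>x. (indicator (obox d l h) x :: real)\<^sup>2)"
proof -
  have "emeasure (leb d) (obox d l h \<inter> \<Omega>) \<le> emeasure (leb d) (obox d l h)"
    by (rule emeasure_mono) auto
  also have "\<dots> < \<infinity>" by (rule emeasure_obox_finite)
  finally have "integrable M (indicator (obox d l h \<inter> \<Omega>) :: point \<Rightarrow> real)"
    using \<Omega>_sets by (intro integrable_real_indicator) (auto simp: sets_M emeasure_M)
  moreover have "(indicator (obox d l h) x :: real)\<^sup>2 = indicator (obox d l h \<inter> \<Omega>) x" if "x \<in> space M" for x
    using that by (simp add: indicator_def space_M)
  ultimately show ?thesis by (simp cong: Bochner_Integration.integrable_cong)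
qed

lemma norm_bump_le_indicator:
  "x \<in> \<Omega> \<Longrightarrow> cmod (bump d m l h x) \<le> indicator (obox d l h) x"
  using norm_bump_le[of d m l h x] bump_outside[of x d l h m] \<Omega>_ext
  by (cases "x \<in> obox d l h") auto

lemma bump_sqi: "sqi M (bump d m l h)"
  unfolding sqi_def
proof
  show meas: "bump d m l h \<in> borel_measurable M"
    by (intro continuous_lebesgue_dom_measurable C_k_continuous[OF C_k_bump])
  show "integrable M (\<lambda>x. (cmod (bump d m l h x))\<^sup>2)"
  proof (rule Bochner_Integration.integrable_bound[OF integrable_indicator_obox])
    show "(\<lambda>x. (cmod (bump d m l h x))\<^sup>2) \<in> borel_measurable M" using meas by measurable
    show "AE x in M. norm ((cmod (bump d m l h x))\<^sup>2) \<le> norm ((indicator (obox d l h) x :: real)\<^sup>2)"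
      using norm_bump_le_indicator by (intro AE_I2) (auto simp: space_M intro!: power_mono)
  qed
qed

lemma bump_span_sqi: "f \<in> bump_span d \<Omega> \<Longrightarrow> sqi M f"
  by (induction rule: bump_span.induct) (auto intro!: sqi_add sqi_scale bump_sqi)

abbreviation cl :: "cfun set" where "cl \<equiv> l2_closure M (bump_span d \<Omega>)"

lemma cl_add: "f \<in> cl \<Longrightarrow> g \<in> cl \<Longrightarrow> (\<lambda>x. f x + g x) \<in> cl"
  by (rule l2_closure_add) (auto intro: bump_span_add)

lemma cl_scale: "f \<in> cl \<Longrightarrow> (\<lambda>x. c * f x) \<in> cl"
  by (rule l2_closure_scale) (auto intro: bump_span_scale)

lemma cl_diff: "f \<in> cl \<Longrightarrow> g \<in> cl \<Longrightarrow> (\<lambda>x. f x - g x) \<in> cl"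
  using cl_add[of f "\<lambda>x. - 1 * g x"] cl_scale[of g "-1"] by simp

lemma cl_zero: "(\<lambda>x. 0) \<in> cl"
  by (intro l2_closure_incl bump_span.zero sqi_zero)

lemma cl_sum: "(\<And>i. i \<in> I \<Longrightarrow> f i \<in> cl) \<Longrightarrow> (\<lambda>x. \<Sum>i\<in>I. f i x) \<in> cl"
  by (induction I rule: infinite_finite_induct) (auto simp: cl_zero intro!: cl_add)

lemma indicator_obox_cl:
  assumes "cbx d l h \<subseteq> \<Omega>"
  shows "indicator (obox d l h) \<in> cl"
proof (rule l2_closure_dominated[OF integrable_indicator_obox])
  show "(indicator (obox d l h) :: cfun) \<in> borel_measurable M"
    using assms obox_subset_cbx[of d l h] by (intro borel_measurable_indicator) (auto simp: sets_M)
  show "bump d m l h \<in> cl" for m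
    by (intro l2_closure_incl bump_in_span bump_sqi assms)
  show "(\<lambda>m. bump d m l h x) \<longlonglongrightarrow> indicator (obox d l h) x" if "x \<in> space M" for x
    using that bump_tendsto[of x d l h] bump_outside[of x d l h] \<Omega>_ext
    by (cases "x \<in> obox d l h") (auto simp: space_M)
  show "cmod (bump d m l h x) \<le> indicator (obox d l h) x" if "x \<in> space M" for m x
    using that by (intro norm_bump_le_indicator) (simp add: space_M)
qed

text \<open>Boxes meet the fixed box in boxes whose closed versions stay inside \<Omega>, and the
  property passes to complements and disjoint unions. Cutting with a fixed box supplies the
  integrable majorant without which complements and unions could leave \<open>L^2\<close>.\<close>

lemma indicator_Int_obox_cl:
  assumes cb: "cbx d l h \<subseteq> \<Omega>" and A: "A \<in> sets (leb d)"
  shows "indicator (A \<inter> obox d l h) \<in> cl"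
proof -
  let ?Q = "obox d l h"
  let ?G = "{obox d l h | l h. True}"
  have inter: "obox d l h \<inter> obox d l' h' = obox d (\<lambda>i. max (l i) (l' i)) (\<lambda>i. min (h i) (h' i))" for l h l' h'
    unfolding obox_def PiE_Int by (rule PiE_cong) auto
  have int: "Int_stable ?G"
  proof (rule Int_stableI)
    fix A B assume "A \<in> ?G" "B \<in> ?G"
    then obtain l h l' h' where "A = obox d l h" "B = obox d l' h'" by (elim CollectE exE conjE)
    then show "A \<inter> B \<in> ?G" using inter by (intro CollectI exI conjI TrueI) simp
  qed
  have oext: "obox d l h \<subseteq> ext d" for l h unfolding obox_def by (rule PiE_mono) simp
  have sub: "?G \<subseteq> Pow (ext d)" using oext by blast
  have "A \<in> sigma_sets (ext d) ?G" using A by (simp add: sets_leb_sigma)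
  with int sub show ?thesis
  proof (induction rule: sigma_sets_induct_disjoint)
    case (basic A)
    then obtain l' h' where A: "A = obox d l' h'" by auto
    have "cbx d (\<lambda>i. max (l' i) (l i)) (\<lambda>i. min (h' i) (h i)) \<subseteq> cbx d l h"
      unfolding cbx_def by (rule PiE_mono) auto
    then show ?case unfolding A inter using cb by (intro indicator_obox_cl) auto
  next
    case empty
    then show ?case using cl_zero by (simp add: indicator_def[abs_def])
  next
    case (compl A)
    have "indicator ((ext d - A) \<inter> ?Q) = (\<lambda>x. indicator ?Q x - indicator (A \<inter> ?Q) x :: complex)"
      using oext[of l h] by (auto simp: indicator_def fun_eq_iff)
    then show ?case using cl_diff[OF indicator_obox_cl[OF cb] compl(2)] by simp
  next
    case (union A)
    have A: "A i \<in> sets (leb d)" for i using union(2) by (auto simp: sets_leb_sigma)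
    show ?case
    proof (rule l2_closure_dominated[OF integrable_indicator_obox])
      show "(indicator (\<Union> (range A) \<inter> ?Q) :: cfun) \<in> borel_measurable M"
        using A cb obox_subset_cbx[of d l h] by (intro borel_measurable_indicator) (auto simp: sets_M)
      show "(\<lambda>x. \<Sum>i<n. indicator (A i \<inter> ?Q) x) \<in> cl" for n
        by (intro cl_sum union)
      have un: "(\<Sum>i<n. indicator (A i \<inter> ?Q) x :: complex) = indicator ((\<Union>i<n. A i) \<inter> ?Q) x" for n x
      proof -
        have "(\<Union>i<n. A i) \<inter> ?Q = (\<Union>i<n. A i \<inter> ?Q)" by blast
        moreover have "disjoint_family_on (\<lambda>i. A i \<inter> ?Q) {..<n}"
          using union(1) unfolding disjoint_family_on_def by blast
        ultimately show ?thesis by (simp only: indicator_UN_disjoint[OF finite_lessThan])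
      qed
      show "(\<lambda>n. \<Sum>i<n. indicator (A i \<inter> ?Q) x :: complex) \<longlonglongrightarrow> indicator (\<Union> (range A) \<inter> ?Q) x"
        if "x \<in> space M" for x
      proof (cases "\<exists>i. x \<in> A i")
        case True
        then obtain i where i: "x \<in> A i" by blast
        have "eventually (\<lambda>n. (\<Sum>i<n. indicator (A i \<inter> ?Q) x :: complex) = indicator (\<Union> (range A) \<inter> ?Q) x) sequentially"
          unfolding un eventually_sequentially using i by (intro exI[of _ "Suc i"]) (auto simp: indicator_def)
        then show ?thesis by (rule tendsto_eventually)
      next
        case False
        then show ?thesis by simp
      qed
      show "cmod (\<Sum>i<n. indicator (A i \<inter> ?Q) x) \<le> indicator ?Q x" for n x
        unfolding un by (simp add: indicator_def)
    qed
  qed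
qed

text \<open>Countably many boxes cover \<Omega>; the n-th one contributes the part of A in it that
  the earlier boxes have missed, so that the indicators add up. Finite measure of A gives the
  majorant.\<close>

lemma indicator_cl:
  assumes A: "A \<in> sets M" and fin: "emeasure M A < \<infinity>"
  shows "indicator A \<in> cl"
proof -
  obtain Q :: "nat \<Rightarrow> point set" where Q: "\<Omega> = (\<Union>i. Q i)"
    "\<And>i. Q i = {} \<or> (\<exists>l h. Q i = obox d l h \<and> cbx d l h \<subseteq> \<Omega>)"
    by (rule open_eq_Union_boxes[OF op]) (rule that)
  have Qs: "Q i \<in> sets (leb d)" for i using Q(2)[of i] by auto
  have AQ: "indicator (B \<inter> Q i) \<in> cl" if "B \<in> sets (leb d)" for B i
    using Q(2)[of i] indicator_Int_obox_cl[OF _ that] cl_zero by (auto simp: indicator_def[abs_def])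
  have A': "A \<in> sets (leb d)" "A \<subseteq> \<Omega>" using A by (auto simp: sets_M)
  have part: "indicator (A \<inter> (\<Union>i<n. Q i)) \<in> cl" for n
  proof (induction n)
    case 0
    then show ?case using cl_zero by (simp add: indicator_def[abs_def])
  next
    case (Suc n)
    have "indicator (A \<inter> (\<Union>i<Suc n. Q i)) =
        (\<lambda>x. indicator (A \<inter> (\<Union>i<n. Q i)) x + indicator ((A - (\<Union>i<n. Q i)) \<inter> Q n) x :: complex)"
      by (auto simp: indicator_def fun_eq_iff less_Suc_eq)
    moreover have "A - (\<Union>i<n. Q i) \<in> sets (leb d)" using A' Qs by auto
    ultimately show ?case using cl_add[OF Suc.IH AQ] by simp
  qed
  show ?thesis
  proof (rule l2_closure_dominated)
    have "integrable M (indicator A :: point \<Rightarrow> real)" using A fin by (rule integrable_real_indicator)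
    moreover have "(indicator A x :: real)\<^sup>2 = indicator A x" for x by (simp add: indicator_def)
    ultimately show "integrable M (\<lambda>x. (indicator A x :: real)\<^sup>2)" by simp
    show "(indicator A :: cfun) \<in> borel_measurable M" using A by (rule borel_measurable_indicator)
    show "indicator (A \<inter> (\<Union>i<n. Q i)) \<in> cl" for n by (rule part)
    show "(\<lambda>n. indicator (A \<inter> (\<Union>i<n. Q i)) x :: complex) \<longlonglongrightarrow> indicator A x" if x: "x \<in> space M" for x
    proof -
      have "x \<in> (\<Union>i. Q i)" using x unfolding space_M using Q(1) by simp
      then obtain i where i: "x \<in> Q i" by blast
      have "eventually (\<lambda>n. indicator (A \<inter> (\<Union>i<n. Q i)) x = (indicator A x :: complex)) sequentially"
        unfolding eventually_sequentially using i by (intro exI[of _ "Suc i"]) (auto simp: indicator_def)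
      then show ?thesis by (rule tendsto_eventually)
    qed
    show "cmod (indicator (A \<inter> (\<Union>i<n. Q i)) x) \<le> indicator A x" for n x
      by (simp add: indicator_def)
  qed
qed

text \<open>Simple functions with modulus at most 2 |f| converge to f, and their level sets for
  nonzero values have finite measure.\<close>

theorem bump_span_dense:
  assumes f: "sqi M f"
  shows "f \<in> cl"
proof -
  have meas: "f \<in> borel_measurable M" and int: "integrable M (\<lambda>x. (cmod (f x))\<^sup>2)"
    using f by (auto simp: sqi_def)
  obtain F where F: "\<And>i. simple_function M (F i)" "\<And>x. x \<in> space M \<Longrightarrow> (\<lambda>i. F i x) \<longlonglongrightarrow> f x"
    "\<And>i x. x \<in> space M \<Longrightarrow> dist (F i x) 0 \<le> 2 * dist (f x) 0"
    using borel_measurable_implies_sequence_metric[OF meas, of 0] by blast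
  define A where "A i y = F i -` {y} \<inter> space M" for i y
  define s where "s i x = (\<Sum>y\<in>F i ` space M. y * indicator (A i y) x)" for i x
  have sF: "s i x = F i x" if x: "x \<in> space M" for i x
  proof -
    have "s i x = (\<Sum>y\<in>F i ` space M. if y = F i x then y else 0)"
      unfolding s_def using x by (intro sum.cong) (auto simp: A_def indicator_def)
    also have "\<dots> = F i x" using simple_functionD(1)[OF F(1), of i] x by simp
    finally show ?thesis .
  qed
  show ?thesis
  proof (rule l2_closure_dominated[where F = "\<lambda>x. 2 * cmod (f x)" and s = s])
    show "integrable M (\<lambda>x. (2 * cmod (f x))\<^sup>2)" using int by (simp add: power_mult_distrib)
    show "f \<in> borel_measurable M" by (rule meas)
    show "s i \<in> cl" for i
      unfolding s_def
    proof (rule cl_sum)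
      fix y assume "y \<in> F i ` space M"
      have As: "A i y \<in> sets M" unfolding A_def by (rule simple_functionD(2)[OF F(1)])
      show "(\<lambda>x. y * indicator (A i y) x) \<in> cl"
      proof (cases "y = 0")
        case True
        then show ?thesis using cl_zero by simp
      next
        case False
        \<comment> \<open>Chebyshev's inequality: on the level set |y| \<le> 2 |f|, so its indicator
          is bounded by 4 |f|^2 / |y|^2. The value 0 had to be split off because its level set may
          have infinite measure.\<close>
        have "integrable M (indicator (A i y) :: point \<Rightarrow> real)"
        proof (rule Bochner_Integration.integrable_bound)
          show "integrable M (\<lambda>x. 4 * inverse ((cmod y)\<^sup>2) * (cmod (f x))\<^sup>2)" using int by simp
          show "(indicator (A i y) :: point \<Rightarrow> real) \<in> borel_measurable M"
            using As by (rule borel_measurable_indicator)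
          show "AE x in M. norm (indicator (A i y) x :: real) \<le> norm (4 * inverse ((cmod y)\<^sup>2) * (cmod (f x))\<^sup>2)"
          proof (rule AE_I2)
            fix x assume x: "x \<in> space M"
            show "norm (indicator (A i y) x :: real) \<le> norm (4 * inverse ((cmod y)\<^sup>2) * (cmod (f x))\<^sup>2)"
            proof (cases "x \<in> A i y")
              case True
              then have "cmod y \<le> 2 * cmod (f x)" using F(3)[OF x, of i] by (auto simp: A_def dist_norm)
              then have "(cmod y)\<^sup>2 \<le> (2 * cmod (f x))\<^sup>2" by (rule power_mono) simp
              then show ?thesis using True False by (simp add: power_mult_distrib field_simps)
            qed simp
          qed
        qed
        then have "emeasure M (A i y) < \<infinity>" using As by (simp add: integrable_indicator_iff sets.Int_space_eq2)
        then show ?thesis by (intro cl_scale indicator_cl As)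
      qed
    qed
    show "(\<lambda>i. s i x) \<longlonglongrightarrow> f x" if "x \<in> space M" for x
      using F(2)[OF that] sF[OF that] by simp
    show "cmod (s i x) \<le> 2 * cmod (f x)" if "x \<in> space M" for i x
      using F(3)[OF that, of i] sF[OF that] by (simp add: dist_norm)
  qed
qed

end

section \<open>Test functions and weak derivatives\<close>

lemma sqi_cong: "(\<And>x. x \<in> space M \<Longrightarrow> f x = g x) \<Longrightarrow> sqi M f \<longleftrightarrow> sqi M g"
  unfolding sqi_def by (intro conj_cong measurable_cong Bochner_Integration.integrable_cong) auto

lemma nrm_cong: "(\<And>x. x \<in> space M \<Longrightarrow> f x = g x) \<Longrightarrow> nrm M f = nrm M g"
  unfolding nrm_def ip_self by (simp cong: Bochner_Integration.integral_cong)

lemma nrm_cnj: "nrm M (\<lambda>x. cnj (f x)) = nrm M f"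
  by (simp add: nrm_def ip_self)

text \<open>Weak derivatives are defined by a pairing without conjugation; conjugating the test
  function expresses it by the inner product.\<close>

lemma integral_mult_eq_ip: "(LINT x|M. f x * g x) = ip M f (\<lambda>x. cnj (g x))"
  by (simp add: ip_def)

lemma test_functions_continuous:
  "\<phi> \<in> test_functions d \<Omega> \<Longrightarrow> continuous_map (powertop_real {..<d}) euclidean \<phi>"
  using C_k_continuous by (auto simp: test_functions_def)

lemma test_functions_C_k: "\<phi> \<in> test_functions d \<Omega> \<Longrightarrow> C_k d m \<phi>"
  by (auto simp: test_functions_def)

lemma test_functions_zero: "(\<lambda>x. 0) \<in> test_functions d \<Omega>"
  by (auto simp: test_functions_def C_k_const intro!: exI[of _ "{}"])

lemma test_functions_scale: "\<phi> \<in> test_functions d \<Omega> \<Longrightarrow> (\<lambda>x. c * \<phi> x) \<in> test_functions d \<Omega>"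
  unfolding test_functions_def by (force intro: C_k_mult C_k_const)

lemma test_functions_add:
  assumes "\<phi> \<in> test_functions d \<Omega>" "\<psi> \<in> test_functions d \<Omega>"
  shows "(\<lambda>x. \<phi> x + \<psi> x) \<in> test_functions d \<Omega>"
proof -
  obtain K where K: "compactin (powertop_real {..<d}) K" "K \<subseteq> \<Omega>" "\<forall>x\<in>ext d - K. \<phi> x = 0"
    using assms(1) unfolding test_functions_def by blast
  obtain L where L: "compactin (powertop_real {..<d}) L" "L \<subseteq> \<Omega>" "\<forall>x\<in>ext d - L. \<psi> x = 0"
    using assms(2) unfolding test_functions_def by blast
  have "C_k d m (\<lambda>x. \<phi> x + \<psi> x)" for m
    using assms by (intro C_k_add test_functions_C_k)
  then show ?thesis
    unfolding test_functions_def using K L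
    by (intro CollectI conjI allI exI[of _ "K \<union> L"] compactin_Un) auto
qed

lemma bump_span_test_functions: "f \<in> bump_span d \<Omega> \<Longrightarrow> f \<in> test_functions d \<Omega>"
proof (induction rule: bump_span.induct)
  case (step f l h c m)
  then show ?case
    by (intro test_functions_add test_functions_scale[of "bump d m l h"] bump_test_function)
qed (rule test_functions_zero)

lemma continuous_map_coordinate_line:
  assumes "x \<in> ext d" "k < d"
  shows "continuous_map euclideanreal (powertop_real {..<d}) (\<lambda>t. x(k := t))"
proof (rule continuous_map_coordinatewise_then_product)
  show "continuous_map euclideanreal euclideanreal (\<lambda>t. (x(k := t)) i)" for i
    by (cases "i = k") auto
  show "(x(k := t)) i = undefined" if "i \<notin> {..<d}" for i t
    using assms that by (auto simp: PiE_iff extensional_def)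
qed

lemma compact_closed:
  "compactin (powertop_real {..<d}) K \<Longrightarrow> closedin (powertop_real {..<d}) K"
  by (rule compactin_imp_closedin) (auto simp: Hausdorff_space_product_topology)

text \<open>A compact K is closed here, so along the coordinate line \<phi> vanishes on a
  neighbourhood of the point and not just at it.\<close>

lemma pderiv_at_zero_outside:
  assumes K: "compactin (powertop_real {..<d}) K" and z: "\<And>x. x \<in> ext d - K \<Longrightarrow> \<phi> x = 0"
    and x: "x \<in> ext d - K" and k: "k < d"
  shows "pderiv_at k \<phi> x = 0"
proof -
  have "openin (powertop_real {..<d}) (ext d - K)"
    using compact_closed[OF K] by (auto simp: closedin_def)
  from openin_continuous_map_preimage[OF continuous_map_coordinate_line[OF _ k] this, of x]
  have op: "open {t. x(k := t) \<in> ext d - K}" using x by simp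
  have "((\<lambda>t. \<phi> (x(k := t))) has_vector_derivative 0) (at (x k))"
  proof (rule has_vector_derivative_transform_within_open[OF _ op])
    show "((\<lambda>t. 0) has_vector_derivative (0::complex)) (at (x k))" by simp
    show "x k \<in> {t. x(k := t) \<in> ext d - K}" using x by simp
  qed (use z in simp)
  then show ?thesis unfolding pderiv_at_def by (rule vector_derivative_at)
qed

lemma pderiv_at_test_functions:
  assumes "\<phi> \<in> test_functions d \<Omega>" "k < d"
  shows "pderiv_at k \<phi> \<in> test_functions d \<Omega>"
proof -
  obtain K where K: "compactin (powertop_real {..<d}) K" "K \<subseteq> \<Omega>" "\<forall>x\<in>ext d - K. \<phi> x = 0"
    using assms(1) unfolding test_functions_def by blast
  have "C_k d m (pderiv_at k \<phi>)" for m
    using test_functions_C_k[OF assms(1), of "Suc m"] assms(2) by simp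
  moreover have "pderiv_at k \<phi> x = 0" if "x \<in> ext d - K" for x
    using K that assms(2) by (intro pderiv_at_zero_outside[of d K]) auto
  ultimately show ?thesis unfolding test_functions_def using K by blast
qed

text \<open>Puts the support of a test function into a set of finite measure, whence test functions
  are square-integrable.\<close>

lemma compact_subset_obox:
  assumes K: "compactin (powertop_real {..<d}) K"
  obtains l h where "K \<subseteq> obox d l h"
proof -
  have Ksub: "K \<subseteq> ext d" using compactin_subset_topspace[OF K] by simp
  have "\<exists>b. \<forall>x\<in>K. \<bar>x i\<bar> < b" if i: "i < d" for i
  proof -
    have "compactin euclideanreal ((\<lambda>x. x i) ` K)"
      using i by (intro image_compactin[OF K] continuous_map_product_projection) auto
    then have "bounded ((\<lambda>x. x i) ` K)" by (simp add: compact_imp_bounded)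
    then obtain b where "\<forall>y\<in>(\<lambda>x. x i) ` K. norm y \<le> b" unfolding bounded_iff by blast
    then have "\<forall>x\<in>K. \<bar>x i\<bar> < b + 1" by fastforce
    then show ?thesis by blast
  qed
  then obtain b where b: "\<And>i. i < d \<Longrightarrow> \<forall>x\<in>K. \<bar>x i\<bar> < b i" by metis
  have "K \<subseteq> obox d (\<lambda>i. - b i) b"
  proof
    fix x assume x: "x \<in> K"
    show "x \<in> obox d (\<lambda>i. - b i) b"
      unfolding obox_def PiE_iff
    proof (intro conjI ballI)
      show "x i \<in> {- b i<..<b i}" if "i \<in> {..<d}" for i
      proof -
        have "\<bar>x i\<bar> < b i" using b x that by simp
        then show ?thesis by (simp add: abs_less_iff minus_less_iff)
      qed
      show "x \<in> extensional {..<d}" using Ksub x by (auto simp: PiE_iff)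
    qed
  qed
  then show ?thesis by (rule that)
qed

text \<open>The graph of the weak gradient, with the derivative in coordinate k at position
  \<open>Suc k\<close>. Carrying the derivatives along makes the space visibly linear, whereas the
  choice in \<open>weak_pderiv\<close> need not be; \<open>tnorm\<close> is then the
  \<open>H^1\<close> norm.\<close>

definition H1_tuples :: "nat \<Rightarrow> point set \<Rightarrow> (nat \<Rightarrow> cfun) set" where
  "H1_tuples d \<Omega> = {u. (\<forall>k<Suc d. sqi (lebesgue_dom d \<Omega>) (u k)) \<and>
     (\<forall>k<d. is_weak_pderiv d \<Omega> k (u 0) (u (Suc k)))}"

context open_domain
begin

lemma test_functions_sqi:
  assumes "\<phi> \<in> test_functions d \<Omega>"
  shows "sqi M \<phi>"
proof -
  obtain K where K: "compactin (powertop_real {..<d}) K" "K \<subseteq> \<Omega>" "\<forall>x\<in>ext d - K. \<phi> x = 0"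
    using assms(1) unfolding test_functions_def by blast
  obtain l h where lh: "K \<subseteq> obox d l h" by (rule compact_subset_obox[OF K(1)])
  have cont: "continuous_map (powertop_real {..<d}) euclidean \<phi>"
    by (rule test_functions_continuous[OF assms])
  have "compactin euclidean (\<phi> ` K)" by (rule image_compactin[OF K(1) cont])
  then have "bounded (\<phi> ` K)" by (simp add: compact_imp_bounded)
  then obtain B where B: "\<forall>y\<in>\<phi> ` K. cmod y \<le> B" unfolding bounded_iff by blast
  \<comment> \<open>The absolute value is there because B may be negative when K is empty.\<close>
  have bound: "cmod (\<phi> x) \<le> \<bar>B\<bar> * indicator (obox d l h) x" if "x \<in> \<Omega>" for x
  proof (cases "x \<in> K")
    case True
    then have "cmod (\<phi> x) \<le> B" "x \<in> obox d l h" using B lh by auto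
    then show ?thesis by simp
  next
    case False
    then have "\<phi> x = 0" using K(3) \<Omega>_ext that by blast
    then show ?thesis by simp
  qed
  show ?thesis
    unfolding sqi_def
  proof
    show meas: "\<phi> \<in> borel_measurable M" by (rule continuous_lebesgue_dom_measurable[OF cont])
    show "integrable M (\<lambda>x. (cmod (\<phi> x))\<^sup>2)"
    proof (rule Bochner_Integration.integrable_bound)
      show "integrable M (\<lambda>x. \<bar>B\<bar>\<^sup>2 * (indicator (obox d l h) x :: real)\<^sup>2)"
        by (intro integrable_mult_right integrable_indicator_obox)
      show "(\<lambda>x. (cmod (\<phi> x))\<^sup>2) \<in> borel_measurable M" using meas by measurable
      show "AE x in M. norm ((cmod (\<phi> x))\<^sup>2) \<le> norm (\<bar>B\<bar>\<^sup>2 * (indicator (obox d l h) x :: real)\<^sup>2)"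
      proof (rule AE_I2)
        fix x assume "x \<in> space M"
        then have "(cmod (\<phi> x))\<^sup>2 \<le> (\<bar>B\<bar> * indicator (obox d l h) x)\<^sup>2"
          using bound by (intro power_mono) (auto simp: space_M)
        then show "norm ((cmod (\<phi> x))\<^sup>2) \<le> norm (\<bar>B\<bar>\<^sup>2 * (indicator (obox d l h) x :: real)\<^sup>2)"
          by (simp add: power_mult_distrib)
      qed
    qed
  qed
qed

lemma pderiv_at_sqi: "\<phi> \<in> test_functions d \<Omega> \<Longrightarrow> k < d \<Longrightarrow> sqi M (pderiv_at k \<phi>)"
  by (intro test_functions_sqi pderiv_at_test_functions)

lemma weak_pderiv_add:
  assumes "sqi M f" "sqi M f'" "sqi M g" "sqi M g'" "k < d"
    and "is_weak_pderiv d \<Omega> k f g" "is_weak_pderiv d \<Omega> k f' g'"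
  shows "is_weak_pderiv d \<Omega> k (\<lambda>x. f x + f' x) (\<lambda>x. g x + g' x)"
  using assms unfolding is_weak_pderiv_def
  by (simp add: distrib_right sqi_integrable_mult test_functions_sqi pderiv_at_sqi)

lemma weak_pderiv_scale:
  "is_weak_pderiv d \<Omega> k f g \<Longrightarrow> is_weak_pderiv d \<Omega> k (\<lambda>x. c * f x) (\<lambda>x. c * g x)"
  unfolding is_weak_pderiv_def by (simp add: mult.assoc)

lemma H1_tuples_tsubspace: "tsubspace M (Suc d) (H1_tuples d \<Omega>)"
proof
  show "H1_tuples d \<Omega> \<subseteq> tsp M (Suc d)" by (auto simp: H1_tuples_def tsp_def)
  show "(\<lambda>k x. 0) \<in> H1_tuples d \<Omega>" by (simp add: H1_tuples_def is_weak_pderiv_def)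
  show "(\<lambda>k x. u k x + v k x) \<in> H1_tuples d \<Omega>" if "u \<in> H1_tuples d \<Omega>" "v \<in> H1_tuples d \<Omega>" for u v
    using that by (auto simp: H1_tuples_def intro!: sqi_add weak_pderiv_add)
  show "(\<lambda>k x. c * u k x) \<in> H1_tuples d \<Omega>" if "u \<in> H1_tuples d \<Omega>" for u c
    using that by (auto simp: H1_tuples_def intro!: sqi_scale weak_pderiv_scale)
qed

lemma H1_tuples_sqi: "u \<in> H1_tuples d \<Omega> \<Longrightarrow> k \<le> d \<Longrightarrow> sqi M (u k)"
  by (simp add: H1_tuples_def less_Suc_eq_le)

text \<open>If h is the conjugate of a test function \<psi>, integration by parts moves the
  derivative from v to \<psi>, and Cauchy-Schwarz leaves only component 0 of v. In general such
  \<psi> comes within \<epsilon> in \<open>L^2\<close>, and A is the norm of its derivative,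
  independent of v.\<close>

lemma H1_tuples_component_weak:
  assumes h: "sqi M h" and k: "k \<le> d" and \<epsilon>: "0 < \<epsilon>"
  shows "\<exists>A\<ge>0. \<forall>v\<in>H1_tuples d \<Omega>. cmod (ip M h (v k)) \<le> \<epsilon> * nrm M (v k) + A * nrm M (v 0)"
proof (cases k)
  case 0
  have "cmod (ip M h (v k)) \<le> \<epsilon> * nrm M (v k) + nrm M h * nrm M (v 0)" if "v \<in> H1_tuples d \<Omega>" for v
  proof -
    have "cmod (ip M h (v 0)) \<le> nrm M h * nrm M (v 0)"
      by (intro ip_Cauchy_Schwarz h H1_tuples_sqi[OF that]) simp
    also have "\<dots> \<le> \<epsilon> * nrm M (v k) + nrm M h * nrm M (v 0)" using \<epsilon> by simp
    finally show ?thesis using 0 by simp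
  qed
  then show ?thesis by (intro exI[of _ "nrm M h"]) simp
next
  case (Suc j)
  have j: "j < d" using k Suc by simp
  obtain \<psi> where \<psi>: "\<psi> \<in> bump_span d \<Omega>" "nrm M (\<lambda>x. cnj (h x) - \<psi> x) < \<epsilon>"
    using bump_span_dense[OF sqi_cnj[OF h]] \<epsilon> unfolding l2_closure_def by blast
  have \<psi>t: "\<psi> \<in> test_functions d \<Omega>" by (rule bump_span_test_functions[OF \<psi>(1)])
  have \<psi>s: "sqi M \<psi>" by (rule test_functions_sqi[OF \<psi>t])
  have D\<psi>: "sqi M (pderiv_at j \<psi>)" by (rule pderiv_at_sqi[OF \<psi>t j])
  have "cmod (ip M h (v k)) \<le> \<epsilon> * nrm M (v k) + nrm M (pderiv_at j \<psi>) * nrm M (v 0)"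
    if v: "v \<in> H1_tuples d \<Omega>" for v
  proof -
    have vk: "sqi M (v k)" and v0: "sqi M (v 0)" using v k by (auto intro: H1_tuples_sqi)
    have "ip M h (v k) = ip M (\<lambda>x. h x - cnj (\<psi> x)) (v k) + ip M (\<lambda>x. cnj (\<psi> x)) (v k)"
      using h \<psi>s vk by (simp add: ip_diff_left sqi_cnj)
    also have "ip M (\<lambda>x. cnj (\<psi> x)) (v k) = cnj (LINT x|M. v k x * \<psi> x)"
      unfolding integral_mult_eq_ip by (rule ip_swap)
    also have "(LINT x|M. v k x * \<psi> x) = - (LINT x|M. v 0 x * pderiv_at j \<psi> x)"
      using v \<psi>t j Suc by (simp add: H1_tuples_def is_weak_pderiv_def)
    finally have "cmod (ip M h (v k)) \<le> cmod (ip M (\<lambda>x. h x - cnj (\<psi> x)) (v k)) +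
        cmod (ip M (v 0) (\<lambda>x. cnj (pderiv_at j \<psi> x)))"
      unfolding integral_mult_eq_ip by (metis complex_mod_cnj norm_minus_cancel norm_triangle_ineq)
    moreover have "cmod (ip M (\<lambda>x. h x - cnj (\<psi> x)) (v k)) \<le> nrm M (\<lambda>x. h x - cnj (\<psi> x)) * nrm M (v k)"
      using h \<psi>s vk by (intro ip_Cauchy_Schwarz sqi_diff sqi_cnj)
    moreover have "nrm M (\<lambda>x. h x - cnj (\<psi> x)) \<le> \<epsilon>"
      using \<psi>(2) nrm_cnj[of M "\<lambda>x. h x - cnj (\<psi> x)"] by simp
    then have "nrm M (\<lambda>x. h x - cnj (\<psi> x)) * nrm M (v k) \<le> \<epsilon> * nrm M (v k)"
      by (rule mult_right_mono) simp
    moreover have "cmod (ip M (v 0) (\<lambda>x. cnj (pderiv_at j \<psi> x))) \<le> nrm M (v 0) * nrm M (pderiv_at j \<psi>)"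
      using ip_Cauchy_Schwarz[OF v0 sqi_cnj[OF D\<psi>]] by (simp add: nrm_cnj)
    ultimately show ?thesis by (simp add: mult.commute)
  qed
  then show ?thesis by (intro exI[of _ "nrm M (pderiv_at j \<psi>)"]) simp
qed

text \<open>A form of closability of the gradient.\<close>

lemma H1_tuples_weakly_closed:
  assumes w: "w \<in> H1_tuples d \<Omega>" and \<epsilon>: "0 < \<epsilon>"
  shows "\<exists>A\<ge>0. \<forall>v\<in>H1_tuples d \<Omega>. cmod (tip M (Suc d) w v) \<le> \<epsilon> * tnorm M (Suc d) v + A * nrm M (v 0)"
proof -
  define \<eta> where "\<eta> = \<epsilon> / Suc d"
  have \<eta>: "\<eta> > 0" using \<epsilon> by (simp add: \<eta>_def)
  define Q where "Q k A \<longleftrightarrow> 0 \<le> A \<and>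
      (\<forall>v\<in>H1_tuples d \<Omega>. cmod (ip M (w k) (v k)) \<le> \<eta> * nrm M (v k) + A * nrm M (v 0))" for k A
  have "\<exists>A. Q k A" if "k \<le> d" for k
    unfolding Q_def by (rule H1_tuples_component_weak[OF H1_tuples_sqi[OF w that] that \<eta>])
  then obtain A where A: "\<And>k. k \<le> d \<Longrightarrow> Q k (A k)" by metis
  have "cmod (tip M (Suc d) w v) \<le> \<epsilon> * tnorm M (Suc d) v + (\<Sum>k<Suc d. A k) * nrm M (v 0)"
    if v: "v \<in> H1_tuples d \<Omega>" for v
  proof -
    have "cmod (tip M (Suc d) w v) \<le> (\<Sum>k<Suc d. cmod (ip M (w k) (v k)))"
      unfolding tip_def by (rule norm_sum)
    also have "\<dots> \<le> (\<Sum>k<Suc d. \<eta> * tnorm M (Suc d) v + A k * nrm M (v 0))"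
    proof (rule sum_mono)
      fix k assume "k \<in> {..<Suc d}"
      then have k: "k < Suc d" by simp
      have "cmod (ip M (w k) (v k)) \<le> \<eta> * nrm M (v k) + A k * nrm M (v 0)"
        using A[of k] v k by (simp add: Q_def)
      also have "\<eta> * nrm M (v k) \<le> \<eta> * tnorm M (Suc d) v"
        using \<eta> k by (intro mult_left_mono nrm_le_tnorm) auto
      finally show "cmod (ip M (w k) (v k)) \<le> \<eta> * tnorm M (Suc d) v + A k * nrm M (v 0)" by simp
    qed
    also have "\<dots> = Suc d * (\<eta> * tnorm M (Suc d) v) + (\<Sum>k<Suc d. A k) * nrm M (v 0)"
      by (simp add: sum.distrib sum_distrib_right del: sum.lessThan_Suc)
    also have "Suc d * (\<eta> * tnorm M (Suc d) v) = \<epsilon> * tnorm M (Suc d) v"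
      by (simp add: \<eta>_def del: of_nat_Suc)
    finally show ?thesis .
  qed
  moreover have "0 \<le> (\<Sum>k<Suc d. A k)" using A by (intro sum_nonneg) (auto simp: Q_def)
  ultimately show ?thesis by (intro exI[of _ "\<Sum>k<Suc d. A k"] conjI ballI)
qed

text \<open>Uniqueness of weak derivatives. The previous estimate with \<open>v k\<close> as its own
  partner and \<epsilon> half its norm bounds the squared norm by half of itself, because the term
  with A vanishes.\<close>

lemma H1_tuples_unique:
  assumes v: "v \<in> H1_tuples d \<Omega>" and z: "nrm M (v 0) = 0" and k: "k \<le> d"
  shows "nrm M (v k) = 0"
proof (rule ccontr)
  assume "nrm M (v k) \<noteq> 0"
  then have pos: "0 < nrm M (v k)" using nrm_nonneg[of M "v k"] by linarith
  then obtain A where "cmod (ip M (v k) (v k)) \<le> nrm M (v k) / 2 * nrm M (v k) + A * nrm M (v 0)"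
    using H1_tuples_component_weak[OF H1_tuples_sqi[OF v k] k, of "nrm M (v k) / 2"] v by auto
  moreover have "cmod (ip M (v k) (v k)) = nrm M (v k) * nrm M (v k)"
    unfolding ip_self nrm_power2[symmetric] norm_of_real by (simp add: power2_eq_square)
  ultimately show False using pos z by simp
qed

lemma L2_eq: "L2 d \<Omega> = {f. sqi M f}"
  by (simp add: L2_def sqi_def)

lemma l2_norm_eq: "l2_norm d \<Omega> f = nrm M f"
  by (simp add: l2_norm_def nrm_def ip_self)

text \<open>\<open>h1_norm\<close> uses the derivative picked by choice. Putting it into u yields a
  tuple with the same component 0, so by uniqueness it differs from the derivative in u by a
  function of norm 0.\<close>

lemma h1_norm_eq:
  assumes u: "u \<in> H1_tuples d \<Omega>"
  shows "h1_norm d \<Omega> (u 0) = tnorm M (Suc d) u"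
proof -
  have "nrm M (weak_pderiv d \<Omega> k (u 0)) = nrm M (u (Suc k))" if k: "k < d" for k
  proof -
    define g where "g = weak_pderiv d \<Omega> k (u 0)"
    have "u (Suc k) \<in> L2 d \<Omega> \<and> is_weak_pderiv d \<Omega> k (u 0) (u (Suc k))"
      using u k by (simp add: H1_tuples_def L2_eq)
    then have g: "g \<in> L2 d \<Omega> \<and> is_weak_pderiv d \<Omega> k (u 0) g"
      unfolding g_def weak_pderiv_def
      by (rule someI[where P = "\<lambda>g. g \<in> L2 d \<Omega> \<and> is_weak_pderiv d \<Omega> k (u 0) g"])
    then have gs: "sqi M g" by (simp add: L2_eq)
    have us: "sqi M (u (Suc k))" using u k by (intro H1_tuples_sqi) auto
    define u' where "u' i = (if i = Suc k then g else u i)" for i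
    have u': "u' \<in> H1_tuples d \<Omega>"
      using u g gs unfolding H1_tuples_def u'_def by simp
    have D: "(\<lambda>i x. u i x - u' i x) \<in> H1_tuples d \<Omega>"
      by (rule tsubspace.diff[OF H1_tuples_tsubspace u u'])
    have "nrm M (\<lambda>x. u 0 x - u' 0 x) = 0" by (simp add: u'_def nrm_def ip_def)
    then have z: "nrm M (\<lambda>x. u (Suc k) x - g x) = 0"
      using H1_tuples_unique[OF D, of "Suc k"] k by (simp add: u'_def)
    have "nrm M (\<lambda>x. (u (Suc k) x - g x) + g x) \<le> nrm M (\<lambda>x. u (Suc k) x - g x) + nrm M g"
      using us gs by (intro nrm_add_le sqi_diff)
    moreover have "nrm M (\<lambda>x. u (Suc k) x - (u (Suc k) x - g x)) \<le> nrm M (u (Suc k)) + nrm M (\<lambda>x. u (Suc k) x - g x)"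
      using us gs by (intro nrm_diff_le sqi_diff)
    ultimately show ?thesis using z by (simp add: g_def)
  qed
  then have "(h1_norm d \<Omega> (u 0))\<^sup>2 = (tnorm M (Suc d) u)\<^sup>2"
    unfolding h1_norm_def l2_norm_eq tnorm_power2 sum.lessThan_Suc_shift
    by (simp add: sum_nonneg)
  moreover have "0 \<le> h1_norm d \<Omega> (u 0)" by (simp add: h1_norm_def sum_nonneg)
  ultimately show ?thesis by simp
qed

lemma H1_iff_tuple: "f \<in> H1 d \<Omega> \<longleftrightarrow> (\<exists>u\<in>H1_tuples d \<Omega>. u 0 = f)"
proof
  assume f: "f \<in> H1 d \<Omega>"
  then have "\<forall>k. \<exists>g. k < d \<longrightarrow> g \<in> L2 d \<Omega> \<and> is_weak_pderiv d \<Omega> k f g" unfolding H1_def by blast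
  then obtain g where g: "\<And>k. k < d \<Longrightarrow> g k \<in> L2 d \<Omega> \<and> is_weak_pderiv d \<Omega> k f (g k)" by metis
  have "case_nat f g \<in> H1_tuples d \<Omega>"
    using f g by (auto simp: H1_tuples_def L2_eq H1_def split: nat.split)
  then show "\<exists>u\<in>H1_tuples d \<Omega>. u 0 = f" by (intro bexI[of _ "case_nat f g"]) simp
next
  assume "\<exists>u\<in>H1_tuples d \<Omega>. u 0 = f"
  then obtain u where u: "u \<in> H1_tuples d \<Omega>" "u 0 = f" by blast
  have "u (Suc k) \<in> L2 d \<Omega> \<and> is_weak_pderiv d \<Omega> k f (u (Suc k))" if "k < d" for k
    using u that by (auto simp: H1_tuples_def L2_eq)
  moreover have "f \<in> L2 d \<Omega>" using u by (auto simp: H1_tuples_def L2_eq)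
  ultimately show "f \<in> H1 d \<Omega>" unfolding H1_def by blast
qed

end

section \<open>Products of two domains\<close>

definition pr1 :: "nat \<Rightarrow> point \<Rightarrow> point" where
  "pr1 p z = restrict z {..<p}"

definition pr2 :: "nat \<Rightarrow> nat \<Rightarrow> point \<Rightarrow> point" where
  "pr2 p q z = (\<lambda>i\<in>{..<q}. z (p + i))"

definition join :: "nat \<Rightarrow> nat \<Rightarrow> point \<Rightarrow> point \<Rightarrow> point" where
  "join p q x y = (\<lambda>i\<in>{..<p + q}. if i < p then x i else y (i - p))"

lemma pr1_ext: "pr1 p z \<in> ext p"
  by (simp add: pr1_def)

lemma pr2_ext: "pr2 p q z \<in> ext q"
  by (simp add: pr2_def)

lemma join_ext: "join p q x y \<in> ext (p + q)"
  by (simp add: join_def)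

lemma pr1_join: "x \<in> ext p \<Longrightarrow> pr1 p (join p q x y) = x"
  by (auto simp: pr1_def join_def PiE_iff extensional_def fun_eq_iff)

lemma pr2_join: "y \<in> ext q \<Longrightarrow> pr2 p q (join p q x y) = y"
  by (auto simp: pr2_def join_def PiE_iff extensional_def fun_eq_iff)

lemma join_pr: "z \<in> ext (p + q) \<Longrightarrow> join p q (pr1 p z) (pr2 p q z) = z"
  by (auto simp: pr1_def pr2_def join_def PiE_iff extensional_def fun_eq_iff)

lemma continuous_map_coord:
  "i < d \<Longrightarrow> continuous_map (powertop_real {..<d}) euclideanreal (\<lambda>x. x i)"
  by (intro continuous_map_product_projection) simp

text \<open>Here \<tau> describes the map from the output side: coordinate i is the input coordinate
  \<tau> i, or the constant \<open>c i\<close>. Then \<sigma> is the partial inverse of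
  \<tau>.\<close>

lemma coord_mapI:
  assumes "\<And>i x. x \<in> ext p \<Longrightarrow> i < d \<Longrightarrow> h x i = (case \<tau> i of None \<Rightarrow> c i | Some k \<Rightarrow> x k)"
    and "\<And>i k. i < d \<Longrightarrow> \<tau> i = Some k \<Longrightarrow> k < p"
    and "\<And>x. x \<in> ext p \<Longrightarrow> h x \<in> ext d"
    and "\<And>k. k < p \<Longrightarrow> (case \<sigma> k of None \<Rightarrow> \<forall>i<d. \<tau> i \<noteq> Some k
        | Some j \<Rightarrow> j < d \<and> (\<forall>i<d. \<tau> i = Some k \<longleftrightarrow> i = j))"
  shows "coord_map p d \<sigma> h"
  unfolding coord_map_def
proof (intro conjI allI impI ballI)
  show "continuous_map (powertop_real {..<p}) (powertop_real {..<d}) h"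
  proof (rule continuous_map_coordinatewise_then_product)
    fix i assume "i \<in> {..<d}"
    then have i: "i < d" by simp
    have "continuous_map (powertop_real {..<p}) euclideanreal (\<lambda>x. case \<tau> i of None \<Rightarrow> c i | Some k \<Rightarrow> x k)"
    proof (cases "\<tau> i")
      case (Some k)
      then show ?thesis using continuous_map_coord[of k p] assms(2)[OF i] by simp
    qed simp
    then show "continuous_map (powertop_real {..<p}) euclideanreal (\<lambda>x. h x i)"
      by (rule continuous_map_eq) (simp add: assms(1) i)
  next
    show "h x i = undefined" if "i \<notin> {..<d}" "x \<in> topspace (powertop_real {..<p})" for i x
      using PiE_arb[of "h x" "{..<d}" "\<lambda>_. UNIV" i] assms(3)[of x] that by simp
  qed
  fix k x assume k: "k < p" and x: "x \<in> ext p"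
  have upd: "h (x(k := t)) i = (if \<tau> i = Some k then t else h x i)" if "i < d" for i t
    using assms(1)[OF x that] assms(1)[OF ext_upd[OF x k, of t] that] by (auto split: option.splits)
  have out: "h y i = undefined" if "y \<in> ext p" "\<not> i < d" for y i
    using PiE_arb[OF assms(3)[OF that(1)]] that(2) by simp
  show "case \<sigma> k of None \<Rightarrow> (\<forall>t. h (x(k := t)) = h x)
        | Some j \<Rightarrow> j < d \<and> h x j = x k \<and> (\<forall>t. h (x(k := t)) = (h x)(j := t))"
  proof (cases "\<sigma> k")
    case None
    have "h (x(k := t)) i = h x i" for t i
      using assms(4)[OF k] None upd[of i t] out[OF x, of i] out[OF ext_upd[OF x k, of t], of i]
      by (cases "i < d") auto
    then show ?thesis using None by (simp add: fun_eq_iff)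
  next
    case (Some j)
    then have j: "j < d" "\<And>i. i < d \<Longrightarrow> \<tau> i = Some k \<longleftrightarrow> i = j" using assms(4)[OF k] by auto
    have "h (x(k := t)) i = ((h x)(j := t)) i" for t i
      using j upd[of i t] out[OF x, of i] out[OF ext_upd[OF x k, of t], of i]
      by (cases "i < d") auto
    moreover have "\<tau> j = Some k" using j by simp
    then have "h x j = x k" using assms(1)[OF x j(1)] by simp
    ultimately show ?thesis using Some j by (simp add: fun_eq_iff)
  qed
qed

lemma coord_map_pr1: "coord_map (p + q) p (\<lambda>k. if k < p then Some k else None) (pr1 p)"
  by (rule coord_mapI[where \<tau> = Some]) (auto simp: pr1_def)

lemma coord_map_pr2: "coord_map (p + q) q (\<lambda>k. if k < p then None else Some (k - p)) (pr2 p q)"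
  by (rule coord_mapI[where \<tau> = "\<lambda>i. Some (p + i)"]) (auto simp: pr2_def)

lemma coord_map_join1: "coord_map p (p + q) Some (\<lambda>x. join p q x y)"
  by (rule coord_mapI[where \<tau> = "\<lambda>i. if i < p then Some i else None" and c = "\<lambda>i. y (i - p)"])
    (auto simp: join_def split: if_splits)

lemma coord_map_join2: "coord_map q (p + q) (\<lambda>k. Some (p + k)) (\<lambda>y. join p q x y)"
  by (rule coord_mapI[where \<tau> = "\<lambda>i. if i < p then None else Some (i - p)" and c = x])
    (auto simp: join_def split: if_splits)

definition dom2 :: "nat \<Rightarrow> nat \<Rightarrow> point set \<Rightarrow> point set \<Rightarrow> point set" where
  "dom2 p q \<Omega>1 \<Omega>2 = {z \<in> ext (p + q). pr1 p z \<in> \<Omega>1 \<and> pr2 p q z \<in> \<Omega>2}"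

lemma join_measurable [measurable]:
  "(\<lambda>z. join p q (fst z) (snd z)) \<in> measurable (leb p \<Otimes>\<^sub>M leb q) (leb (p + q))"
proof (rule measurable_PiM_single')
  show "(\<lambda>z. join p q (fst z) (snd z) i) \<in> measurable (leb p \<Otimes>\<^sub>M leb q) lborel" if "i \<in> {..<p + q}" for i
    using that by (cases "i < p") (auto simp: join_def)
  show "(\<lambda>\<omega> i. join p q (fst \<omega>) (snd \<omega>) i) \<in> space (leb p \<Otimes>\<^sub>M leb q) \<rightarrow> (\<Pi>\<^sub>E i\<in>{..<p + q}. space lborel)"
    using join_ext by auto
qed

lemma pr1_measurable [measurable]: "pr1 p \<in> measurable (leb (p + q)) (leb p)"
  unfolding pr1_def[abs_def] by (rule measurable_restrict) auto

lemma pr2_measurable [measurable]: "pr2 p q \<in> measurable (leb (p + q)) (leb q)"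
  unfolding pr2_def[abs_def] by (rule measurable_restrict) auto

text \<open>A product measure is determined by its values on rectangles, and the preimage of a
  rectangle under joining is a product of two rectangles.\<close>

lemma leb_join: "distr (leb p \<Otimes>\<^sub>M leb q) (leb (p + q)) (\<lambda>z. join p q (fst z) (snd z)) = leb (p + q)"
proof (rule lborels.PiM_eqI)
  interpret F1: finite_product_sigma_finite "\<lambda>_::nat. lborel :: real measure" "{..<p}" by standard simp
  interpret F2: finite_product_sigma_finite "\<lambda>_::nat. lborel :: real measure" "{..<q}" by standard simp
  fix A :: "nat \<Rightarrow> real set" assume A: "\<And>i. i \<in> {..<p + q} \<Longrightarrow> A i \<in> sets lborel"
  let ?A1 = "Pi\<^sub>E {..<p} A" and ?A2 = "\<Pi>\<^sub>E i\<in>{..<q}. A (p + i)"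
  have pre: "(\<lambda>z. join p q (fst z) (snd z)) -` Pi\<^sub>E {..<p + q} A \<inter> space (leb p \<Otimes>\<^sub>M leb q) = ?A1 \<times> ?A2"
  proof (rule set_eqI, rule iffI)
    fix z assume z: "z \<in> (\<lambda>z. join p q (fst z) (snd z)) -` Pi\<^sub>E {..<p + q} A \<inter> space (leb p \<Otimes>\<^sub>M leb q)"
    then have zs: "fst z \<in> ext p" "snd z \<in> ext q" by (auto simp: space_pair_measure space_leb)
    have j: "join p q (fst z) (snd z) i \<in> A i" if "i < p + q" for i using z that by auto
    have "fst z i \<in> A i" if "i < p" for i using j[of i] that by (simp add: join_def)
    moreover have "snd z i \<in> A (p + i)" if "i < q" for i using j[of "p + i"] that by (simp add: join_def)
    ultimately show "z \<in> ?A1 \<times> ?A2" using zs by (auto simp: mem_Times_iff PiE_iff)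
  next
    fix z assume z: "z \<in> ?A1 \<times> ?A2"
    have "join p q (fst z) (snd z) i \<in> A i" if "i < p + q" for i
    proof (cases "i < p")
      case True
      then show ?thesis using z that by (auto simp: join_def mem_Times_iff)
    next
      case False
      then have "i - p < q" "p + (i - p) = i" using that by auto
      then show ?thesis using z that False PiE_mem[of "snd z" "{..<q}" "\<lambda>i. A (p + i)" "i - p"]
        by (auto simp: join_def mem_Times_iff)
    qed
    moreover have "z \<in> space (leb p \<Otimes>\<^sub>M leb q)"
      using z by (auto simp: space_pair_measure space_leb mem_Times_iff PiE_iff)
    ultimately show "z \<in> (\<lambda>z. join p q (fst z) (snd z)) -` Pi\<^sub>E {..<p + q} A \<inter> space (leb p \<Otimes>\<^sub>M leb q)"
      using join_ext[of p q "fst z" "snd z"] by (auto simp: PiE_iff)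
  qed
  have A2: "A (p + i) \<in> sets lborel" if "i < q" for i using A[of "p + i"] that by simp
  have "Pi\<^sub>E {..<p + q} A \<in> sets (leb (p + q))" using A by (intro sets_PiM_I_finite) auto
  then have "emeasure (distr (leb p \<Otimes>\<^sub>M leb q) (leb (p + q)) (\<lambda>z. join p q (fst z) (snd z))) (Pi\<^sub>E {..<p + q} A)
      = emeasure (leb p \<Otimes>\<^sub>M leb q) (?A1 \<times> ?A2)"
    by (simp only: emeasure_distr[OF join_measurable] pre)
  also have "\<dots> = emeasure (leb p) ?A1 * emeasure (leb q) ?A2"
    using A A2 by (intro F2.emeasure_pair_measure_Times sets_PiM_I_finite) auto
  also have "emeasure (leb p) ?A1 = (\<Prod>i<p. emeasure lborel (A i))"
    using A by (intro lborels.emeasure_PiM) auto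
  also have "emeasure (leb q) ?A2 = (\<Prod>i<q. emeasure lborel (A (p + i)))"
    using A2 by (intro lborels.emeasure_PiM) auto
  also have "(\<Prod>i<p. emeasure lborel (A i)) * (\<Prod>i<q. emeasure lborel (A (p + i))) = (\<Prod>i<p + q. emeasure lborel (A i))"
    by (induction q) (simp_all add: mult.assoc[symmetric])
  finally show "emeasure (distr (leb p \<Otimes>\<^sub>M leb q) (leb (p + q)) (\<lambda>z. join p q (fst z) (snd z))) (Pi\<^sub>E {..<p + q} A)
    = (\<Prod>i\<in>{..<p + q}. emeasure lborel (A i))" .
qed auto

section \<open>The product domain as a product measure space\<close>

locale two_domains = D1: open_domain p \<Omega>1 + D2: open_domain q \<Omega>2
  for p q :: nat and \<Omega>1 \<Omega>2 :: "point set"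
begin

abbreviation \<Omega> :: "point set" where "\<Omega> \<equiv> dom2 p q \<Omega>1 \<Omega>2"

lemma \<Omega>_open: "openin (powertop_real {..<p + q}) \<Omega>"
proof -
  have "openin (powertop_real {..<p + q}) {z \<in> topspace (powertop_real {..<p + q}). pr1 p z \<in> \<Omega>1}"
    using coord_map_pr1[of p q] D1.op
    by (intro openin_continuous_map_preimage) (auto simp: coord_map_def)
  moreover have "openin (powertop_real {..<p + q}) {z \<in> topspace (powertop_real {..<p + q}). pr2 p q z \<in> \<Omega>2}"
    using coord_map_pr2[of p q] D2.op
    by (intro openin_continuous_map_preimage) (auto simp: coord_map_def)
  moreover have "\<Omega> = {z \<in> topspace (powertop_real {..<p + q}). pr1 p z \<in> \<Omega>1} \<inter>
      {z \<in> topspace (powertop_real {..<p + q}). pr2 p q z \<in> \<Omega>2}"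
    by (auto simp: dom2_def)
  ultimately show ?thesis by auto
qed

sublocale D: open_domain "p + q" \<Omega>
  by standard (rule \<Omega>_open)

abbreviation P :: "(point \<times> point) measure" where "P \<equiv> D1.M \<Otimes>\<^sub>M D2.M"

abbreviation J :: "point \<times> point \<Rightarrow> point" where "J z \<equiv> join p q (fst z) (snd z)"

lemma sigma_finite_leb: "sigma_finite_measure (leb d)"
proof -
  interpret finite_product_sigma_finite "\<lambda>_::nat. lborel :: real measure" "{..<d}" by standard simp
  show ?thesis by (rule sigma_finite_measure_axioms)
qed

lemma sigma_finite_M: "sigma_finite_measure D1.M" "sigma_finite_measure D2.M"
  unfolding lebesgue_dom_def
  by (intro sigma_finite_measure_restrict_space[OF sigma_finite_leb] D1.\<Omega>_sets D2.\<Omega>_sets)+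

sublocale pair: pair_sigma_finite D1.M D2.M
  using sigma_finite_M by (simp add: pair_sigma_finite_def)

lemma space_P: "space P = \<Omega>1 \<times> \<Omega>2"
  by (simp add: space_pair_measure D1.space_M D2.space_M)

lemma J_in: "z \<in> space P \<Longrightarrow> J z \<in> \<Omega>"
  using D1.\<Omega>_ext D2.\<Omega>_ext
  by (auto simp: space_P dom2_def join_ext pr1_join pr2_join subset_iff mem_Times_iff)

lemma pr_J: "z \<in> space P \<Longrightarrow> pr1 p (J z) = fst z \<and> pr2 p q (J z) = snd z"
  using D1.\<Omega>_ext D2.\<Omega>_ext by (auto simp: space_P pr1_join pr2_join subset_iff mem_Times_iff)

lemma J_pr: "z \<in> \<Omega> \<Longrightarrow> J (pr1 p z, pr2 p q z) = z"
  by (simp add: dom2_def join_pr)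

lemma J_measurable: "J \<in> measurable P D.M"
proof -
  have "J \<in> measurable P (leb (p + q))"
  proof (rule measurable_compose[OF _ join_measurable])
    have "fst \<in> measurable P (leb p)"
      by (rule measurable_compose[OF measurable_fst]) (simp add: lebesgue_dom_def measurable_restrict_space1)
    moreover have "snd \<in> measurable P (leb q)"
      by (rule measurable_compose[OF measurable_snd]) (simp add: lebesgue_dom_def measurable_restrict_space1)
    ultimately show "(\<lambda>x. x) \<in> measurable P (leb p \<Otimes>\<^sub>M leb q)"
      by (simp add: measurable_pair_iff o_def)
  qed
  then show ?thesis
    unfolding lebesgue_dom_def[of "p + q"] using J_in by (intro measurable_restrict_space2) auto
qed

lemma pr_measurable: "(\<lambda>z. (pr1 p z, pr2 p q z)) \<in> measurable D.M P"
proof (rule measurable_Pair)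
  show "pr1 p \<in> measurable D.M D1.M"
    unfolding lebesgue_dom_def
    by (intro measurable_restrict_space3 pr1_measurable) (auto simp: dom2_def)
  show "pr2 p q \<in> measurable D.M D2.M"
    unfolding lebesgue_dom_def
    by (intro measurable_restrict_space3 pr2_measurable) (auto simp: dom2_def)
qed

text \<open>Reduces \<open>distr_J\<close> to \<open>leb_join\<close> on the whole space. The
  sigma-algebras agree because the identity is measurable in both directions, and the measures are
  compared on rectangles.\<close>

lemma P_eq: "P = restrict_space (leb p \<Otimes>\<^sub>M leb q) (\<Omega>1 \<times> \<Omega>2)"
proof (rule pair_measure_eqI[OF sigma_finite_M])
  have prod: "\<Omega>1 \<times> \<Omega>2 \<in> sets (leb p \<Otimes>\<^sub>M leb q)" using D1.\<Omega>_sets D2.\<Omega>_sets by simp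
  have prod': "\<Omega>1 \<times> \<Omega>2 \<inter> space (leb p \<Otimes>\<^sub>M leb q) = \<Omega>1 \<times> \<Omega>2"
    using sets.sets_into_space[OF prod] by blast
  let ?R = "restrict_space (leb p \<Otimes>\<^sub>M leb q) (\<Omega>1 \<times> \<Omega>2)"
  interpret L2: sigma_finite_measure "leb q" by (rule sigma_finite_leb)
  show "sets P = sets ?R"
  proof (rule antisym)
    have "(\<lambda>z. z) \<in> measurable ?R P"
    proof -
      have "fst \<in> measurable ?R D1.M"
        unfolding lebesgue_dom_def by (rule measurable_restrict_space3[OF measurable_fst]) auto
      moreover have "snd \<in> measurable ?R D2.M"
        unfolding lebesgue_dom_def by (rule measurable_restrict_space3[OF measurable_snd]) auto
      ultimately show ?thesis by (simp add: measurable_pair_iff o_def)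
    qed
    moreover have "space ?R = space P" using prod' by (simp add: space_restrict_space space_P)
    ultimately show "sets P \<subseteq> sets ?R"
      using measurable_sets[of "\<lambda>z. z" ?R P] sets.sets_into_space[of _ P] by (fastforce simp: Int_absorb2)
    have "(\<lambda>z. z) \<in> measurable P (leb p \<Otimes>\<^sub>M leb q)"
    proof -
      have "fst \<in> measurable P (leb p)"
        by (rule measurable_compose[OF measurable_fst]) (simp add: lebesgue_dom_def measurable_restrict_space1)
      moreover have "snd \<in> measurable P (leb q)"
        by (rule measurable_compose[OF measurable_snd]) (simp add: lebesgue_dom_def measurable_restrict_space1)
      ultimately show ?thesis by (simp add: measurable_pair_iff o_def)
    qed
    then have "(\<lambda>z. z) \<in> measurable P ?R"
      by (rule measurable_restrict_space2[rotated]) (auto simp: space_P)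
    then show "sets ?R \<subseteq> sets P"
      using measurable_sets[of "\<lambda>z. z" P ?R] sets.sets_into_space[of _ ?R] \<open>space ?R = space P\<close>
      by (fastforce simp: Int_absorb2)
  qed
  fix A B assume "A \<in> sets D1.M" "B \<in> sets D2.M"
  then have AB: "A \<subseteq> \<Omega>1" "A \<in> sets (leb p)" "B \<subseteq> \<Omega>2" "B \<in> sets (leb q)"
    by (auto simp: D1.sets_M D2.sets_M)
  have "emeasure ?R (A \<times> B) = emeasure (leb p \<Otimes>\<^sub>M leb q) (A \<times> B)"
    using AB prod prod' by (intro emeasure_restrict_space) auto
  also have "\<dots> = emeasure (leb p) A * emeasure (leb q) B"
    using AB by (intro L2.emeasure_pair_measure_Times)
  finally show "emeasure D1.M A * emeasure D2.M B = emeasure ?R (A \<times> B)"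
    using AB by (simp add: D1.emeasure_M D2.emeasure_M)
qed

lemma distr_J: "distr P D.M J = D.M"
proof (rule measure_eqI)
  fix A assume "A \<in> sets (distr P D.M J)"
  then have A: "A \<in> sets D.M" "A \<subseteq> \<Omega>" "A \<in> sets (leb (p + q))" by (auto simp: D.sets_M)
  have prod: "\<Omega>1 \<times> \<Omega>2 \<in> sets (leb p \<Otimes>\<^sub>M leb q)" using D1.\<Omega>_sets D2.\<Omega>_sets by simp
  have prod': "\<Omega>1 \<times> \<Omega>2 \<inter> space (leb p \<Otimes>\<^sub>M leb q) = \<Omega>1 \<times> \<Omega>2"
    using sets.sets_into_space[OF prod] by blast
  \<comment> \<open>If a joined point lies in \<Omega>, its parts lie in the two domains, so
    restricting the preimage of A to their product loses nothing.\<close>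
  have pre: "J -` A \<inter> space P = J -` A \<inter> space (leb p \<Otimes>\<^sub>M leb q)"
  proof (rule set_eqI, rule iffI)
    fix z assume "z \<in> J -` A \<inter> space P"
    then show "z \<in> J -` A \<inter> space (leb p \<Otimes>\<^sub>M leb q)" using prod' by (auto simp: space_P)
  next
    fix z assume z: "z \<in> J -` A \<inter> space (leb p \<Otimes>\<^sub>M leb q)"
    then have "J z \<in> \<Omega>" "fst z \<in> ext p" "snd z \<in> ext q"
      using A(2) by (auto simp: space_pair_measure space_leb)
    then have "fst z \<in> \<Omega>1" "snd z \<in> \<Omega>2" by (auto simp: dom2_def pr1_join pr2_join)
    then show "z \<in> J -` A \<inter> space P" using z by (simp add: space_P mem_Times_iff)
  qed
  have "emeasure (distr P D.M J) A = emeasure P (J -` A \<inter> space P)"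
    using A by (intro emeasure_distr J_measurable)
  also have "\<dots> = emeasure (leb p \<Otimes>\<^sub>M leb q) (J -` A \<inter> space P)"
    unfolding P_eq using prod prod'
    by (intro emeasure_restrict_space) (auto simp: space_restrict_space)
  also have "\<dots> = emeasure (distr (leb p \<Otimes>\<^sub>M leb q) (leb (p + q)) J) A"
    unfolding pre using A by (intro emeasure_distr[symmetric] join_measurable)
  also have "\<dots> = emeasure D.M A" unfolding leb_join using A by (simp add: D.emeasure_M)
  finally show "emeasure (distr P D.M J) A = emeasure D.M A" .
qed simp

lemma integral_J:
  fixes f :: "point \<Rightarrow> 'c::{banach, second_countable_topology}"
  assumes "f \<in> borel_measurable D.M"
  shows "(LINT z|D.M. f z) = (LINT z|P. f (J z))"
  using integral_distr[OF J_measurable assms] by (simp add: distr_J)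

lemma integrable_J:
  fixes f :: "point \<Rightarrow> 'c::{banach, second_countable_topology}"
  assumes "f \<in> borel_measurable D.M"
  shows "integrable D.M f \<longleftrightarrow> integrable P (\<lambda>z. f (J z))"
  using integrable_distr_eq[OF J_measurable assms] by (simp add: distr_J)

lemma sqi_J: "sqi D.M f \<Longrightarrow> sqi P (\<lambda>z. f (J z))"
  unfolding sqi_def using integrable_J[of "\<lambda>x. (cmod (f x))\<^sup>2"] measurable_compose[OF J_measurable, of f]
  by auto

lemma nrm_J: "f \<in> borel_measurable D.M \<Longrightarrow> nrm D.M f = nrm P (\<lambda>z. f (J z))"
  unfolding nrm_def ip_self using integral_J[of "\<lambda>x. (cmod (f x))\<^sup>2"] by simp

text \<open>The abstract density theorem lives on pairs, while \<open>H1_tuples\<close> lives on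
  points with p + q coordinates. This pullback leads from the former to the latter and inverts
  composition with \<open>J\<close> on the domains.\<close>

definition unjoin :: "(point \<times> point \<Rightarrow> complex) \<Rightarrow> cfun" where
  "unjoin w z = w (pr1 p z, pr2 p q z)"

lemma unjoin_J: "z \<in> space P \<Longrightarrow> unjoin w (J z) = w z"
  by (simp add: unjoin_def pr_J)

lemma sqi_unjoin: "sqi D.M (unjoin w) \<longleftrightarrow> sqi P w"
proof
  assume "sqi D.M (unjoin w)"
  from sqi_J[OF this] show "sqi P w" by (simp add: unjoin_J cong: sqi_cong)
next
  assume w: "sqi P w"
  have meas: "unjoin w \<in> borel_measurable D.M"
    unfolding unjoin_def[abs_def] using measurable_compose[OF pr_measurable, of w borel] w
    by (simp add: sqi_def)
  have "integrable P (\<lambda>z. (cmod (unjoin w (J z)))\<^sup>2)"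
    using w by (simp add: sqi_def unjoin_J cong: Bochner_Integration.integrable_cong)
  then show "sqi D.M (unjoin w)"
    unfolding sqi_def using meas integrable_J[of "\<lambda>x. (cmod (unjoin w x))\<^sup>2"] by auto
qed

lemma nrm_unjoin: "sqi P w \<Longrightarrow> nrm D.M (unjoin w) = nrm P w"
  using nrm_J[of "unjoin w"] sqi_unjoin[of w] by (auto simp: sqi_def unjoin_J cong: nrm_cong)

lemma integral_unjoin_mult:
  assumes "sqi P w" "sqi D.M \<phi>"
  shows "(LINT z|D.M. unjoin w z * \<phi> z) = (LINT z|P. w z * \<phi> (J z))"
proof -
  have "unjoin w \<in> borel_measurable D.M" "\<phi> \<in> borel_measurable D.M"
    using assms sqi_unjoin[of w] by (auto simp: sqi_def)
  then have "(LINT z|D.M. unjoin w z * \<phi> z) = (LINT z|P. unjoin w (J z) * \<phi> (J z))"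
    by (intro integral_J) measurable
  then show ?thesis by (simp add: unjoin_J cong: Bochner_Integration.integral_cong)
qed

end

lemma pderiv_at_mult:
  assumes "C_k d (Suc m) f" "C_k d (Suc m) g" "k < d" "x \<in> ext d"
  shows "pderiv_at k (\<lambda>x. f x * g x) x = f x * pderiv_at k g x + pderiv_at k f x * g x"
proof -
  have "((\<lambda>t. f (x(k := t)) * g (x(k := t))) has_vector_derivative
      f x * pderiv_at k g x + pderiv_at k f x * g x) (at (x k))"
    using has_vector_derivative_mult[OF C_k_has_derivative[OF assms(1,3,4)] C_k_has_derivative[OF assms(2,3,4)]]
    unfolding fun_upd_triv .
  then show ?thesis unfolding pderiv_at_def[of k "\<lambda>x. f x * g x"] by (rule vector_derivative_at)
qed

text \<open>Extends an identity tested on bumps in one variable to an arbitrary square-integrable g,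
  which is how slices against g get their weak derivatives.\<close>

lemma (in open_domain) ip_eq_zero_if_bump:
  assumes s: "sqi M s" and g: "sqi M g"
    and z: "\<And>\<psi>. \<psi> \<in> bump_span d \<Omega> \<Longrightarrow> ip M s (\<lambda>x. cnj (\<psi> x)) = 0"
  shows "ip M s g = 0"
proof -
  have "cmod (ip M s g) \<le> e" if e: "0 < e" for e
  proof -
    define \<eta> where "\<eta> = e / (nrm M s + 1)"
    have pos: "0 < nrm M s + 1" using nrm_nonneg[of M s] by linarith
    then have \<eta>: "0 < \<eta>" using e by (simp add: \<eta>_def)
    obtain \<psi> where \<psi>: "\<psi> \<in> bump_span d \<Omega>" "nrm M (\<lambda>x. cnj (g x) - \<psi> x) < \<eta>"
      using bump_span_dense[OF sqi_cnj[OF g]] \<eta> unfolding l2_closure_def by blast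
    have \<psi>s: "sqi M (\<lambda>x. cnj (\<psi> x))" by (intro sqi_cnj bump_span_sqi \<psi>(1))
    have "ip M s g = ip M s (\<lambda>x. g x - cnj (\<psi> x))"
      using s g \<psi>s z[OF \<psi>(1)] by (simp add: ip_diff_right)
    then have "cmod (ip M s g) \<le> nrm M s * nrm M (\<lambda>x. g x - cnj (\<psi> x))"
      using ip_Cauchy_Schwarz[OF s sqi_diff[OF g \<psi>s]] by simp
    also have "nrm M (\<lambda>x. g x - cnj (\<psi> x)) = nrm M (\<lambda>x. cnj (g x) - \<psi> x)"
      using nrm_cnj[of M "\<lambda>x. g x - cnj (\<psi> x)"] by simp
    also have "nrm M s * nrm M (\<lambda>x. cnj (g x) - \<psi> x) \<le> (nrm M s + 1) * \<eta>"
      using \<psi>(2) pos by (intro mult_mono) auto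
    also have "\<dots> = e" using pos by (simp add: \<eta>_def)
    finally show ?thesis .
  qed
  then have "cmod (ip M s g) \<le> 0" by (rule field_le_epsilon) simp
  then show ?thesis by simp
qed

section \<open>Weak derivatives of tensors and of slices\<close>

context two_domains
begin

lemma continuous_map_join:
  "continuous_map (prod_topology (powertop_real {..<p}) (powertop_real {..<q})) (powertop_real {..<p + q}) J"
proof (rule continuous_map_coordinatewise_then_product)
  fix i assume i: "i \<in> {..<p + q}"
  show "continuous_map (prod_topology (powertop_real {..<p}) (powertop_real {..<q})) euclideanreal (\<lambda>z. J z i)"
  proof (cases "i < p")
    case True
    have "continuous_map (prod_topology (powertop_real {..<p}) (powertop_real {..<q})) euclideanreal ((\<lambda>x. x i) \<circ> fst)"
      by (rule continuous_map_compose[OF continuous_map_fst continuous_map_coord[OF True]])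
    then show ?thesis using True i by (simp add: o_def join_def)
  next
    case False
    then have iq: "i - p < q" using i by auto
    have "continuous_map (prod_topology (powertop_real {..<p}) (powertop_real {..<q})) euclideanreal ((\<lambda>x. x (i - p)) \<circ> snd)"
      by (rule continuous_map_compose[OF continuous_map_snd continuous_map_coord[OF iq]])
    then show ?thesis using False i by (simp add: o_def join_def)
  qed
qed (simp add: join_def)

lemma tensor_test_function:
  assumes \<phi>: "\<phi> \<in> test_functions p \<Omega>1" and \<psi>: "\<psi> \<in> test_functions q \<Omega>2"
  shows "(\<lambda>z. \<phi> (pr1 p z) * \<psi> (pr2 p q z)) \<in> test_functions (p + q) \<Omega>"
proof -
  obtain K where K: "compactin (powertop_real {..<p}) K" "K \<subseteq> \<Omega>1" "\<forall>x\<in>ext p - K. \<phi> x = 0"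
    using \<phi> unfolding test_functions_def by blast
  obtain L where L: "compactin (powertop_real {..<q}) L" "L \<subseteq> \<Omega>2" "\<forall>x\<in>ext q - L. \<psi> x = 0"
    using \<psi> unfolding test_functions_def by blast
  have "compactin (prod_topology (powertop_real {..<p}) (powertop_real {..<q})) (K \<times> L)"
    using K L by (simp add: compactin_Times)
  from image_compactin[OF this continuous_map_join]
  have 1: "compactin (powertop_real {..<p + q}) (J ` (K \<times> L))" .
  have 2: "J ` (K \<times> L) \<subseteq> \<Omega>"
  proof
    fix u assume "u \<in> J ` (K \<times> L)"
    then obtain z where z: "z \<in> K \<times> L" "u = J z" by blast
    then have "z \<in> space P" using K L by (auto simp: space_P)
    then show "u \<in> \<Omega>" using J_in z by simp
  qed
  have 3: "\<phi> (pr1 p z) * \<psi> (pr2 p q z) = 0" if z: "z \<in> ext (p + q) - J ` (K \<times> L)" for z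
  proof (cases "pr1 p z \<in> K \<and> pr2 p q z \<in> L")
    case True
    then have "J (pr1 p z, pr2 p q z) \<in> J ` (K \<times> L)" by blast
    then show ?thesis using z join_pr[of z p q] by simp
  next
    case False
    then show ?thesis using K(3) L(3) pr1_ext[of p z] pr2_ext[of p q z] by auto
  qed
  have "C_k (p + q) m (\<lambda>z. \<phi> (pr1 p z) * \<psi> (pr2 p q z))" for m
    by (intro C_k_mult C_k_coord_map[OF coord_map_pr1] C_k_coord_map[OF coord_map_pr2]
        test_functions_C_k[OF \<phi>] test_functions_C_k[OF \<psi>])
  then show ?thesis
    unfolding test_functions_def using 1 2 3 by blast
qed

lemma pderiv_at_tensor:
  assumes \<phi>: "\<phi> \<in> test_functions p \<Omega>1" and \<psi>: "\<psi> \<in> test_functions q \<Omega>2" and z: "z \<in> ext (p + q)"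
  shows "k < p \<Longrightarrow> pderiv_at k (\<lambda>z. \<phi> (pr1 p z) * \<psi> (pr2 p q z)) z = pderiv_at k \<phi> (pr1 p z) * \<psi> (pr2 p q z)"
    and "j < q \<Longrightarrow> pderiv_at (p + j) (\<lambda>z. \<phi> (pr1 p z) * \<psi> (pr2 p q z)) z = \<phi> (pr1 p z) * pderiv_at j \<psi> (pr2 p q z)"
proof -
  have 1: "C_k (p + q) (Suc 0) (\<lambda>z. \<phi> (pr1 p z))"
    by (rule C_k_coord_map[OF coord_map_pr1 test_functions_C_k[OF \<phi>]])
  have 2: "C_k (p + q) (Suc 0) (\<lambda>z. \<psi> (pr2 p q z))"
    by (rule C_k_coord_map[OF coord_map_pr2 test_functions_C_k[OF \<psi>]])
  show "pderiv_at k (\<lambda>z. \<phi> (pr1 p z) * \<psi> (pr2 p q z)) z = pderiv_at k \<phi> (pr1 p z) * \<psi> (pr2 p q z)" if "k < p"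
    using pderiv_at_mult[OF 1 2 _ z, of k] pderiv_at_coord_map[OF coord_map_pr1 _ z, of k \<phi>]
      pderiv_at_coord_map[OF coord_map_pr2 _ z, of k \<psi>] that by simp
  show "pderiv_at (p + j) (\<lambda>z. \<phi> (pr1 p z) * \<psi> (pr2 p q z)) z = \<phi> (pr1 p z) * pderiv_at j \<psi> (pr2 p q z)" if "j < q"
    using pderiv_at_mult[OF 1 2 _ z, of "p + j"] pderiv_at_coord_map[OF coord_map_pr1 _ z, of "p + j" \<phi>]
      pderiv_at_coord_map[OF coord_map_pr2 _ z, of "p + j" \<psi>] that by simp
qed

text \<open>The support of a slice lies in the projection of K to the free variable, which is
  compact whatever the value of the fixed variable.\<close>

lemma slice_test_function:
  assumes \<phi>: "\<phi> \<in> test_functions (p + q) \<Omega>"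
  shows "y \<in> ext q \<Longrightarrow> (\<lambda>x. \<phi> (join p q x y)) \<in> test_functions p \<Omega>1"
    and "x \<in> ext p \<Longrightarrow> (\<lambda>y. \<phi> (join p q x y)) \<in> test_functions q \<Omega>2"
proof -
  obtain K where K: "compactin (powertop_real {..<p + q}) K" "K \<subseteq> \<Omega>" "\<forall>x\<in>ext (p + q) - K. \<phi> x = 0"
    using \<phi> unfolding test_functions_def by blast
  show "(\<lambda>x. \<phi> (join p q x y)) \<in> test_functions p \<Omega>1"
  proof -
    have 1: "compactin (powertop_real {..<p}) (pr1 p ` K)"
      using coord_map_pr1[of p q] by (intro image_compactin[OF K(1)]) (simp add: coord_map_def)
    have 2: "pr1 p ` K \<subseteq> \<Omega>1" using K(2) by (auto simp: dom2_def)
    have 3: "\<phi> (join p q x y) = 0" if x: "x \<in> ext p - pr1 p ` K" for x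
    proof -
      have "join p q x y \<notin> K" using x pr1_join[of x p q y] by force
      then show ?thesis using K(3) join_ext[of p q x y] by simp
    qed
    have "C_k p m (\<lambda>x. \<phi> (join p q x y))" for m
      by (intro C_k_coord_map[OF coord_map_join1] test_functions_C_k[OF \<phi>])
    then show ?thesis unfolding test_functions_def using 1 2 3 by blast
  qed
  show "(\<lambda>y. \<phi> (join p q x y)) \<in> test_functions q \<Omega>2"
  proof -
    have 1: "compactin (powertop_real {..<q}) (pr2 p q ` K)"
      using coord_map_pr2[of p q] by (intro image_compactin[OF K(1)]) (simp add: coord_map_def)
    have 2: "pr2 p q ` K \<subseteq> \<Omega>2" using K(2) by (auto simp: dom2_def)
    have 3: "\<phi> (join p q x y) = 0" if y: "y \<in> ext q - pr2 p q ` K" for y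
    proof -
      have "join p q x y \<notin> K" using y pr2_join[of y q p x] by force
      then show ?thesis using K(3) join_ext[of p q x y] by simp
    qed
    have "C_k q m (\<lambda>y. \<phi> (join p q x y))" for m
      by (intro C_k_coord_map[OF coord_map_join2] test_functions_C_k[OF \<phi>])
    then show ?thesis unfolding test_functions_def using 1 2 3 by blast
  qed
qed

text \<open>Both orders are needed, since the variable in which one integrates by parts has to be
  the inner one.\<close>

lemma Fubini_tensor:
  assumes a: "sqi D1.M a" and b: "sqi D2.M b" and g: "sqi D.M g"
  shows "(LINT z|P. a (fst z) * b (snd z) * g (J z)) = (LINT y|D2.M. b y * (LINT x|D1.M. a x * g (join p q x y)))"
    and "(LINT z|P. a (fst z) * b (snd z) * g (J z)) = (LINT x|D1.M. a x * (LINT y|D2.M. b y * g (join p q x y)))"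
proof -
  have int: "integrable P (\<lambda>z. a (fst z) * b (snd z) * g (J z))"
    by (rule sqi_integrable_mult[OF pair.sqi_tensor[OF a b] sqi_J[OF g]])
  then have int': "integrable P (case_prod (\<lambda>x y. a x * b y * g (join p q x y)))"
    by (simp add: case_prod_beta')
  have "(LINT z|P. a (fst z) * b (snd z) * g (J z)) = (LINT y|D2.M. LINT x|D1.M. a x * b y * g (join p q x y))"
    using pair.integral_snd[OF int'] by (simp add: case_prod_beta')
  also have "\<dots> = (LINT y|D2.M. b y * (LINT x|D1.M. a x * g (join p q x y)))"
  proof -
    have "(LINT x|D1.M. a x * b y * g (join p q x y)) = b y * (LINT x|D1.M. a x * g (join p q x y))" for y
      by (subst Bochner_Integration.integral_mult_right_zero[symmetric]) (simp add: mult_ac)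
    then show ?thesis by simp
  qed
  finally show "(LINT z|P. a (fst z) * b (snd z) * g (J z)) = (LINT y|D2.M. b y * (LINT x|D1.M. a x * g (join p q x y)))" .
  have "(LINT z|P. a (fst z) * b (snd z) * g (J z)) = (LINT x|D1.M. LINT y|D2.M. a x * b y * g (join p q x y))"
    using pair.integral_fst[OF int'] by (simp add: case_prod_beta')
  also have "\<dots> = (LINT x|D1.M. a x * (LINT y|D2.M. b y * g (join p q x y)))"
    by (simp add: mult.assoc)
  finally show "(LINT z|P. a (fst z) * b (snd z) * g (J z)) = (LINT x|D1.M. a x * (LINT y|D2.M. b y * g (join p q x y)))" .
qed

text \<open>For each fixed y the slice of \<phi> is a test function on the first domain, so the weak
  derivative of a applies inside the integral over y, where b is a mere factor.\<close>

lemma weak_pderiv_tensor1: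
  assumes a: "sqi D1.M a" "sqi D1.M a'" and b: "sqi D2.M b" and k: "k < p"
    and weak: "is_weak_pderiv p \<Omega>1 k a a'"
  shows "is_weak_pderiv (p + q) \<Omega> k (unjoin (\<lambda>z. a (fst z) * b (snd z))) (unjoin (\<lambda>z. a' (fst z) * b (snd z)))"
  unfolding is_weak_pderiv_def
proof
  fix \<phi> assume \<phi>: "\<phi> \<in> test_functions (p + q) \<Omega>"
  have D\<phi>: "sqi D.M (pderiv_at k \<phi>)" using k by (intro D.pderiv_at_sqi \<phi>) simp
  have s\<phi>: "sqi D.M \<phi>" by (rule D.test_functions_sqi[OF \<phi>])
  have inner: "(LINT x|D1.M. a x * pderiv_at k \<phi> (join p q x y)) = - (LINT x|D1.M. a' x * \<phi> (join p q x y))"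
    if y: "y \<in> space D2.M" for y
  proof -
    have y': "y \<in> ext q" using y D2.\<Omega>_ext by (auto simp: D2.space_M)
    have "pderiv_at k \<phi> (join p q x y) = pderiv_at k (\<lambda>x. \<phi> (join p q x y)) x" if "x \<in> space D1.M" for x
    proof -
      have "x \<in> ext p" using that D1.\<Omega>_ext by (auto simp: D1.space_M)
      then show ?thesis using pderiv_at_coord_map[OF coord_map_join1 k, of x \<phi>] by simp
    qed
    then have "(LINT x|D1.M. a x * pderiv_at k \<phi> (join p q x y)) =
        (LINT x|D1.M. a x * pderiv_at k (\<lambda>x. \<phi> (join p q x y)) x)"
      by (simp cong: Bochner_Integration.integral_cong)
    then show ?thesis
      using weak slice_test_function(1)[OF \<phi> y'] unfolding is_weak_pderiv_def by simp
  qed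
  have "(LINT z|D.M. unjoin (\<lambda>z. a (fst z) * b (snd z)) z * pderiv_at k \<phi> z) =
      (LINT y|D2.M. b y * (LINT x|D1.M. a x * pderiv_at k \<phi> (join p q x y)))"
    using integral_unjoin_mult[OF pair.sqi_tensor[OF a(1) b] D\<phi>] Fubini_tensor(1)[OF a(1) b D\<phi>] by simp
  also have "\<dots> = - (LINT y|D2.M. b y * (LINT x|D1.M. a' x * \<phi> (join p q x y)))"
    by (simp add: inner cong: Bochner_Integration.integral_cong)
  also have "(LINT y|D2.M. b y * (LINT x|D1.M. a' x * \<phi> (join p q x y))) =
      (LINT z|D.M. unjoin (\<lambda>z. a' (fst z) * b (snd z)) z * \<phi> z)"
    using integral_unjoin_mult[OF pair.sqi_tensor[OF a(2) b] s\<phi>] Fubini_tensor(1)[OF a(2) b s\<phi>] by simp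
  finally show "(LINT z|D.M. unjoin (\<lambda>z. a (fst z) * b (snd z)) z * pderiv_at k \<phi> z) =
      - (LINT z|D.M. unjoin (\<lambda>z. a' (fst z) * b (snd z)) z * \<phi> z)" .
qed

lemma weak_pderiv_tensor2:
  assumes a: "sqi D1.M a" and b: "sqi D2.M b" "sqi D2.M b'" and j: "j < q"
    and weak: "is_weak_pderiv q \<Omega>2 j b b'"
  shows "is_weak_pderiv (p + q) \<Omega> (p + j) (unjoin (\<lambda>z. a (fst z) * b (snd z))) (unjoin (\<lambda>z. a (fst z) * b' (snd z)))"
  unfolding is_weak_pderiv_def
proof
  fix \<phi> assume \<phi>: "\<phi> \<in> test_functions (p + q) \<Omega>"
  have D\<phi>: "sqi D.M (pderiv_at (p + j) \<phi>)" using j by (intro D.pderiv_at_sqi \<phi>) simp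
  have s\<phi>: "sqi D.M \<phi>" by (rule D.test_functions_sqi[OF \<phi>])
  have inner: "(LINT y|D2.M. b y * pderiv_at (p + j) \<phi> (join p q x y)) = - (LINT y|D2.M. b' y * \<phi> (join p q x y))"
    if x: "x \<in> space D1.M" for x
  proof -
    have x': "x \<in> ext p" using x D1.\<Omega>_ext by (auto simp: D1.space_M)
    have "pderiv_at (p + j) \<phi> (join p q x y) = pderiv_at j (\<lambda>y. \<phi> (join p q x y)) y" if "y \<in> space D2.M" for y
    proof -
      have "y \<in> ext q" using that D2.\<Omega>_ext by (auto simp: D2.space_M)
      then show ?thesis using pderiv_at_coord_map[OF coord_map_join2 j, of y \<phi>] by simp
    qed
    then have "(LINT y|D2.M. b y * pderiv_at (p + j) \<phi> (join p q x y)) =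
        (LINT y|D2.M. b y * pderiv_at j (\<lambda>y. \<phi> (join p q x y)) y)"
      by (simp cong: Bochner_Integration.integral_cong)
    then show ?thesis
      using weak slice_test_function(2)[OF \<phi> x'] unfolding is_weak_pderiv_def by simp
  qed
  have "(LINT z|D.M. unjoin (\<lambda>z. a (fst z) * b (snd z)) z * pderiv_at (p + j) \<phi> z) =
      (LINT x|D1.M. a x * (LINT y|D2.M. b y * pderiv_at (p + j) \<phi> (join p q x y)))"
    using integral_unjoin_mult[OF pair.sqi_tensor[OF a b(1)] D\<phi>] Fubini_tensor(2)[OF a b(1) D\<phi>] by simp
  also have "\<dots> = - (LINT x|D1.M. a x * (LINT y|D2.M. b' y * \<phi> (join p q x y)))"
    by (simp add: inner cong: Bochner_Integration.integral_cong)
  also have "(LINT x|D1.M. a x * (LINT y|D2.M. b' y * \<phi> (join p q x y))) =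
      (LINT z|D.M. unjoin (\<lambda>z. a (fst z) * b' (snd z)) z * \<phi> z)"
    using integral_unjoin_mult[OF pair.sqi_tensor[OF a b(2)] s\<phi>] Fubini_tensor(2)[OF a b(2) s\<phi>] by simp
  finally show "(LINT z|D.M. unjoin (\<lambda>z. a (fst z) * b (snd z)) z * pderiv_at (p + j) \<phi> z) =
      - (LINT z|D.M. unjoin (\<lambda>z. a (fst z) * b' (snd z)) z * \<phi> z)" .
qed

definition V :: "(nat \<Rightarrow> point \<times> point \<Rightarrow> complex) set" where
  "V = {w. (\<lambda>k. unjoin (w k)) \<in> H1_tuples (p + q) \<Omega>}"

lemma V_sqi: "w \<in> V \<Longrightarrow> k \<le> p + q \<Longrightarrow> sqi P (w k)"
  using D.H1_tuples_sqi[of "\<lambda>k. unjoin (w k)" k] by (simp add: V_def sqi_unjoin)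

lemma tens_in_V:
  assumes a: "a \<in> H1_tuples p \<Omega>1" and b: "b \<in> H1_tuples q \<Omega>2"
  shows "tens p a b \<in> V"
proof -
  have a': "sqi D1.M (a k)" if "k \<le> p" for k by (rule D1.H1_tuples_sqi[OF a that])
  have b': "sqi D2.M (b k)" if "k \<le> q" for k by (rule D2.H1_tuples_sqi[OF b that])
  have t1: "tens p a b k = (\<lambda>z. a k (fst z) * b 0 (snd z))" if "k \<le> p" for k
    using that by (simp add: tens_def fun_eq_iff)
  have t2: "tens p a b k = (\<lambda>z. a 0 (fst z) * b (k - p) (snd z))" if "p < k" for k
    using that by (simp add: tens_def fun_eq_iff)
  have "sqi P (tens p a b k)" if "k \<le> p + q" for k
  proof (cases "k \<le> p")
    case True
    then show ?thesis unfolding t1[OF True] by (intro pair.sqi_tensor a' b') auto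
  next
    case False
    then have k: "p < k" by simp
    show ?thesis unfolding t2[OF k] using that by (intro pair.sqi_tensor a' b') auto
  qed
  moreover have "is_weak_pderiv (p + q) \<Omega> k (unjoin (tens p a b 0)) (unjoin (tens p a b (Suc k)))"
    if k: "k < p + q" for k
  proof (cases "k < p")
    case True
    then have "Suc k \<le> p" by simp
    have "is_weak_pderiv p \<Omega>1 k (a 0) (a (Suc k))" using a True by (simp add: H1_tuples_def)
    then show ?thesis
      unfolding t1[OF \<open>Suc k \<le> p\<close>] t1[OF le0] using True by (intro weak_pderiv_tensor1 a' b') auto
  next
    case False
    define j where "j = k - p"
    have j: "j < q" "k = p + j" using False k by (auto simp: j_def)
    have t: "tens p a b (Suc (p + j)) = (\<lambda>z. a 0 (fst z) * b (Suc j) (snd z))"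
      by (simp add: tens_def fun_eq_iff)
    have "is_weak_pderiv q \<Omega>2 j (b 0) (b (Suc j))" using b j by (simp add: H1_tuples_def)
    then show ?thesis
      unfolding j(2) t t1[OF le0] using j by (intro weak_pderiv_tensor2 a' b') auto
  qed
  ultimately show ?thesis
    unfolding V_def H1_tuples_def by (simp add: sqi_unjoin)
qed

text \<open>The weak derivative tested on products, where the derivative hits one factor only. The
  other factor can then be replaced by arbitrary square-integrable functions, by density.\<close>

lemma V_weak_tensor:
  assumes w: "w \<in> V" and \<phi>: "\<phi> \<in> test_functions p \<Omega>1" and \<psi>: "\<psi> \<in> test_functions q \<Omega>2"
  shows "k < p \<Longrightarrow> ip P (w 0) (\<lambda>z. cnj (pderiv_at k \<phi> (fst z)) * cnj (\<psi> (snd z))) +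
      ip P (w (Suc k)) (\<lambda>z. cnj (\<phi> (fst z)) * cnj (\<psi> (snd z))) = 0"
    and "j < q \<Longrightarrow> ip P (w 0) (\<lambda>z. cnj (\<phi> (fst z)) * cnj (pderiv_at j \<psi> (snd z))) +
      ip P (w (Suc (p + j))) (\<lambda>z. cnj (\<phi> (fst z)) * cnj (\<psi> (snd z))) = 0"
proof -
  define \<Phi> where "\<Phi> = (\<lambda>z. \<phi> (pr1 p z) * \<psi> (pr2 p q z))"
  have \<Phi>: "\<Phi> \<in> test_functions (p + q) \<Omega>" unfolding \<Phi>_def by (rule tensor_test_function[OF \<phi> \<psi>])
  have \<Phi>J: "\<Phi> (J z) = \<phi> (fst z) * \<psi> (snd z)" if "z \<in> space P" for z
    using that by (simp add: \<Phi>_def pr_J)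
  have main: "(LINT z|P. w 0 z * pderiv_at k \<Phi> (J z)) + (LINT z|P. w (Suc k) z * (\<phi> (fst z) * \<psi> (snd z))) = 0"
    if k: "k < p + q" for k
  proof -
    have "(LINT z|D.M. unjoin (w 0) z * pderiv_at k \<Phi> z) = - (LINT z|D.M. unjoin (w (Suc k)) z * \<Phi> z)"
      using w \<Phi> k by (simp add: V_def H1_tuples_def is_weak_pderiv_def)
    moreover have "(LINT z|D.M. unjoin (w 0) z * pderiv_at k \<Phi> z) = (LINT z|P. w 0 z * pderiv_at k \<Phi> (J z))"
      by (rule integral_unjoin_mult[OF V_sqi[OF w] D.pderiv_at_sqi[OF \<Phi> k]]) simp
    moreover have "(LINT z|D.M. unjoin (w (Suc k)) z * \<Phi> z) = (LINT z|P. w (Suc k) z * \<Phi> (J z))"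
      using k by (intro integral_unjoin_mult[OF V_sqi[OF w] D.test_functions_sqi[OF \<Phi>]]) simp
    ultimately show ?thesis by (simp add: \<Phi>J cong: Bochner_Integration.integral_cong)
  qed
  have Jext: "J z \<in> ext (p + q)" for z by (rule join_ext)
  show "ip P (w 0) (\<lambda>z. cnj (pderiv_at k \<phi> (fst z)) * cnj (\<psi> (snd z))) +
      ip P (w (Suc k)) (\<lambda>z. cnj (\<phi> (fst z)) * cnj (\<psi> (snd z))) = 0" if k: "k < p"
  proof -
    have "pderiv_at k \<Phi> (J z) = pderiv_at k \<phi> (fst z) * \<psi> (snd z)" if "z \<in> space P" for z
      unfolding \<Phi>_def using pderiv_at_tensor(1)[OF \<phi> \<psi> Jext[of z] k] that by (simp add: pr_J)
    then show ?thesis using main[of k] k by (simp add: ip_def cong: Bochner_Integration.integral_cong)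
  qed
  show "ip P (w 0) (\<lambda>z. cnj (\<phi> (fst z)) * cnj (pderiv_at j \<psi> (snd z))) +
      ip P (w (Suc (p + j))) (\<lambda>z. cnj (\<phi> (fst z)) * cnj (\<psi> (snd z))) = 0" if j: "j < q"
  proof -
    have "pderiv_at (p + j) \<Phi> (J z) = \<phi> (fst z) * pderiv_at j \<psi> (snd z)" if "z \<in> space P" for z
      unfolding \<Phi>_def using pderiv_at_tensor(2)[OF \<phi> \<psi> Jext[of z] j] that by (simp add: pr_J)
    then show ?thesis using main[of "p + j"] j by (simp add: ip_def cong: Bochner_Integration.integral_cong)
  qed
qed

text \<open>With the test function \<phi> in the first variable fixed, the claim says that s, a
  function of the second variable, is orthogonal to g. Since w has weak derivatives, s is orthogonal
  to the conjugates of all bumps, hence to every g.\<close>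

lemma slice2_in_H1:
  assumes w: "w \<in> V" and g: "sqi D2.M g"
  shows "(\<lambda>k. slice2 D2.M (w k) g) \<in> H1_tuples p \<Omega>1"
proof -
  have "is_weak_pderiv p \<Omega>1 k (slice2 D2.M (w 0) g) (slice2 D2.M (w (Suc k)) g)" if k: "k < p" for k
    unfolding is_weak_pderiv_def
  proof
    fix \<phi> assume \<phi>: "\<phi> \<in> test_functions p \<Omega>1"
    define \<alpha> where "\<alpha> = (\<lambda>x. cnj (pderiv_at k \<phi> x))"
    define \<beta> where "\<beta> = (\<lambda>x. cnj (\<phi> x))"
    have \<alpha>: "sqi D1.M \<alpha>" unfolding \<alpha>_def by (intro sqi_cnj D1.pderiv_at_sqi \<phi> k)
    have \<beta>: "sqi D1.M \<beta>" unfolding \<beta>_def by (intro sqi_cnj D1.test_functions_sqi \<phi>)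
    have w0: "sqi P (w 0)" "sqi P (w (Suc k))" using k by (auto intro!: V_sqi[OF w])
    define s where "s = (\<lambda>y. slice1 D1.M (w 0) \<alpha> y + slice1 D1.M (w (Suc k)) \<beta> y)"
    have s12: "sqi D2.M (slice1 D1.M (w 0) \<alpha>)" "sqi D2.M (slice1 D1.M (w (Suc k)) \<beta>)"
      by (intro pair.sqi_slice1 w0 \<alpha> \<beta>)+
    have s: "sqi D2.M s" unfolding s_def by (intro sqi_add s12)
    have sg: "ip D2.M s g' = ip P (w 0) (\<lambda>z. \<alpha> (fst z) * g' (snd z)) + ip P (w (Suc k)) (\<lambda>z. \<beta> (fst z) * g' (snd z))"
      if g': "sqi D2.M g'" for g'
      unfolding s_def using s12 g' w0 \<alpha> \<beta> by (simp add: ip_add_left pair.ip_slice1)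
    have "ip D2.M s g = 0"
    proof (rule D2.ip_eq_zero_if_bump[OF s g])
      fix \<psi> assume \<psi>: "\<psi> \<in> bump_span q \<Omega>2"
      have \<psi>t: "\<psi> \<in> test_functions q \<Omega>2" by (rule bump_span_test_functions[OF \<psi>])
      have "sqi D2.M (\<lambda>y. cnj (\<psi> y))" by (intro sqi_cnj D2.bump_span_sqi \<psi>)
      from sg[OF this] show "ip D2.M s (\<lambda>y. cnj (\<psi> y)) = 0"
        using V_weak_tensor(1)[OF w \<phi> \<psi>t k] by (simp add: \<alpha>_def \<beta>_def)
    qed
    then have "ip D1.M (slice2 D2.M (w 0) g) \<alpha> + ip D1.M (slice2 D2.M (w (Suc k)) g) \<beta> = 0"
      using sg[OF g] w0 \<alpha> \<beta> g by (simp add: pair.ip_slice2)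
    then show "(LINT x|D1.M. slice2 D2.M (w 0) g x * pderiv_at k \<phi> x) = - (LINT x|D1.M. slice2 D2.M (w (Suc k)) g x * \<phi> x)"
      by (simp add: integral_mult_eq_ip \<alpha>_def \<beta>_def add_eq_0_iff2)
  qed
  moreover have "sqi D1.M (slice2 D2.M (w k) g)" if "k \<le> p" for k
    using that by (intro pair.sqi_slice2 V_sqi[OF w] g) simp
  ultimately show ?thesis by (simp add: H1_tuples_def)
qed

lemma slice1_in_H1:
  assumes w: "w \<in> V" and f: "sqi D1.M f"
  shows "(\<lambda>k. slice1 D1.M (drop_first p w k) f) \<in> H1_tuples q \<Omega>2"
proof -
  have "is_weak_pderiv q \<Omega>2 j (slice1 D1.M (w 0) f) (slice1 D1.M (w (Suc (p + j))) f)" if j: "j < q" for j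
    unfolding is_weak_pderiv_def
  proof
    fix \<phi> assume \<phi>: "\<phi> \<in> test_functions q \<Omega>2"
    define \<alpha> where "\<alpha> = (\<lambda>y. cnj (pderiv_at j \<phi> y))"
    define \<beta> where "\<beta> = (\<lambda>y. cnj (\<phi> y))"
    have \<alpha>: "sqi D2.M \<alpha>" unfolding \<alpha>_def by (intro sqi_cnj D2.pderiv_at_sqi \<phi> j)
    have \<beta>: "sqi D2.M \<beta>" unfolding \<beta>_def by (intro sqi_cnj D2.test_functions_sqi \<phi>)
    have w0: "sqi P (w 0)" "sqi P (w (Suc (p + j)))" using j by (auto intro!: V_sqi[OF w])
    define s where "s = (\<lambda>x. slice2 D2.M (w 0) \<alpha> x + slice2 D2.M (w (Suc (p + j))) \<beta> x)"
    have s12: "sqi D1.M (slice2 D2.M (w 0) \<alpha>)" "sqi D1.M (slice2 D2.M (w (Suc (p + j))) \<beta>)"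
      by (intro pair.sqi_slice2 w0 \<alpha> \<beta>)+
    have s: "sqi D1.M s" unfolding s_def by (intro sqi_add s12)
    have sg: "ip D1.M s g' = ip P (w 0) (\<lambda>z. g' (fst z) * \<alpha> (snd z)) + ip P (w (Suc (p + j))) (\<lambda>z. g' (fst z) * \<beta> (snd z))"
      if g': "sqi D1.M g'" for g'
      unfolding s_def using s12 g' w0 \<alpha> \<beta> by (simp add: ip_add_left pair.ip_slice2)
    have "ip D1.M s f = 0"
    proof (rule D1.ip_eq_zero_if_bump[OF s f])
      fix \<psi> assume \<psi>: "\<psi> \<in> bump_span p \<Omega>1"
      have \<psi>t: "\<psi> \<in> test_functions p \<Omega>1" by (rule bump_span_test_functions[OF \<psi>])
      have "sqi D1.M (\<lambda>y. cnj (\<psi> y))" by (intro sqi_cnj D1.bump_span_sqi \<psi>)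
      from sg[OF this] show "ip D1.M s (\<lambda>y. cnj (\<psi> y)) = 0"
        using V_weak_tensor(2)[OF w \<psi>t \<phi> j] by (simp add: \<alpha>_def \<beta>_def)
    qed
    then have "ip D2.M (slice1 D1.M (w 0) f) \<alpha> + ip D2.M (slice1 D1.M (w (Suc (p + j))) f) \<beta> = 0"
      using sg[OF f] w0 \<alpha> \<beta> f by (simp add: pair.ip_slice1)
    then show "(LINT y|D2.M. slice1 D1.M (w 0) f y * pderiv_at j \<phi> y) = - (LINT y|D2.M. slice1 D1.M (w (Suc (p + j))) f y * \<phi> y)"
      by (simp add: integral_mult_eq_ip \<alpha>_def \<beta>_def add_eq_0_iff2)
  qed
  moreover have "sqi D2.M (slice1 D1.M (drop_first p w k) f)" if "k \<le> q" for k
    using that by (intro pair.sqi_slice1 f) (auto simp: drop_first_def intro!: V_sqi[OF w])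
  ultimately show ?thesis by (simp add: H1_tuples_def drop_first_def)
qed

text \<open>Bumps are products over the coordinates and thus elementary tensors; the density of
  bumps on \<Omega> therefore contains that of tensors.\<close>

lemma bump_join:
  "bump (p + q) m l h (join p q x y) = bump p m l h x * bump q m (\<lambda>i. l (p + i)) (\<lambda>i. h (p + i)) y"
proof -
  have split: "(\<Prod>i<p + n. F i) = (\<Prod>i<p. F i) * (\<Prod>i<n. F (p + i))" for F :: "nat \<Rightarrow> complex" and n
    by (induction n) (simp_all add: mult.assoc[symmetric])
  show ?thesis
    unfolding bump_def split by (intro arg_cong2[where f = "(*)"] prod.cong) (simp_all add: join_def)
qed

lemma bump_span_join:
  "\<psi> \<in> bump_span (p + q) \<Omega> \<Longrightarrow> \<exists>(n::nat) f g. (\<forall>l<n. sqi D1.M (f l) \<and> sqi D2.M (g l)) \<and>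
    (\<forall>z. \<psi> (J z) = (\<Sum>l<n. f l (fst z) * g l (snd z)))"
proof (induction rule: bump_span.induct)
  case zero
  show ?case by (intro exI[of _ 0]) simp
next
  case (step \<psi> l h c m)
  then obtain n :: nat and f g where fg: "\<forall>l<n. sqi D1.M (f l) \<and> sqi D2.M (g l)"
    "\<forall>z. \<psi> (J z) = (\<Sum>l<n. f l (fst z) * g l (snd z))" by (elim exE conjE)
  define f' where "f' = f(n := (\<lambda>x. c * bump p m l h x))"
  define g' where "g' = g(n := bump q m (\<lambda>i. l (p + i)) (\<lambda>i. h (p + i)))"
  have "sqi D1.M (f' i) \<and> sqi D2.M (g' i)" if "i < Suc n" for i
    using that fg(1) D1.bump_sqi D2.bump_sqi by (cases "i = n") (simp_all add: f'_def g'_def sqi_scale)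
  moreover have "\<psi> (J z) + c * bump (p + q) m l h (J z) = (\<Sum>l<Suc n. f' l (fst z) * g' l (snd z))" for z
    using fg(2) by (simp add: f'_def g'_def bump_join mult.assoc)
  ultimately show ?case by (intro exI[of _ "Suc n"] exI[of _ f'] exI[of _ g']) simp
qed

lemma tensors_dense:
  assumes h: "sqi P h" and \<epsilon>: "0 < \<epsilon>"
  shows "\<exists>(m::nat) f g. (\<forall>l<m. sqi D1.M (f l) \<and> sqi D2.M (g l)) \<and>
        nrm P (\<lambda>z. h z - (\<Sum>l<m. f l (fst z) * g l (snd z))) < \<epsilon>"
proof -
  have "unjoin h \<in> D.cl" using h by (intro D.bump_span_dense) (simp add: sqi_unjoin)
  then obtain \<psi> where \<psi>: "\<psi> \<in> bump_span (p + q) \<Omega>" "sqi D.M \<psi>" "nrm D.M (\<lambda>z. unjoin h z - \<psi> z) < \<epsilon>"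
    using \<epsilon> unfolding l2_closure_def by blast
  obtain n :: nat and f g where fg: "\<forall>l<n. sqi D1.M (f l) \<and> sqi D2.M (g l)"
    "\<forall>z. \<psi> (J z) = (\<Sum>l<n. f l (fst z) * g l (snd z))"
    using bump_span_join[OF \<psi>(1)] by (elim exE conjE)
  have "sqi D.M (\<lambda>z. unjoin h z - \<psi> z)" using h \<psi>(2) by (intro sqi_diff) (simp_all add: sqi_unjoin)
  then have "nrm D.M (\<lambda>z. unjoin h z - \<psi> z) = nrm P (\<lambda>z. unjoin h (J z) - \<psi> (J z))"
    by (intro nrm_J) (simp add: sqi_def)
  also have "\<dots> = nrm P (\<lambda>z. h z - (\<Sum>l<n. f l (fst z) * g l (snd z)))"
    using fg(2) by (intro nrm_cong) (simp add: unjoin_J)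
  finally show ?thesis using fg(1) \<psi>(3) by (intro exI[of _ n] exI[of _ f] exI[of _ g]) simp
qed

section \<open>The density theorem for two open domains\<close>

lemma tip_unjoin:
  assumes "\<And>k. k < N \<Longrightarrow> sqi P (u k)" "\<And>k. k < N \<Longrightarrow> sqi P (v k)"
  shows "tip D.M N (\<lambda>k. unjoin (u k)) (\<lambda>k. unjoin (v k)) = tip P N u v"
proof -
  have "ip D.M (unjoin (u k)) (unjoin (v k)) = ip P (u k) (v k)" if "k < N" for k
  proof -
    have "ip D.M (unjoin (u k)) (unjoin (v k)) = (LINT z|P. u k z * cnj (unjoin (v k) (J z)))"
      unfolding ip_def using assms that by (intro integral_unjoin_mult sqi_cnj) (simp_all add: sqi_unjoin)
    then show ?thesis by (simp add: ip_def unjoin_J cong: Bochner_Integration.integral_cong)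
  qed
  then show ?thesis by (simp add: tip_def)
qed

lemma tnorm_unjoin:
  assumes "\<And>k. k < N \<Longrightarrow> sqi P (u k)"
  shows "tnorm D.M N (\<lambda>k. unjoin (u k)) = tnorm P N u"
  unfolding tnorm_def using tip_unjoin[of N u u, OF assms assms] by simp

lemma V_tsubspace: "tsubspace P (Suc (p + q)) V"
proof
  note H = D.H1_tuples_tsubspace
  show "V \<subseteq> tsp P (Suc (p + q))" using V_sqi by (auto simp: tsp_def)
  show "(\<lambda>k x. 0) \<in> V"
    using tsubspace.zero[OF H] by (simp add: V_def unjoin_def[abs_def])
  show "(\<lambda>k x. u k x + v k x) \<in> V" if "u \<in> V" "v \<in> V" for u v
    using tsubspace.add[OF H, of "\<lambda>k. unjoin (u k)" "\<lambda>k. unjoin (v k)"] that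
    by (simp add: V_def unjoin_def[abs_def])
  show "(\<lambda>k x. c * u k x) \<in> V" if "u \<in> V" for u c
    using tsubspace.scale[OF H, of "\<lambda>k. unjoin (u k)" c] that
    by (simp add: V_def unjoin_def[abs_def])
qed

lemma V_weakly_closed:
  assumes w: "w \<in> V" and \<epsilon>: "0 < \<epsilon>"
  shows "\<exists>A\<ge>0. \<forall>v\<in>V. cmod (tip P (Suc (p + q)) w v) \<le> \<epsilon> * tnorm P (Suc (p + q)) v + A * nrm P (v 0)"
proof -
  have "(\<lambda>k. unjoin (w k)) \<in> H1_tuples (p + q) \<Omega>" using w by (simp add: V_def)
  from D.H1_tuples_weakly_closed[OF this \<epsilon>] obtain A where A: "A \<ge> 0"
    "\<forall>v\<in>H1_tuples (p + q) \<Omega>. cmod (tip D.M (Suc (p + q)) (\<lambda>k. unjoin (w k)) v)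
      \<le> \<epsilon> * tnorm D.M (Suc (p + q)) v + A * nrm D.M (v 0)"
    by (elim exE conjE)
  have "cmod (tip P (Suc (p + q)) w v) \<le> \<epsilon> * tnorm P (Suc (p + q)) v + A * nrm P (v 0)" if v: "v \<in> V" for v
  proof -
    have sq: "sqi P (w k)" "sqi P (v k)" if "k < Suc (p + q)" for k
      using that V_sqi[OF w, of k] V_sqi[OF v, of k] by simp_all
    have "(\<lambda>k. unjoin (v k)) \<in> H1_tuples (p + q) \<Omega>" using v by (simp add: V_def)
    from bspec[OF A(2) this] show ?thesis
      using sq by (simp add: tip_unjoin tnorm_unjoin nrm_unjoin)
  qed
  with A(1) show ?thesis by (intro exI[of _ A] conjI ballI)
qed

sublocale T: tensor_setting D1.M D2.M p q "H1_tuples p \<Omega>1" "H1_tuples q \<Omega>2" V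
proof (unfold tensor_setting_def tensor_setting_axioms_def, intro conjI allI impI)
  show "pair_sigma_finite D1.M D2.M" by (rule pair.pair_sigma_finite_axioms)
  show "tsubspace D1.M (Suc p) (H1_tuples p \<Omega>1)" by (rule D1.H1_tuples_tsubspace)
  show "tsubspace D2.M (Suc q) (H1_tuples q \<Omega>2)" by (rule D2.H1_tuples_tsubspace)
  show "tsubspace P (Suc (p + q)) V" by (rule V_tsubspace)
qed (fact tens_in_V slice1_in_H1 slice2_in_H1 tensors_dense V_weakly_closed)+

theorem H1_tuples_dense:
  assumes u: "u \<in> H1_tuples (p + q) \<Omega>" and \<epsilon>: "0 < \<epsilon>"
  shows "\<exists>(m::nat) a b. (\<forall>l<m. a l \<in> H1_tuples p \<Omega>1 \<and> b l \<in> H1_tuples q \<Omega>2) \<and>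
    tnorm D.M (Suc (p + q)) (\<lambda>k z. u k z - (\<Sum>l<m. unjoin (tens p (a l) (b l) k) z)) < \<epsilon>"
proof -
  define w where "w k z = u k (J z)" for k z
  have uw: "unjoin (w k) z = u k z" if "z \<in> \<Omega>" for k z
    using J_pr[OF that] by (simp add: unjoin_def w_def)
  \<comment> \<open>\<open>unjoin (w k)\<close> and \<open>u k\<close> agree on \<Omega> only, so
    membership in \<open>H1_tuples\<close> is transferred through the integrals.\<close>
  have int: "(LINT z|D.M. unjoin (w k) z * \<phi> z) = (LINT z|D.M. u k z * \<phi> z)" for k \<phi>
    by (rule Bochner_Integration.integral_cong) (simp_all add: uw D.space_M)
  have w: "w \<in> V"
  proof -
    have "is_weak_pderiv (p + q) \<Omega> k (unjoin (w 0)) (unjoin (w (Suc k)))" if "k < p + q" for k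
    proof -
      have "is_weak_pderiv (p + q) \<Omega> k (u 0) (u (Suc k))" using u that by (simp add: H1_tuples_def)
      then show ?thesis
        unfolding is_weak_pderiv_def
        by (simp only: int)
    qed
    moreover have "sqi D.M (unjoin (w k))" if "k < Suc (p + q)" for k
    proof -
      have "sqi D.M (unjoin (w k)) \<longleftrightarrow> sqi D.M (u k)" by (rule sqi_cong) (simp add: uw D.space_M)
      then show ?thesis using u that by (simp add: H1_tuples_def)
    qed
    ultimately show ?thesis by (simp add: V_def H1_tuples_def)
  qed
  obtain k where k: "k \<in> tens_span p (H1_tuples p \<Omega>1) (H1_tuples q \<Omega>2)"
    "tnorm P (Suc (p + q)) (\<lambda>i z. w i z - k i z) < \<epsilon>"
    using T.tens_span_dense[OF w \<epsilon>] by blast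
  then obtain m :: nat and a b where keq: "k = (\<lambda>k z. \<Sum>l<m. tens p (a l) (b l) k z)"
    and ab: "\<forall>l<m. a l \<in> H1_tuples p \<Omega>1 \<and> b l \<in> H1_tuples q \<Omega>2"
    unfolding tens_span_def by (elim CollectE exE conjE)
  have kV: "k \<in> V" using k(1) T.tens_span_subset by blast
  have "(\<lambda>i z. w i z - k i z) \<in> V" by (rule tsubspace.diff[OF V_tsubspace w kV])
  then have "sqi P (\<lambda>z. w i z - k i z)" if "i < Suc (p + q)" for i
    using V_sqi[of "\<lambda>i z. w i z - k i z" i] that by simp
  then have "tnorm P (Suc (p + q)) (\<lambda>i z. w i z - k i z) =
      tnorm D.M (Suc (p + q)) (\<lambda>i. unjoin (\<lambda>z. w i z - k i z))"
    by (rule tnorm_unjoin[symmetric])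
  also have "\<dots> = tnorm D.M (Suc (p + q)) (\<lambda>i z. u i z - (\<Sum>l<m. unjoin (tens p (a l) (b l) i) z))"
  proof -
    have "nrm D.M (unjoin (\<lambda>z. w i z - k i z)) = nrm D.M (\<lambda>z. u i z - (\<Sum>l<m. unjoin (tens p (a l) (b l) i) z))" for i
    proof (rule nrm_cong)
      fix z assume "z \<in> space D.M"
      then show "unjoin (\<lambda>z. w i z - k i z) z = u i z - (\<Sum>l<m. unjoin (tens p (a l) (b l) i) z)"
        using uw[of z i] by (simp add: D.space_M keq unjoin_def)
    qed
    then have "(tnorm D.M (Suc (p + q)) (\<lambda>i. unjoin (\<lambda>z. w i z - k i z)))\<^sup>2 =
        (tnorm D.M (Suc (p + q)) (\<lambda>i z. u i z - (\<Sum>l<m. unjoin (tens p (a l) (b l) i) z)))\<^sup>2"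
      unfolding tnorm_power2 by simp
    then show ?thesis by simp
  qed
  finally show ?thesis using k(2) ab by (intro exI[of _ m] exI[of _ a] exI[of _ b]) simp
qed

text \<open>Only an inequality, as the product of the squared norms also has terms with derivatives
  in both factors at once. It shows that approximating one factor in \<open>H^1\<close> approximates
  the tensor.\<close>

lemma tnorm_tens_le:
  assumes a: "a \<in> H1_tuples p \<Omega>1" and b: "b \<in> H1_tuples q \<Omega>2"
  shows "tnorm D.M (Suc (p + q)) (\<lambda>k. unjoin (tens p a b k)) \<le> tnorm D1.M (Suc p) a * tnorm D2.M (Suc q) b"
proof (rule power2_le_imp_le)
  have a': "sqi D1.M (a k)" if "k \<le> p" for k by (rule D1.H1_tuples_sqi[OF a that])
  have b': "sqi D2.M (b k)" if "k \<le> q" for k by (rule D2.H1_tuples_sqi[OF b that])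
  have sq: "sqi P (tens p a b k)" if "k < Suc (p + q)" for k
    using V_sqi[OF tens_in_V[OF a b], of k] that by simp
  have "drop_first p (tens p a b) k = (\<lambda>z. a 0 (fst z) * b k (snd z))" for k
    by (auto simp: drop_first_def tens_def fun_eq_iff)
  then have "nrm P (drop_first p (tens p a b) k) = nrm D1.M (a 0) * nrm D2.M (b k)" if "k < Suc q" for k
    using pair.nrm_tensor[OF a'[of 0] b'[of k]] that by simp
  then have 1: "(tnorm P (Suc q) (drop_first p (tens p a b)))\<^sup>2 = (nrm D1.M (a 0))\<^sup>2 * (tnorm D2.M (Suc q) b)\<^sup>2"
    unfolding tnorm_power2 sum_distrib_left by (intro sum.cong) (simp_all add: power_mult_distrib)
  have 2: "(nrm P (tens p a b (Suc i)))\<^sup>2 \<le> (nrm D1.M (a (Suc i)))\<^sup>2 * (tnorm D2.M (Suc q) b)\<^sup>2" if "i < p" for i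
  proof -
    have "tens p a b (Suc i) = (\<lambda>z. a (Suc i) (fst z) * b 0 (snd z))"
      using that by (simp add: tens_def fun_eq_iff)
    then have "nrm P (tens p a b (Suc i)) = nrm D1.M (a (Suc i)) * nrm D2.M (b 0)"
      using pair.nrm_tensor[OF a'[of "Suc i"] b'[of 0]] that by simp
    also have "\<dots> \<le> nrm D1.M (a (Suc i)) * tnorm D2.M (Suc q) b"
      by (intro mult_left_mono nrm_le_tnorm) auto
    finally have "(nrm P (tens p a b (Suc i)))\<^sup>2 \<le> (nrm D1.M (a (Suc i)) * tnorm D2.M (Suc q) b)\<^sup>2"
      by (rule power_mono) simp
    then show ?thesis by (simp add: power_mult_distrib)
  qed
  have "(tnorm D.M (Suc (p + q)) (\<lambda>k. unjoin (tens p a b k)))\<^sup>2 = (tnorm P (Suc (p + q)) (tens p a b))\<^sup>2"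
    using tnorm_unjoin[of "Suc (p + q)" "tens p a b", OF sq] by simp
  also have "\<dots> \<le> (nrm D1.M (a 0))\<^sup>2 * (tnorm D2.M (Suc q) b)\<^sup>2 +
      (\<Sum>i<p. (nrm D1.M (a (Suc i)))\<^sup>2 * (tnorm D2.M (Suc q) b)\<^sup>2)"
    unfolding tnorm_split 1 by (intro add_left_mono sum_mono 2) simp
  also have "\<dots> = (tnorm D1.M (Suc p) a * tnorm D2.M (Suc q) b)\<^sup>2"
    unfolding power_mult_distrib tnorm_power2[of D1.M] sum.lessThan_Suc_shift
    by (simp add: distrib_right sum_distrib_right)
  finally show "(tnorm D.M (Suc (p + q)) (\<lambda>k. unjoin (tens p a b k)))\<^sup>2 \<le>
      (tnorm D1.M (Suc p) a * tnorm D2.M (Suc q) b)\<^sup>2" .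
qed simp

end

section \<open>Products of several domains\<close>

lemma block_pr1: "j < n \<Longrightarrow> block d j (pr1 (total_dim n d) z) = block d j z"
proof -
  assume j: "j < n"
  have "(\<Sum>l<j. d l) + i < total_dim n d" if "i < d j" for i
  proof -
    have "(\<Sum>l<Suc j. d l) \<le> total_dim n d"
      unfolding total_dim_def using j by (intro sum_mono2) auto
    then show ?thesis using that by simp
  qed
  then show ?thesis by (auto simp: block_def pr1_def fun_eq_iff)
qed

lemma block_eq_pr2: "block d n z = pr2 (total_dim n d) (d n) z"
  by (simp add: block_def pr2_def total_dim_def)

lemma total_dim_Suc: "total_dim (Suc n) d = total_dim n d + d n"
  by (simp add: total_dim_def)

text \<open>Grouping all factors but the last makes the case of two domains the induction
  step.\<close>

lemma prod_dom_Suc: "prod_dom (Suc n) d \<Omega> = dom2 (total_dim n d) (d n) (prod_dom n d \<Omega>) (\<Omega> n)"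
proof -
  have "(\<forall>j<Suc n. block d j z \<in> \<Omega> j) \<longleftrightarrow> (\<forall>j<n. block d j (pr1 (total_dim n d) z) \<in> \<Omega> j) \<and>
      pr2 (total_dim n d) (d n) z \<in> \<Omega> n" for z
    by (auto simp: less_Suc_eq block_pr1 block_eq_pr2[of d n])
  then show ?thesis
    using pr1_ext by (simp add: prod_dom_def dom2_def total_dim_Suc)
qed

lemma prod_dom_open:
  "(\<And>j. j < n \<Longrightarrow> openin (powertop_real {..<d j}) (\<Omega> j)) \<Longrightarrow>
    openin (powertop_real {..<total_dim n d}) (prod_dom n d \<Omega>)"
proof (induction n)
  case 0
  have "prod_dom 0 d \<Omega> = topspace (powertop_real {..<total_dim 0 d})"
    by (simp add: prod_dom_def)
  then show ?case using openin_topspace by metis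
next
  case (Suc n)
  interpret two_domains "total_dim n d" "d n" "prod_dom n d \<Omega>" "\<Omega> n"
    using Suc by (simp add: two_domains_def open_domain_def)
  show ?case unfolding prod_dom_Suc total_dim_Suc by (rule \<Omega>_open)
qed

lemma tensor_span_zero: "(\<lambda>x. 0) \<in> tensor_span n d \<H>"
  unfolding tensor_span_def by (intro CollectI exI[of _ 0]) simp

lemma tensor_span_add:
  assumes f: "f \<in> tensor_span n d \<H>" and g: "g \<in> tensor_span n d \<H>"
  shows "(\<lambda>x. f x + g x) \<in> tensor_span n d \<H>"
proof -
  obtain m :: nat and c F where 1: "f = (\<lambda>x. \<Sum>i<m. c i * elem_tensor n d (F i) x)"
    "\<forall>i<m. \<forall>j<n. F i j \<in> \<H> j"
    using f unfolding tensor_span_def by (elim CollectE exE conjE)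
  obtain m' :: nat and c' F' where 2: "g = (\<lambda>x. \<Sum>i<m'. c' i * elem_tensor n d (F' i) x)"
    "\<forall>i<m'. \<forall>j<n. F' i j \<in> \<H> j"
    using g unfolding tensor_span_def by (elim CollectE exE conjE)
  define C where "C i = (if i < m then c i else c' (i - m))" for i
  define G where "G i = (if i < m then F i else F' (i - m))" for i
  have "(\<Sum>i<m + m'. C i * elem_tensor n d (G i) x) = f x + g x" for x
  proof -
    have split: "(\<Sum>i<m + l. H i) = (\<Sum>i<m. H i) + (\<Sum>i<l. H (m + i))" for H :: "nat \<Rightarrow> complex" and l
      by (induction l) (simp_all add: add.assoc)
    show ?thesis unfolding split by (simp add: C_def G_def 1(1) 2(1))
  qed
  moreover have "G i j \<in> \<H> j" if "i < m + m'" "j < n" for i j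
    using that 1(2) 2(2) by (simp add: G_def)
  ultimately show ?thesis
    unfolding tensor_span_def by (intro CollectI exI[of _ "m + m'"] exI[of _ C] exI[of _ G]) simp
qed

lemma tensor_span_sum:
  "(\<And>i. i \<in> I \<Longrightarrow> f i \<in> tensor_span n d \<H>) \<Longrightarrow> (\<lambda>x. \<Sum>i\<in>I. f i x) \<in> tensor_span n d \<H>"
  by (induction I rule: infinite_finite_induct) (auto simp: tensor_span_zero intro!: tensor_span_add)

lemma tensor_span_Suc:
  assumes g: "g \<in> tensor_span n d \<H>" and h: "h \<in> \<H> n"
  shows "(\<lambda>z. g (pr1 (total_dim n d) z) * h (pr2 (total_dim n d) (d n) z)) \<in> tensor_span (Suc n) d \<H>"
proof -
  obtain m :: nat and c F where g: "g = (\<lambda>x. \<Sum>i<m. c i * elem_tensor n d (F i) x)"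
    "\<forall>i<m. \<forall>j<n. F i j \<in> \<H> j"
    using g unfolding tensor_span_def by (elim CollectE exE conjE)
  have "elem_tensor (Suc n) d ((F i)(n := h)) z =
      elem_tensor n d (F i) (pr1 (total_dim n d) z) * h (pr2 (total_dim n d) (d n) z)" for i z
    by (simp add: elem_tensor_def block_pr1 block_eq_pr2[of d n])
  then have "(\<lambda>z. g (pr1 (total_dim n d) z) * h (pr2 (total_dim n d) (d n) z)) =
      (\<lambda>z. \<Sum>i<m. c i * elem_tensor (Suc n) d ((F i)(n := h)) z)"
    by (simp add: g(1) sum_distrib_right mult.assoc)
  moreover have "((F i)(n := h)) j \<in> \<H> j" if "i < m" "j < Suc n" for i j
    using that g(2) h by (cases "j = n") simp_all
  ultimately show ?thesis
    unfolding tensor_span_def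
    by (intro CollectI exI[of _ m] exI[of _ c] exI[of _ "\<lambda>i. (F i)(n := h)"]) simp
qed

text \<open>The case of two domains yields sums of a \<otimes> b with a on the first n domains
  grouped together; by the induction hypothesis each a is near the span of elementary tensors in
  \<open>H^1\<close>, and tensoring with b preserves this up to the norm of b.\<close>

lemma tensor_span_dense:
  assumes "\<And>j. j < n \<Longrightarrow> openin (powertop_real {..<d j}) (\<Omega> j)"
    and "u \<in> H1_tuples (total_dim n d) (prod_dom n d \<Omega>)" and "0 < \<epsilon>"
  shows "\<exists>k\<in>H1_tuples (total_dim n d) (prod_dom n d \<Omega>).
    k 0 \<in> tensor_span n d (\<lambda>j. H1 (d j) (\<Omega> j)) \<and>
    tnorm (lebesgue_dom (total_dim n d) (prod_dom n d \<Omega>)) (Suc (total_dim n d)) (\<lambda>i x. u i x - k i x) < \<epsilon>"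
  using assms
proof (induction n arbitrary: u \<epsilon>)
  case 0
  let ?M = "lebesgue_dom (total_dim 0 d) (prod_dom 0 d \<Omega>)"
  interpret open_domain "total_dim 0 d" "prod_dom 0 d \<Omega>"
    by (simp add: open_domain_def prod_dom_open)
  have sp: "x = (\<lambda>_. undefined)" if "x \<in> space ?M" for x
    using that[unfolded space_M] by (auto simp: prod_dom_def total_dim_def)
  \<comment> \<open>In dimension 0 the domain is a single point and there are no derivatives, so u
    is constant; the empty elementary tensor is 1, and its multiples are the constants.\<close>
  define k where "k = (\<lambda>(i::nat) (x::point). u 0 (\<lambda>_. undefined))"
  have eq: "u 0 x = k 0 x" if "x \<in> space ?M" for x using sp[OF that] by (simp add: k_def)
  have "sqi ?M (u 0) \<longleftrightarrow> sqi ?M (k 0)" by (rule sqi_cong[OF eq])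
  then have "k \<in> H1_tuples (total_dim 0 d) (prod_dom 0 d \<Omega>)"
    using 0 by (simp add: H1_tuples_def total_dim_def)
  moreover have "k 0 \<in> tensor_span 0 d (\<lambda>j. H1 (d j) (\<Omega> j))"
    unfolding tensor_span_def
    by (intro CollectI exI[of _ 1] exI[of _ "\<lambda>_. u 0 (\<lambda>_. undefined)"]) (simp add: k_def elem_tensor_def)
  moreover have "nrm ?M (\<lambda>x. u 0 x - k 0 x) = nrm ?M (\<lambda>x. 0)"
    by (rule nrm_cong) (simp add: eq)
  then have "(tnorm ?M (Suc (total_dim 0 d)) (\<lambda>i x. u i x - k i x))\<^sup>2 = 0"
    by (simp add: tnorm_power2 total_dim_def nrm_def ip_def)
  ultimately show ?case using 0 by auto
next
  case (Suc n)
  let ?p = "total_dim n d" and ?q = "d n"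
  interpret two_domains ?p ?q "prod_dom n d \<Omega>" "\<Omega> n"
    using Suc.prems(1) prod_dom_open[of n d \<Omega>] by (simp add: two_domains_def open_domain_def)
  let ?H = "\<lambda>j. H1 (d j) (\<Omega> j)"
  have \<epsilon>: "0 < \<epsilon> / 2" using Suc.prems by simp
  have u: "u \<in> H1_tuples (?p + ?q) (dom2 ?p ?q (prod_dom n d \<Omega>) (\<Omega> n))"
    using Suc.prems(2) by (simp add: prod_dom_Suc total_dim_Suc)
  obtain m :: nat and a b where ab: "\<forall>l<m. a l \<in> H1_tuples ?p (prod_dom n d \<Omega>) \<and> b l \<in> H1_tuples ?q (\<Omega> n)"
    and close: "tnorm D.M (Suc (?p + ?q)) (\<lambda>k z. u k z - (\<Sum>l<m. unjoin (tens ?p (a l) (b l) k) z)) < \<epsilon> / 2"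
    using H1_tuples_dense[OF u \<epsilon>] by (elim exE conjE)
  \<comment> \<open>Each of the m terms may cost \<epsilon> / 2 divided by \<open>Suc m\<close>. The
    two increments by 1 keep the quotient defined when m = 0 or \<open>b l\<close> has norm
    0.\<close>
  define \<eta> where "\<eta> l = \<epsilon> / 2 / (real (Suc m) * (tnorm D2.M (Suc ?q) (b l) + 1))" for l
  have B: "0 < tnorm D2.M (Suc ?q) (b l) + 1" for l
    using tnorm_nonneg[of D2.M "Suc ?q" "b l"] by linarith
  have \<eta>: "0 < \<eta> l" for l
    unfolding \<eta>_def using \<epsilon> B[of l] by (intro divide_pos_pos mult_pos_pos) auto
  define Q where "Q l k \<longleftrightarrow> k \<in> H1_tuples ?p (prod_dom n d \<Omega>) \<and> k 0 \<in> tensor_span n d ?H \<and>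
      tnorm D1.M (Suc ?p) (\<lambda>i x. a l i x - k i x) < \<eta> l" for l k
  have "\<exists>k. Q l k" if "l < m" for l
  proof -
    have "a l \<in> H1_tuples ?p (prod_dom n d \<Omega>)" using ab that by simp
    moreover have "openin (powertop_real {..<d j}) (\<Omega> j)" if "j < n" for j
      using Suc.prems(1)[of j] that by simp
    ultimately obtain k where "k \<in> H1_tuples ?p (prod_dom n d \<Omega>)" "k 0 \<in> tensor_span n d ?H"
      "tnorm D1.M (Suc ?p) (\<lambda>i x. a l i x - k i x) < \<eta> l"
      using Suc.IH[of "a l" "\<eta> l"] \<eta>[of l] by (elim meta_impE) auto
    then have "Q l k" by (simp add: Q_def)
    then show ?thesis by (rule exI[of "Q l" k])
  qed
  then obtain k where "\<And>l. l < m \<Longrightarrow> Q l (k l)" by metis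
  then have k: "k l \<in> H1_tuples ?p (prod_dom n d \<Omega>)" "k l 0 \<in> tensor_span n d ?H"
    "tnorm D1.M (Suc ?p) (\<lambda>i x. a l i x - k l i x) < \<eta> l" if "l < m" for l
    using that by (simp_all add: Q_def)
  define E where "E = (\<lambda>i z. \<Sum>l<m. unjoin (tens ?p (k l) (b l) i) z)"
  define A where "A = (\<lambda>i z. \<Sum>l<m. unjoin (tens ?p (a l) (b l) i) z)"
  interpret H: tsubspace D.M "Suc (?p + ?q)" "H1_tuples (?p + ?q) (dom2 ?p ?q (prod_dom n d \<Omega>) (\<Omega> n))"
    by (rule D.H1_tuples_tsubspace)
  have tH: "(\<lambda>i. unjoin (tens ?p a' b' i)) \<in> H1_tuples (?p + ?q) (dom2 ?p ?q (prod_dom n d \<Omega>) (\<Omega> n))"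
    if "a' \<in> H1_tuples ?p (prod_dom n d \<Omega>)" "b' \<in> H1_tuples ?q (\<Omega> n)" for a' b'
    using tens_in_V[OF that] by (simp add: V_def)
  have E: "E \<in> H1_tuples (?p + ?q) (dom2 ?p ?q (prod_dom n d \<Omega>) (\<Omega> n))"
    unfolding E_def by (rule H.sum) (use tH k ab in simp)
  have A: "A \<in> H1_tuples (?p + ?q) (dom2 ?p ?q (prod_dom n d \<Omega>) (\<Omega> n))"
    unfolding A_def by (rule H.sum) (use tH ab in simp)
  have E0: "E 0 \<in> tensor_span (Suc n) d ?H"
  proof -
    have "E 0 = (\<lambda>z. \<Sum>l<m. k l 0 (pr1 ?p z) * b l 0 (pr2 ?p ?q z))"
      by (simp add: E_def unjoin_def tens_def fun_eq_iff)
    moreover have "b l 0 \<in> H1 ?q (\<Omega> n)" if "l < m" for l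
      using ab that D2.H1_iff_tuple by auto
    ultimately show ?thesis by (simp only:) (intro tensor_span_sum tensor_span_Suc, auto simp: k)
  qed
  \<comment> \<open>\<open>tens\<close> is linear in its first factor, so the error is again a sum
    of tensors, to which the norm bound applies term by term.\<close>
  have diff: "(\<lambda>i z. A i z - E i z) = (\<lambda>i z. \<Sum>l<m. unjoin (tens ?p (\<lambda>i x. a l i x - k l i x) (b l) i) z)"
    unfolding A_def E_def sum_subtractf[symmetric]
    by (intro ext sum.cong refl) (simp add: unjoin_def tens_def left_diff_distrib)
  have ak: "(\<lambda>i x. a l i x - k l i x) \<in> H1_tuples ?p (prod_dom n d \<Omega>)" if "l < m" for l
    using ab k(1)[OF that] that by (intro tsubspace.diff[OF D1.H1_tuples_tsubspace]) simp_all
  have "tnorm D.M (Suc (?p + ?q)) (\<lambda>i z. A i z - E i z) \<le>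
      (\<Sum>l<m. tnorm D.M (Suc (?p + ?q)) (\<lambda>i. unjoin (tens ?p (\<lambda>i x. a l i x - k l i x) (b l) i)))"
    unfolding diff by (rule tnorm_sum_le) (use H.tsp[OF tH] ak ab in simp)
  also have "\<dots> \<le> (\<Sum>l<m. \<epsilon> / 2 / real (Suc m))"
  proof (rule sum_mono)
    fix l assume "l \<in> {..<m}"
    then have l: "l < m" by simp
    have "tnorm D.M (Suc (?p + ?q)) (\<lambda>i. unjoin (tens ?p (\<lambda>i x. a l i x - k l i x) (b l) i)) \<le>
        tnorm D1.M (Suc ?p) (\<lambda>i x. a l i x - k l i x) * tnorm D2.M (Suc ?q) (b l)"
      using ab l by (intro tnorm_tens_le ak) simp_all
    also have "\<dots> \<le> \<eta> l * (tnorm D2.M (Suc ?q) (b l) + 1)"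
      using k(3)[OF l] \<eta>[of l] by (intro mult_mono) auto
    also have "\<dots> = \<epsilon> / 2 / real (Suc m)"
      using B[of l] by (simp add: \<eta>_def del: of_nat_Suc)
    finally show "tnorm D.M (Suc (?p + ?q)) (\<lambda>i. unjoin (tens ?p (\<lambda>i x. a l i x - k l i x) (b l) i)) \<le>
        \<epsilon> / 2 / real (Suc m)" .
  qed
  also have "\<dots> = (\<epsilon> / 2) * (real m / real (Suc m))" by simp
  also have "\<dots> \<le> (\<epsilon> / 2) * 1" using \<epsilon> by (intro mult_left_mono) auto
  finally have AE: "tnorm D.M (Suc (?p + ?q)) (\<lambda>i z. A i z - E i z) \<le> \<epsilon> / 2" by simp
  have "tnorm D.M (Suc (?p + ?q)) (\<lambda>i z. (u i z - A i z) + (A i z - E i z)) \<le>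
      tnorm D.M (Suc (?p + ?q)) (\<lambda>i z. u i z - A i z) + tnorm D.M (Suc (?p + ?q)) (\<lambda>i z. A i z - E i z)"
    by (rule tnorm_add_le[OF H.tsp[OF H.diff[OF u A]] H.tsp[OF H.diff[OF A E]]])
  then have "tnorm D.M (Suc (?p + ?q)) (\<lambda>i z. u i z - E i z) < \<epsilon>"
    using close AE by (simp add: A_def)
  then show ?case
    using E E0 unfolding prod_dom_Suc total_dim_Suc by (intro bexI[of _ E] conjI)
qed

theorem H1_eq_tensor_space:
  assumes "\<And>j. j < n \<Longrightarrow> openin (powertop_real {..<d j}) (\<Omega> j)"
  shows "H1 (total_dim n d) (prod_dom n d \<Omega>) = tensor_space n d \<Omega> (\<lambda>j. H1 (d j) (\<Omega> j))"
proof
  let ?D = "total_dim n d" and ?W = "prod_dom n d \<Omega>"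
  interpret open_domain ?D ?W using prod_dom_open[OF assms] by (rule open_domain.intro)
  interpret H: tsubspace M "Suc ?D" "H1_tuples ?D ?W" by (rule H1_tuples_tsubspace)
  show "H1 ?D ?W \<subseteq> tensor_space n d \<Omega> (\<lambda>j. H1 (d j) (\<Omega> j))"
  proof
    fix f assume f: "f \<in> H1 ?D ?W"
    then obtain u where u: "u \<in> H1_tuples ?D ?W" "u 0 = f" unfolding H1_iff_tuple by blast
    have "\<exists>g\<in>tensor_span n d (\<lambda>j. H1 (d j) (\<Omega> j)). h1_norm ?D ?W (\<lambda>x. f x - g x) < \<epsilon>"
      if \<epsilon>: "0 < \<epsilon>" for \<epsilon>
    proof -
      obtain k where k: "k \<in> H1_tuples ?D ?W" "k 0 \<in> tensor_span n d (\<lambda>j. H1 (d j) (\<Omega> j))"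
        "tnorm M (Suc ?D) (\<lambda>i x. u i x - k i x) < \<epsilon>"
        using tensor_span_dense[OF assms u(1) \<epsilon>] by blast
      have "h1_norm ?D ?W (\<lambda>x. f x - k 0 x) = tnorm M (Suc ?D) (\<lambda>i x. u i x - k i x)"
        using h1_norm_eq[OF H.diff[OF u(1) k(1)]] u(2) by simp
      then show ?thesis using k by (intro bexI[of _ "k 0"]) simp_all
    qed
    then show "f \<in> tensor_space n d \<Omega> (\<lambda>j. H1 (d j) (\<Omega> j))"
      using f by (simp add: tensor_space_def h1_closure_def)
  qed
qed (auto simp: tensor_space_def h1_closure_def)

section \<open>Uniqueness of the operator of a form\<close>

lemma l2_inner_swap: "l2_inner d \<Omega> g f = cnj (l2_inner d \<Omega> f g)"
  using ip_swap[of "lebesgue_dom d \<Omega>" g f] by (simp add: l2_inner_def ip_def)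

lemma dirichlet_form_swap: "dirichlet_form d \<Omega> g f = cnj (dirichlet_form d \<Omega> f g)"
  unfolding dirichlet_form_def by (simp add: l2_inner_swap[of d \<Omega> "weak_pderiv d \<Omega> _ g"])

text \<open>For (f, h) in T and (g, k) in S, both f and g lie in the common form domain, so each may
  serve as the test function for the other operator. Hermitian symmetry of the form then gives <k,
  f> = <g, h>; hence (f, h) belongs to the adjoint of S, which is S.\<close>

lemma form_operator_subset:
  assumes T: "form_operator d \<Omega> H T" and S: "form_operator d \<Omega> H S"
  shows "T \<subseteq> S"
proof
  fix t assume t: "t \<in> T"
  obtain f h where fh: "t = (f, h)" by (cases t)
  have "f \<in> L2 d \<Omega>" "h \<in> L2 d \<Omega>" "f \<in> H"
    using T t fh by (auto simp: form_operator_def self_adjoint_def l2_operator_def)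
  moreover have "l2_inner d \<Omega> k f = l2_inner d \<Omega> g h" if gk: "(g, k) \<in> S" for g k
  proof -
    have "g \<in> H" using S gk by (auto simp: form_operator_def)
    then have "dirichlet_form d \<Omega> f g = l2_inner d \<Omega> h g"
      using T t fh by (fastforce simp: form_operator_def)
    moreover have "dirichlet_form d \<Omega> g f = l2_inner d \<Omega> k f"
      using S gk \<open>f \<in> H\<close> by (fastforce simp: form_operator_def)
    ultimately show ?thesis
      using dirichlet_form_swap[of d \<Omega> g f] l2_inner_swap[of d \<Omega> g h] by simp
  qed
  ultimately have "(f, h) \<in> adjoint_op d \<Omega> S" by (auto simp: adjoint_op_def)
  then show "t \<in> S" using S fh by (simp add: form_operator_def self_adjoint_def)
qed

theorem proposition3p2:
  fixes n :: nat and d :: "nat \<Rightarrow> nat" and \<Omega> :: "nat \<Rightarrow> (nat \<Rightarrow> real) set"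
  assumes "n \<ge> 2"
    and "\<And>j. j < n \<Longrightarrow> openin (powertop_real {..<d j}) (\<Omega> j)"
  shows "(\<forall>T L. form_operator (total_dim n d) (prod_dom n d \<Omega>)
                   (tensor_space n d \<Omega> (\<lambda>j. H1 (d j) (\<Omega> j))) T \<longrightarrow>
                 neumann_laplacian (total_dim n d) (prod_dom n d \<Omega>) L \<longrightarrow>
                 T = neg_op L) \<and>
         H1 (total_dim n d) (prod_dom n d \<Omega>) = tensor_space n d \<Omega> (\<lambda>j. H1 (d j) (\<Omega> j))"
proof (intro conjI allI impI)
  show eq: "H1 (total_dim n d) (prod_dom n d \<Omega>) = tensor_space n d \<Omega> (\<lambda>j. H1 (d j) (\<Omega> j))"
    by (rule H1_eq_tensor_space[OF assms(2)])
  fix T L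
  assume T: "form_operator (total_dim n d) (prod_dom n d \<Omega>) (tensor_space n d \<Omega> (\<lambda>j. H1 (d j) (\<Omega> j))) T"
    and L: "neumann_laplacian (total_dim n d) (prod_dom n d \<Omega>) L"
  \<comment> \<open>Rewriting \<open>H1\<close> into the tensor space gives both operators the same
    form domain, as their comparison requires.\<close>
  from L[unfolded neumann_laplacian_def eq]
  show "T = neg_op L" by (intro subset_antisym form_operator_subset[OF T] form_operator_subset[OF _ T])
qed

end
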